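(* Let $1<\gamma\le2$, $0<s<1/3$, $0<\beta<1$, and suppose $a\in L^\infty(0,T;C^\beta)$ with $a\ge a_*>0$ and $G\in L^2(0,T;H^{1-\gamma/2})$. Assume that $\|\mathcal A_\Psi^\gamma f\|_{H^{-\gamma/2}}\lesssim_\Psi\|f\|_{H^{\gamma/2}}$ when $1<\gamma<2$, and $\|\mathcal D_\Psi^2f\|_{L^2}+\|\mathcal A_\Psi^2f\|_{H^{-1}}\lesssim_\Psi\|f\|_{H^1}$ when $\gamma=2$. Every smooth solution $m$ on $[0,T]\times\mathbb T$ of $$m_t+\mathcal A_\Psi^\gamma m=\partial_y(am^2+G)$$ satisfies $$K_T^s(m)\lesssim_{a_*,\Psi}\|m(0)\|_{L^2}^2+\|m(T)\|_{L^2}^2+\int_0^T\|m(t)\|_{H^{\gamma/2}}^2\,dt+\|a\|_{L^\infty(0,T;C^\beta)}Z_T^\beta(m)+\|G\|_{L^2(0,T;H^{1-\gamma/2})}^2,$$ where $$K_T^s(m):=\int_0^T\int_0^1h^{-1-3s}\|\delta_hm(t)\|_{L^3}^3\,dh\,dt,\qquad Z_T^\beta(m):=\int_0^T\|m(t)^3\|_{B^{1-\beta}_{1,1}}\,dt.$$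
   Context: $\mathbb T=\mathbb R/\mathbb Z$; $\delta_hf(y)=f(y+h)-f(y)$; $B^s_{p,q}=B^s_{p,q}(\mathbb T)$. $\Lambda^s$ is the Fourier multiplier $|2\pi k|^s$ ($k\ne0$), zero at $k=0$; $\mathcal R_\gamma=\Lambda^{\gamma-2}\partial_x$; $f^\Theta=f\circ\Theta$ (spatial composition). Setting: $\Psi(t,x)=x+\psi(t,x)$ is, for each $t$, an orientation-preserving degree-one bi-Lipschitz map of $\mathbb T$ with $J=\partial_x\Psi$, $\Phi=\Psi^{-1}$; $\mathcal D_\Psi^\gamma f=[\mathcal R_\gamma(Jf^\Psi)+f^\Psi\Lambda^\gamma\psi]^\Phi$ and $\mathcal A_\Psi^\gamma=-\partial_y\mathcal D_\Psi^\gamma$; at $\gamma=2$, $\mathcal D_\Psi^2f=(J^2)^\Phi f_y$. In the transformed equation one has $a=(J^2)^\Phi$ and $G=2Q_\lambda m+R$, where, for $\lambda\ge0$ and a function $\ell$ (the linear response), $Q_\lambda=(\ell J)^\Phi+\frac\lambda2\psi^\Phi$ and $R=(\ell^2)^\Phi$. The implicit constant depends on $s,\beta,\gamma$, $a_*$ and on $\Psi$ (through the constants in the assumed operator bounds). *)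

theory Defs
  imports "HOL-Analysis.Analysis" "HOL-Probability.Essential_Supremum"
begin

text \<open>
  Functions on the circle \<open>\<real>/\<int>\<close> are 1-periodic functions on the real line, and \<open>{0..1}\<close> serves as
  fundamental domain. Periodic distributions are represented by their Fourier coefficients
  \<open>int \<Rightarrow> complex\<close>. All norms take values in \<^typ>\<open>ennreal\<close>, so that none of them (and no
  integral of one of them) silently degenerates to zero when it is infinite.
\<close>

definition periodic1 :: "(real \<Rightarrow> real) \<Rightarrow> bool" where
  "periodic1 f \<longleftrightarrow> (\<forall>x. f (x + 1) = f x)"

definition smooth_circle :: "(real \<Rightarrow> real) \<Rightarrow> bool" where
  "smooth_circle f \<longleftrightarrow> periodic1 f \<and> (\<forall>n x. (deriv ^^ n) f field_differentiable at x)"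

text \<open>
  Smoothness up to the boundary on \<open>[0,T] \<times> \<real>/\<int>\<close>. The family \<open>D i j\<close> consists of the mixed partial
  derivatives of order \<open>i\<close> in time (one-sided at \<open>t = 0\<close> and \<open>t = T\<close>) and \<open>j\<close> in space.
\<close>

definition smooth_spacetime :: "real \<Rightarrow> (real \<Rightarrow> real \<Rightarrow> real) \<Rightarrow> bool" where
  "smooth_spacetime T m \<longleftrightarrow>
     (\<forall>t\<in>{0..T}. periodic1 (m t)) \<and>
     (\<exists>D :: nat \<Rightarrow> nat \<Rightarrow> real \<Rightarrow> real \<Rightarrow> real.
        (\<forall>t\<in>{0..T}. \<forall>y. D 0 0 t y = m t y) \<and>
        (\<forall>i j. continuous_on ({0..T} \<times> UNIV) (\<lambda>(t, y). D i j t y)) \<and>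
        (\<forall>i j. \<forall>t\<in>{0..T}. \<forall>y.
           ((\<lambda>\<tau>. D i j \<tau> y) has_real_derivative D (Suc i) j t y) (at t within {0..T}) \<and>
           (D i j t has_real_derivative D i (Suc j) t y) (at y)))"

definition diff_op :: "real \<Rightarrow> (real \<Rightarrow> real) \<Rightarrow> real \<Rightarrow> real" where
  "diff_op h f y = f (y + h) - f y"


subsection \<open>Fourier coefficients and multipliers\<close>

definition fc :: "(real \<Rightarrow> real) \<Rightarrow> int \<Rightarrow> complex" where
  "fc f k = set_lebesgue_integral lborel {0..1}
              (\<lambda>x. complex_of_real (f x) * cis (- 2 * pi * of_int k * x))"

definition Dx :: "(int \<Rightarrow> complex) \<Rightarrow> int \<Rightarrow> complex" where
  "Dx c k = 2 * of_real pi * \<i> * of_int k * c k"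

definition Lam :: "real \<Rightarrow> (int \<Rightarrow> complex) \<Rightarrow> int \<Rightarrow> complex" where
  "Lam \<sigma> c k = (if k = 0 then 0 else of_real (\<bar>2 * pi * of_int k\<bar> powr \<sigma>) * c k)"

definition Riesz :: "real \<Rightarrow> (int \<Rightarrow> complex) \<Rightarrow> int \<Rightarrow> complex" where
  "Riesz \<gamma> c = Lam (\<gamma> - 2) (Dx c)"

text \<open>The Fourier coefficients of a product.\<close>

definition fconv :: "(int \<Rightarrow> complex) \<Rightarrow> (int \<Rightarrow> complex) \<Rightarrow> int \<Rightarrow> complex" where
  "fconv c d k = (\<Sum>\<^sub>\<infinity>j. c (k - j) * d j)"


subsection \<open>Norms\<close>

text \<open>The power \<open>x\<^sup>p\<close> for \<open>p > 0\<close>.\<close>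

definition ennpow :: "ennreal \<Rightarrow> real \<Rightarrow> ennreal" where
  "ennpow x p = (if x = top then top else ennreal (enn2real x powr p))"

definition Lp_norm :: "real \<Rightarrow> (real \<Rightarrow> real) \<Rightarrow> ennreal" where
  "Lp_norm p f = ennpow (\<integral>\<^sup>+x\<in>{0..1}. ennreal (\<bar>f x\<bar> powr p) \<partial>lborel) (1 / p)"

definition H_norm :: "real \<Rightarrow> (int \<Rightarrow> complex) \<Rightarrow> ennreal" where
  "H_norm r c = ennpow (\<Sum>\<^sub>\<infinity>k. ennreal ((1 + (2 * pi * of_int k)\<^sup>2) powr r * (cmod (c k))\<^sup>2)) (1 / 2)"

definition Hoelder_norm :: "real \<Rightarrow> (real \<Rightarrow> real) \<Rightarrow> ennreal" where
  "Hoelder_norm \<beta> f =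
     (SUP x. ennreal \<bar>f x\<bar>) +
     (SUP (x, y)\<in>{(x, y). x \<noteq> y}. ennreal (\<bar>f x - f y\<bar> / \<bar>x - y\<bar> powr \<beta>))"

text \<open>The first-order difference norm of \<open>B\<^sup>s\<^sub>p\<^sub>,\<^sub>q\<close>, valid for \<open>0 < s < 1\<close> and finite \<open>p\<close>, \<open>q\<close>.\<close>

definition Besov_norm :: "real \<Rightarrow> real \<Rightarrow> real \<Rightarrow> (real \<Rightarrow> real) \<Rightarrow> ennreal" where
  "Besov_norm s p q f =
     Lp_norm p f +
     ennpow (\<integral>\<^sup>+h\<in>{0<..<1}. ennreal (h powr (- 1 - s * q)) * ennpow (Lp_norm p (diff_op h f)) q \<partial>lborel)
            (1 / q)"


subsection \<open>Space-time norms and classes\<close>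

definition spacetime_measurable :: "real \<Rightarrow> (real \<Rightarrow> real \<Rightarrow> real) \<Rightarrow> bool" where
  "spacetime_measurable T f \<longleftrightarrow>
     (\<lambda>(t, y). f t y) \<in> borel_measurable (restrict_space borel ({0<..<T} \<times> UNIV)) \<and>
     (\<forall>t\<in>{0<..<T}. periodic1 (f t))"

definition LinfC_norm :: "real \<Rightarrow> real \<Rightarrow> (real \<Rightarrow> real \<Rightarrow> real) \<Rightarrow> ennreal" where
  "LinfC_norm T \<beta> a = esssup (lebesgue_on {0<..<T}) (\<lambda>t. Hoelder_norm \<beta> (a t))"

definition in_LinfC :: "real \<Rightarrow> real \<Rightarrow> (real \<Rightarrow> real \<Rightarrow> real) \<Rightarrow> bool" where
  "in_LinfC T \<beta> a \<longleftrightarrow> spacetime_measurable T a \<and> LinfC_norm T \<beta> a < top"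

definition L2H_norm :: "real \<Rightarrow> real \<Rightarrow> (real \<Rightarrow> real \<Rightarrow> real) \<Rightarrow> ennreal" where
  "L2H_norm T r G = ennpow (\<integral>\<^sup>+t\<in>{0<..<T}. (H_norm r (fc (G t)))\<^sup>2 \<partial>lborel) (1 / 2)"

text \<open>
  For \<open>r \<ge> 0\<close> only, where elements of \<open>H\<^sup>r\<close> are square integrable functions. The
  condition on \<open>Lp_norm 2\<close> ensures that the Fourier coefficients are those of a genuine function
  rather than the default value of a divergent integral.
\<close>

definition in_L2H :: "real \<Rightarrow> real \<Rightarrow> (real \<Rightarrow> real \<Rightarrow> real) \<Rightarrow> bool" where
  "in_L2H T r G \<longleftrightarrow>
     spacetime_measurable T G \<and>
     (AE t in lborel. t \<in> {0<..<T} \<longrightarrow> Lp_norm 2 (G t) < top) \<and>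
     L2H_norm T r G < top"

definition K_energy :: "real \<Rightarrow> real \<Rightarrow> (real \<Rightarrow> real \<Rightarrow> real) \<Rightarrow> ennreal" where
  "K_energy T s m =
     (\<integral>\<^sup>+t\<in>{0<..<T}. (\<integral>\<^sup>+h\<in>{0<..<1}.
        ennreal (h powr (- 1 - 3 * s)) * (Lp_norm 3 (diff_op h (m t))) ^ 3 \<partial>lborel) \<partial>lborel)"

definition Z_energy :: "real \<Rightarrow> real \<Rightarrow> (real \<Rightarrow> real \<Rightarrow> real) \<Rightarrow> ennreal" where
  "Z_energy T \<beta> m = (\<integral>\<^sup>+t\<in>{0<..<T}. Besov_norm (1 - \<beta>) 1 1 (\<lambda>y. (m t y) ^ 3) \<partial>lborel)"


subsection \<open>The transformed operators\<close>

definition Psi :: "(real \<Rightarrow> real) \<Rightarrow> real \<Rightarrow> real" where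
  "Psi \<psi> x = x + \<psi> x"

text \<open>
  \<^term>\<open>Psi \<psi>\<close> is the lift to the real line of an orientation-preserving bi-Lipschitz circle map;
  degree one is the periodicity of \<open>\<psi>\<close>.
\<close>

definition bilipschitz_circle_map :: "(real \<Rightarrow> real) \<Rightarrow> bool" where
  "bilipschitz_circle_map \<psi> \<longleftrightarrow>
     periodic1 \<psi> \<and> strict_mono (Psi \<psi>) \<and> bij (Psi \<psi>) \<and>
     (\<exists>L. L-lipschitz_on UNIV (Psi \<psi>) \<and> L-lipschitz_on UNIV (inv (Psi \<psi>)))"

text \<open>
  \<open>v\<close> represents \<open>\<R>\<^sub>\<gamma> (J f\<^sup>\<Psi>) + f\<^sup>\<Psi> \<Lambda>\<^sup>\<gamma> \<psi>\<close> with \<open>J = \<Psi>'\<close>, which exists almost everywhere. For a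
  bi-Lipschitz \<open>\<Psi>\<close> each of the two summands is in general only a distribution, in \<open>H\<^sup>1\<^sup>-\<^sup>\<gamma>\<close>; the
  convolution giving the second one converges absolutely since \<open>f\<^sup>\<Psi>\<close> and \<open>\<psi>\<close> are Lipschitz and
  \<open>\<gamma> \<le> 2\<close>. For smooth \<open>f\<close> their sum is a bounded function (the singular parts cancel),
  which is what gives a meaning to the composition with \<open>\<Phi> = \<Psi>\<^sup>-\<^sup>1\<close>. It is determined up to a null
  set, which the bi-Lipschitz map \<open>\<Phi>\<close> preserves.
\<close>

definition represents_D :: "real \<Rightarrow> (real \<Rightarrow> real) \<Rightarrow> (real \<Rightarrow> real) \<Rightarrow> (real \<Rightarrow> real) \<Rightarrow> bool" where
  "represents_D \<gamma> \<psi> f v \<longleftrightarrow>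
     periodic1 v \<and> set_integrable lborel {0..1} v \<and>
     (\<forall>k. fc v k = Riesz \<gamma> (fc (\<lambda>x. deriv (Psi \<psi>) x * f (Psi \<psi> x))) k
                   + fconv (fc (f \<circ> Psi \<psi>)) (Lam \<gamma> (fc \<psi>)) k)"

definition D_op :: "real \<Rightarrow> (real \<Rightarrow> real) \<Rightarrow> (real \<Rightarrow> real) \<Rightarrow> real \<Rightarrow> real" where
  "D_op \<gamma> \<psi> f = (SOME v. represents_D \<gamma> \<psi> f v) \<circ> inv (Psi \<psi>)"

definition A_op :: "real \<Rightarrow> (real \<Rightarrow> real) \<Rightarrow> (real \<Rightarrow> real) \<Rightarrow> int \<Rightarrow> complex" where
  "A_op \<gamma> \<psi> f k = - Dx (fc (D_op \<gamma> \<psi> f)) k"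

text \<open>
  The operator bounds, with constant \<open>M\<close> uniform in time; they are a priori bounds on the dense
  class of smooth \<open>f\<close>.
\<close>

definition operator_bounds :: "real \<Rightarrow> real \<Rightarrow> real \<Rightarrow> (real \<Rightarrow> real \<Rightarrow> real) \<Rightarrow> bool" where
  "operator_bounds \<gamma> M T \<psi> \<longleftrightarrow>
     (\<forall>t\<in>{0..T}. \<forall>f. smooth_circle f \<longrightarrow>
        (\<gamma> < 2 \<longrightarrow>
           H_norm (- \<gamma> / 2) (A_op \<gamma> (\<psi> t) f) \<le> ennreal M * H_norm (\<gamma> / 2) (fc f)) \<and>
        (\<gamma> = 2 \<longrightarrow>
           Lp_norm 2 (D_op 2 (\<psi> t) f) + H_norm (- 1) (A_op 2 (\<psi> t) f)
             \<le> ennreal M * H_norm 1 (fc f)))"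

text \<open>
  \<open>m\<^sub>t + \<A> m = \<partial>\<^sub>y (a m\<^sup>2 + G)\<close> as an identity of periodic distributions for almost every
  \<open>t\<close>: since \<open>a\<close> and \<open>G\<close> are rough, only \<open>m\<close> is differentiated classically.
\<close>

definition solves_transformed_eq ::
  "real \<Rightarrow> real \<Rightarrow> (real \<Rightarrow> real \<Rightarrow> real) \<Rightarrow> (real \<Rightarrow> real \<Rightarrow> real) \<Rightarrow> (real \<Rightarrow> real \<Rightarrow> real) \<Rightarrow>
     (real \<Rightarrow> real \<Rightarrow> real) \<Rightarrow> bool" where
  "solves_transformed_eq \<gamma> T \<psi> a G m \<longleftrightarrow>
     (AE t in lborel. t \<in> {0<..<T} \<longrightarrow>
        (\<forall>k. fc (\<lambda>y. deriv (\<lambda>\<tau>. m \<tau> y) t) k + A_op \<gamma> (\<psi> t) (m t) k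
               = Dx (fc (\<lambda>y. a t y * (m t y)\<^sup>2 + G t y)) k))"

end

theory Submission
  imports Defs "HOL-Probability.Probability_Measure"
begin

text \<open>
  The equation is tested with \<open>\<psi>\<^sub>h(y) = \<integral>\<^sub>0\<^sup>h (\<bar>m(y) - m(y - z)\<bar> - \<bar>m(y + z) - m(y)\<bar>) dz\<close>. Pairing \<open>\<psi>\<^sub>h\<close> with
  \<open>m\<^sub>t\<close> gives the time derivative of \<open>\<integral>\<integral> \<bar>\<delta>\<^sub>z m\<bar> \<delta>\<^sub>z m / 2\<close> over \<open>0 < z < h\<close>, which costs \<open>h \<parallel>m\<parallel>\<^sup>2\<close> at the two end
  times. With \<open>N = m\<^sup>3\<close> and \<open>\<psi>\<^sub>h\<^sup>N\<close> built from \<open>N\<close> in the same way, \<open>m\<^sup>2 \<psi>\<^sub>h' - \<psi>\<^sub>h\<^sup>N' / 3\<close> contains no derivative of \<open>m\<close>,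
  and integrating it against \<open>a\<close> yields \<open>- \<integral> a \<bar>\<delta>\<^sub>h m\<bar>\<^sup>3 / 3\<close> up to an error \<open>\<parallel>a\<parallel> h\<^sup>\<beta> \<parallel>\<delta>\<^sub>h N\<parallel>\<close> in \<open>L\<^sup>1\<close>. What is left of
  the quadratic flux, the pairing of \<open>a\<close> with \<open>\<psi>\<^sub>h\<^sup>N'\<close>, is a duality between \<open>C\<^sup>\<beta>\<close> and the Besov space of order
  \<open>1 - \<beta>\<close>. Differences of \<open>\<psi>\<^sub>h\<close> are dominated by \<open>4 h\<close> times those of \<open>m\<close>, so the \<open>H\<close>-norm of order \<open>\<gamma>/2\<close> of
  \<open>\<psi>\<^sub>h\<close> is \<open>O(h)\<close>, and this controls the operator and \<open>G\<close>. Since \<open>3 s < 1\<close>, all errors are integrable against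
  \<open>h\<close> to the power \<open>- 1 - 3 s\<close>.
\<close>

section \<open>Integration over the circle\<close>

text \<open>Tested with plain increments of \<open>m\<close>, a quadratic flux produces cubes
  without a definite sign. The absolute values make the cubic term coercive, at a price:
  \<open>psi m h\<close> is only Lipschitz, while the rough terms of the equation are given through
  Fourier coefficients alone. Hence every pairing is a sum over frequencies, and a derivative of
  \<open>psi m h\<close> occurs only as the multiplier \<open>Dx\<close> or as a limit of difference
  quotients. The integration over \<open>z\<close> is what removes derivatives of \<open>m\<close>
  from the flux. As long as the shifted value \<open>w = m(y - z)\<close> is held fixed,
  \<open>m^2 d|m - w| = d|m^3 - w^3| / 3\<close>, so the contributions of \<open>m\<close> and of
  its cube cancel. What remains is the derivative falling on \<open>w\<close>; it is a derivative in
  \<open>z\<close> and integrates to a boundary value at \<open>z = h\<close>. The boundary value at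
  \<open>z = 0\<close> vanishes, and the values at distance \<open>h\<close>, symmetrised over the
  pair \<open>y\<close>, \<open>y + h\<close>, give the third power of the increment. The operator
  bound is a norm bound only, so duality costs the \<open>H\<close>-norm of the test function; a
  test function of size \<open>h\<close> makes this cost linear in \<open>h\<close>.\<close>

definition circ :: "real measure" where
  "circ = restrict_space lborel {0..1}"

lemma space_circ [simp]: "space circ = {0..1}"
  by (simp add: circ_def space_restrict_space)

lemma measurable_circ [measurable (raw)]:
  "f \<in> borel_measurable borel \<Longrightarrow> f \<in> borel_measurable circ"
  unfolding circ_def by (intro measurable_restrict_space1) simp

lemma emeasure_circ: "emeasure circ (space circ) = 1"
  by (simp add: circ_def emeasure_restrict_space space_restrict_space)

interpretation circ: prob_space circ
  by standard (rule emeasure_circ)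

lemma nn_integral_circ: "(\<integral>\<^sup>+x\<in>{0..1}. f x \<partial>lborel) = (\<integral>\<^sup>+x. f x \<partial>circ)"
  unfolding circ_def by (simp add: nn_integral_restrict_space)

lemma set_integral_circ:
  fixes f :: "real \<Rightarrow> 'b::{banach, second_countable_topology}"
  shows "set_lebesgue_integral lborel {0..1} f = (\<integral>x. f x \<partial>circ)"
  unfolding circ_def set_lebesgue_integral_def by (simp add: integral_restrict_space)

lemma periodic_int:
  assumes "\<And>x. f (x + 1) = f (x :: real)"
  shows "f (x + of_int n) = f x"
proof -
  have nat: "f (x + of_nat k) = f x" for k x
  proof (induction k)
    case (Suc k)
    have "f (x + of_nat (Suc k)) = f ((x + of_nat k) + 1)" by (simp add: add_ac)
    then show ?case using Suc by (simp only: assms)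
  qed simp
  show ?thesis
  proof (cases n rule: int_cases2)
    case (nonneg k) then show ?thesis by (simp add: nat)
  next
    case (nonpos k) then show ?thesis using nat[of "x - of_nat k" k] by simp
  qed
qed

lemma periodic_frac:
  assumes "\<And>x. f (x + 1) = f (x :: real)"
  shows "f (frac x) = f x"
  using periodic_int[of f, OF assms, of "frac x" "\<lfloor>x\<rfloor>"] by (simp add: frac_def)

text \<open>Only the fractional part \<open>r\<close> of the shift matters. The piece of
  \<open>{r..1 + r}\<close> beyond 1 is moved back by one period; the two pieces disagree with
  \<open>{0..1}\<close> at most at the points \<open>0\<close> and \<open>r\<close>.\<close>

lemma nn_integral_circ_shift:
  assumes [measurable]: "f \<in> borel_measurable borel" and per: "\<And>x. f (x + 1) = f (x :: real)"
  shows "(\<integral>\<^sup>+x. f (x + h) \<partial>circ) = (\<integral>\<^sup>+x. f x \<partial>circ)"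
proof -
  define r where "r = frac h"
  have r: "0 \<le> r" "r < 1" by (auto simp: r_def frac_ge_0 frac_lt_1)
  have fr: "f (x + h) = f (x + r)" for x
    using periodic_int[of f, OF per, of "x + r" "\<lfloor>h\<rfloor>"] by (simp add: r_def frac_def algebra_simps)
  have "(\<integral>\<^sup>+x. f (x + h) \<partial>circ) = (\<integral>\<^sup>+x. f (x + r) * indicator {0..1} x \<partial>lborel)"
    by (simp add: fr nn_integral_circ)
  also have "\<dots> = (\<integral>\<^sup>+x. f x * indicator {r..1 + r} x \<partial>lborel)"
    by (subst nn_integral_real_affine[where c = 1 and t = "-r"])
       (auto intro!: nn_integral_cong simp: indicator_def add.commute)
  also have "\<dots> = (\<integral>\<^sup>+x. f x * indicator {r..1} x + f x * indicator {1<..1 + r} x \<partial>lborel)"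
    using r by (intro nn_integral_cong) (auto simp: indicator_def)
  also have "\<dots> = (\<integral>\<^sup>+x. f x * indicator {r..1} x \<partial>lborel) + (\<integral>\<^sup>+x. f x * indicator {1<..1 + r} x \<partial>lborel)"
    by (intro nn_integral_add) auto
  also have "(\<integral>\<^sup>+x. f x * indicator {1<..1 + r} x \<partial>lborel) = (\<integral>\<^sup>+x. f x * indicator {0<..r} x \<partial>lborel)"
    by (subst nn_integral_real_affine[where c = 1 and t = 1])
       (auto intro!: nn_integral_cong simp: indicator_def add.commute[of 1] per)
  also have "(\<integral>\<^sup>+x. f x * indicator {r..1} x \<partial>lborel) + \<dots>
      = (\<integral>\<^sup>+x. f x * indicator {r..1} x + f x * indicator {0<..r} x \<partial>lborel)"
    by (intro nn_integral_add[symmetric]) auto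
  also have "\<dots> = (\<integral>\<^sup>+x. f x * indicator {0..1} x \<partial>lborel)"
  proof (intro nn_integral_cong_AE)
    have "AE x in lborel. x \<noteq> 0 \<and> x \<noteq> r" by (intro AE_conjI AE_lborel_singleton)
    then show "AE x in lborel. f x * indicator {r..1} x + f x * indicator {0<..r} x = f x * indicator {0..1} x"
      by eventually_elim (use r in \<open>auto simp: indicator_def\<close>)
  qed
  finally show ?thesis by (simp add: nn_integral_circ)
qed

text \<open>Rotation invariance for nonnegative integrands becomes an equality of image measures;
  \<open>integral_distr\<close> then carries it over to Bochner integrals, in particular to complex
  ones.\<close>

lemma distr_circ_shift: "distr circ borel (\<lambda>x. frac (x + h)) = distr circ borel frac"
proof (rule measure_eqI)
  fix A assume "A \<in> sets (distr circ borel (\<lambda>x. frac (x + h)))"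
  then have A [measurable]: "A \<in> sets borel" by simp
  have [measurable]: "(frac :: real \<Rightarrow> real) \<in> borel_measurable borel"
    unfolding frac_def by measurable
  have eq: "emeasure (distr circ borel (\<lambda>x. frac (x + k))) A = (\<integral>\<^sup>+x. indicator A (frac (x + k)) \<partial>circ)" for k
    by (simp add: nn_integral_indicator[symmetric] nn_integral_distr del: nn_integral_indicator)
  have "(\<integral>\<^sup>+x. indicator A (frac (x + h)) \<partial>circ) = (\<integral>\<^sup>+x. (indicator A (frac x) :: ennreal) \<partial>circ)"
    by (rule nn_integral_circ_shift) (auto simp: frac_1_eq)
  then show "emeasure (distr circ borel (\<lambda>x. frac (x + h))) A = emeasure (distr circ borel frac) A"
    using eq[of h] eq[of 0] by simp
qed simp

lemma integral_circ_shift: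
  fixes f :: "real \<Rightarrow> 'b::{banach, second_countable_topology}"
  assumes [measurable]: "f \<in> borel_measurable borel" and per: "\<And>x. f (x + 1) = f x"
  shows "(\<integral>x. f (x + h) \<partial>circ) = (\<integral>x. f x \<partial>circ)"
proof -
  have [measurable]: "(frac :: real \<Rightarrow> real) \<in> borel_measurable borel"
    unfolding frac_def by measurable
  have fr: "f (frac x) = f x" for x by (rule periodic_frac[of f, OF per])
  have "(\<integral>x. f (x + h) \<partial>circ) = (\<integral>x. f x \<partial>distr circ borel (\<lambda>x. frac (x + h)))"
    by (subst integral_distr) (auto simp: fr)
  also have "\<dots> = (\<integral>x. f x \<partial>distr circ borel frac)" by (simp only: distr_circ_shift)
  also have "\<dots> = (\<integral>x. f x \<partial>circ)" by (subst integral_distr) (auto simp: fr)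
  finally show ?thesis .
qed

lemma integrable_circ_bounded:
  fixes f :: "real \<Rightarrow> 'b::{banach, second_countable_topology}"
  assumes "f \<in> borel_measurable borel" "\<And>x. norm (f x) \<le> B"
  shows "integrable circ f"
  using assms by (intro circ.integrable_const_bound[where B = B]) auto

section \<open>Sums over the integers\<close>

lemma nn_integral_count_space_int_eq_suminf:
  fixes f :: "int \<Rightarrow> ennreal"
  shows "(\<integral>\<^sup>+k. f k \<partial>count_space UNIV) = (\<Sum>n. f (from_nat_into UNIV n))"
proof -
  have g: "bij_betw (from_nat_into (UNIV :: int set)) UNIV UNIV"
    by (intro bij_betw_from_nat_into) (auto simp: infinite_UNIV_int)
  have "(\<integral>\<^sup>+k. f k \<partial>count_space UNIV) = (\<integral>\<^sup>+n. f (from_nat_into UNIV n) \<partial>count_space UNIV)"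
    using nn_integral_bij_count_space[OF g, of f] by simp
  then show ?thesis by (simp add: nn_integral_count_space_nat)
qed

text \<open>\<open>H_norm\<close> is written with an unordered sum, which in \<open>ennreal\<close>
  is the supremum of the finite partial sums. As an integral over a counting measure it becomes
  accessible to Tonelli and to the calculus of \<open>nn_integral\<close>.\<close>

lemma nn_integral_count_space_int_eq_infsum:
  fixes f :: "int \<Rightarrow> ennreal"
  shows "(\<integral>\<^sup>+k. f k \<partial>count_space UNIV) = (\<Sum>\<^sub>\<infinity>k. f k)"
proof (rule antisym)
  have sup: "(\<Sum>\<^sub>\<infinity>k. f k) = (SUP F\<in>{F. finite F \<and> F \<subseteq> UNIV}. sum f F)"
    by (rule nonneg_infsum_complete) simp
  define g :: "nat \<Rightarrow> int" where "g = from_nat_into UNIV"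
  have g: "bij_betw g UNIV UNIV"
    unfolding g_def by (intro bij_betw_from_nat_into) (auto simp: infinite_UNIV_int)
  have "(\<integral>\<^sup>+k. f k \<partial>count_space UNIV) = (\<Sum>n. f (g n))"
    unfolding g_def by (rule nn_integral_count_space_int_eq_suminf)
  also have "\<dots> \<le> (\<Sum>\<^sub>\<infinity>k. f k)"
  proof (rule suminf_le_const)
    show "summable (\<lambda>n. f (g n))" by (rule summableI)
    fix n
    have "inj_on g {..<n}" using g by (auto simp: bij_betw_def intro: inj_on_subset)
    then have "(\<Sum>i<n. f (g i)) = sum f (g ` {..<n})" by (simp add: sum.reindex)
    also have "\<dots> \<le> (\<Sum>\<^sub>\<infinity>k. f k)" unfolding sup by (rule SUP_upper) auto
    finally show "(\<Sum>i<n. f (g i)) \<le> (\<Sum>\<^sub>\<infinity>k. f k)" .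
  qed
  finally show "(\<integral>\<^sup>+k. f k \<partial>count_space UNIV) \<le> (\<Sum>\<^sub>\<infinity>k. f k)" .
  show "(\<Sum>\<^sub>\<infinity>k. f k) \<le> (\<integral>\<^sup>+k. f k \<partial>count_space UNIV)"
    unfolding sup
  proof (rule SUP_least)
    fix F :: "int set" assume "F \<in> {F. finite F \<and> F \<subseteq> UNIV}"
    then have F: "finite F" by simp
    have "sum f F = (\<integral>\<^sup>+k. f k * indicator F k \<partial>count_space UNIV)"
      using F by (subst nn_integral_count_space'[of F])
        (auto simp: indicator_def intro!: sum.cong split: if_splits)
    also have "\<dots> \<le> (\<integral>\<^sup>+k. f k \<partial>count_space UNIV)"
      by (intro nn_integral_mono) (auto simp: indicator_def)
    finally show "sum f F \<le> (\<integral>\<^sup>+k. f k \<partial>count_space UNIV)" .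
  qed
qed

lemma nn_integral_count_space_int_le:
  fixes f :: "int \<Rightarrow> ennreal"
  assumes "\<And>K. finite K \<Longrightarrow> sum f K \<le> B"
  shows "(\<integral>\<^sup>+k. f k \<partial>count_space UNIV) \<le> B"
  unfolding nn_integral_count_space_int_eq_infsum
  by (subst nonneg_infsum_complete) (auto intro!: SUP_least assms)

lemma sum_le_nn_integral_count_space_int:
  fixes f :: "int \<Rightarrow> ennreal"
  assumes "finite K"
  shows "sum f K \<le> (\<integral>\<^sup>+k. f k \<partial>count_space UNIV)"
  unfolding nn_integral_count_space_int_eq_infsum
  by (subst nonneg_infsum_complete) (auto intro!: SUP_upper assms)

lemma sum_symmetric_int_tendsto:
  fixes c :: "int \<Rightarrow> complex"
  assumes "integrable (count_space UNIV) c"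
  shows "(\<lambda>n. \<Sum>k\<in>{-int n..int n}. c k) \<longlonglongrightarrow> (\<integral>k. c k \<partial>count_space UNIV)"
proof -
  have "(\<lambda>n. \<integral>k. c k * indicator {-int n..int n} k \<partial>count_space UNIV) \<longlonglongrightarrow> (\<integral>k. c k \<partial>count_space UNIV)"
  proof (rule integral_dominated_convergence[where w = "\<lambda>k. norm (c k)"])
    show "AE k in count_space UNIV. (\<lambda>n. c k * indicator {- int n..int n} k) \<longlonglongrightarrow> c k"
    proof (intro AE_I2 tendsto_eventually eventually_sequentiallyI)
      fix k and n :: nat assume "n \<ge> nat \<bar>k\<bar>"
      then show "c k * indicator {- int n..int n} k = c k" by (auto simp: indicator_def)
    qed
  qed (use assms in \<open>auto simp: norm_mult indicator_def\<close>)
  moreover have "(\<integral>k. c k * indicator {-int n..int n} k \<partial>count_space UNIV) = (\<Sum>k\<in>{-int n..int n}. c k)" for n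
  proof -
    have "(\<integral>k. c k * indicator {-int n..int n} k \<partial>count_space UNIV)
        = (\<Sum>k | k \<in> UNIV \<and> c k * indicator {-int n..int n} k \<noteq> 0. c k * indicator {-int n..int n} k)"
      by (rule lebesgue_integral_count_space_finite_support, rule finite_subset[of _ "{-int n..int n}"])
         (auto simp: indicator_def split: if_splits)
    also have "\<dots> = (\<Sum>k\<in>{-int n..int n}. c k)"
      by (intro sum.mono_neutral_cong_left) (auto simp: indicator_def split: if_splits)
    finally show ?thesis .
  qed
  ultimately show ?thesis by simp
qed

lemma integrable_count_space_intI:
  fixes c :: "int \<Rightarrow> 'b::{banach, second_countable_topology}"
  assumes "(\<integral>\<^sup>+k. ennreal (norm (c k)) \<partial>count_space UNIV) < \<infinity>"
  shows "integrable (count_space UNIV) c"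
  using assms by (intro integrableI_bounded) auto

lemma nn_integral_inverse_squares_int:
  "(\<integral>\<^sup>+k. ennreal (1 / (1 + (real_of_int k)\<^sup>2)) \<partial>count_space UNIV) \<le> 5"
proof (rule nn_integral_count_space_int_le)
  fix K :: "int set" assume "finite K"
  \<comment> \<open>The remainder \<open>4 / (n + 1)\<close> closes the induction: the two new terms
    cost at most \<open>4 / (n + 1) - 4 / (n + 2)\<close>, and at \<open>n = 0\<close> there is
    equality.\<close>
  have sym: "(\<Sum>k\<in>{-int n..int n}. 1 / (1 + (real_of_int k)\<^sup>2)) \<le> 5 - 4 / (real n + 1)" for n
  proof (induction n)
    case (Suc n)
    have eq: "{-int (Suc n)..int (Suc n)} = insert (int (Suc n)) (insert (- int (Suc n)) {-int n..int n})"
      by auto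
    have "(\<Sum>k\<in>{-int (Suc n)..int (Suc n)}. 1 / (1 + (real_of_int k)\<^sup>2))
      = 2 / (1 + (real n + 1)\<^sup>2) + (\<Sum>k\<in>{-int n..int n}. 1 / (1 + (real_of_int k)\<^sup>2))"
    proof -
      have "(- 1 - real n)\<^sup>2 = (1 + real n)\<^sup>2" by (simp add: power2_eq_square algebra_simps)
      then show ?thesis unfolding eq by (simp add: add_ac)
    qed
    also have "\<dots> \<le> 2 / (1 + (real n + 1)\<^sup>2) + (5 - 4 / (real n + 1))" using Suc by simp
    also have "\<dots> \<le> 5 - 4 / (real (Suc n) + 1)"
    proof -
      have "2 / (1 + (real n + 1)\<^sup>2) \<le> 4 / ((real n + 1) * (real n + 2))"
        by (simp add: divide_simps power2_eq_square algebra_simps add_pos_nonneg)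
      also have "\<dots> = 4 / (real n + 1) - 4 / (real n + 2)"
        by (simp add: field_simps)
      finally show ?thesis by (simp add: add.commute)
    qed
    finally show ?case .
  qed simp
  define n where "n = nat (Max (insert 0 (abs ` K)))"
  have K: "K \<subseteq> {-int n..int n}"
  proof
    fix k assume "k \<in> K"
    then have "\<bar>k\<bar> \<le> Max (insert 0 (abs ` K))" using \<open>finite K\<close> by (intro Max_ge) auto
    then show "k \<in> {-int n..int n}" by (auto simp: n_def)
  qed
  have "(\<Sum>k\<in>K. ennreal (1 / (1 + (real_of_int k)\<^sup>2))) = ennreal (\<Sum>k\<in>K. 1 / (1 + (real_of_int k)\<^sup>2))"
    by (subst sum_ennreal) auto
  also have "\<dots> \<le> ennreal (\<Sum>k\<in>{-int n..int n}. 1 / (1 + (real_of_int k)\<^sup>2))"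
    by (intro ennreal_leI sum_mono2 K) auto
  also have "\<dots> \<le> ennreal 5"
    using sym[of n] by (intro ennreal_leI) (smt (verit) divide_nonneg_nonneg of_nat_0_le_iff)
  finally show "(\<Sum>k\<in>K. ennreal (1 / (1 + (real_of_int k)\<^sup>2))) \<le> 5" by simp
qed

section \<open>Fourier series of Lipschitz functions\<close>

definition echar :: "int \<Rightarrow> real \<Rightarrow> complex" where
  "echar k x = cis (2 * pi * of_int k * x)"

lemma norm_echar [simp]: "cmod (echar k x) = 1"
  by (simp add: echar_def)

lemma echar_0 [simp]: "echar 0 x = 1" "echar k 0 = 1"
  by (simp_all add: echar_def)

lemma cnj_echar: "cnj (echar k x) = echar (- k) x"
  by (simp add: echar_def cis_cnj)

lemma echar_mult: "echar j x * echar k x = echar (j + k) x"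
  by (simp add: echar_def cis_mult algebra_simps)

lemma echar_add: "echar k (x + y) = echar k x * echar k y"
  by (simp add: echar_def cis_mult algebra_simps)

lemma echar_1_right: "echar k 1 = 1"
  using cis_multiple_2pi[of "of_int k"] by (simp add: echar_def)

lemma echar_periodic: "echar k (x + 1) = echar k x"
  by (simp add: echar_add echar_1_right)

lemma continuous_echar: "continuous_on UNIV (echar k)"
  unfolding echar_def cis_conv_exp by (intro continuous_intros)

lemma measurable_echar [measurable]: "echar k \<in> borel_measurable borel"
  by (intro borel_measurable_continuous_onI continuous_echar)

text \<open>A shift by half a wavelength, \<open>1 / (2 k)\<close>, turns the character into its
  negative, so by rotation invariance its mean is its own negative.\<close>

lemma integral_echar: "(\<integral>x. echar k x \<partial>circ) = (if k = 0 then 1 else 0)"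
proof (cases "k = 0")
  case False
  define h where "h = 1 / (2 * real_of_int k)"
  have "echar k h = cis pi" using False by (simp add: echar_def h_def)
  then have e: "echar k h = -1" by simp
  have "(\<integral>x. echar k x \<partial>circ) = (\<integral>x. echar k (x + h) \<partial>circ)"
    by (intro integral_circ_shift[symmetric] echar_periodic) simp
  also have "\<dots> = - (\<integral>x. echar k x \<partial>circ)" by (simp add: echar_add e)
  finally show ?thesis using False by simp
qed (simp add: circ.prob_space[simplified])

text \<open>Complex-valued counterpart of \<open>fc\<close>: the quotient \<open>v\<close> used
  below for the convergence of Fourier series is not real.\<close>

definition cfc :: "(real \<Rightarrow> complex) \<Rightarrow> int \<Rightarrow> complex" where
  "cfc f k = (\<integral>x. f x * echar (- k) x \<partial>circ)"

lemma fc_eq_cfc: "fc f k = cfc (\<lambda>x. of_real (f x)) k"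
  unfolding fc_def cfc_def set_integral_circ by (simp add: echar_def)

definition L2c :: "(real \<Rightarrow> complex) \<Rightarrow> bool" where
  "L2c f \<longleftrightarrow> f \<in> borel_measurable borel \<and> integrable circ (\<lambda>x. (cmod (f x))\<^sup>2)"

lemma L2c_measurable [measurable_dest]: "L2c f \<Longrightarrow> f \<in> borel_measurable borel"
  by (simp add: L2c_def)

lemma L2c_integrable_mult:
  assumes "L2c f" "L2c g"
  shows "integrable circ (\<lambda>x. f x * g x)"
proof (rule Bochner_Integration.integrable_bound)
  show "integrable circ (\<lambda>x. (cmod (f x))\<^sup>2 + (cmod (g x))\<^sup>2)"
    using assms by (auto simp: L2c_def)
  show "(\<lambda>x. f x * g x) \<in> borel_measurable circ"
    using assms by (auto simp: L2c_def)
  have "cmod (f x * g x) \<le> (cmod (f x))\<^sup>2 + (cmod (g x))\<^sup>2" for x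
  proof -
    have "0 \<le> cmod (f x) * cmod (g x)" by simp
    then show ?thesis
      using sum_squares_bound[of "cmod (f x)" "cmod (g x)"] by (simp only: norm_mult mult.assoc)
  qed
  then show "AE x in circ. norm (f x * g x) \<le> norm ((cmod (f x))\<^sup>2 + (cmod (g x))\<^sup>2)"
    by simp
qed

lemma L2c_bounded:
  assumes "f \<in> borel_measurable borel" "\<And>x. cmod (f x) \<le> B"
  shows "L2c f"
  unfolding L2c_def using assms
  by (auto intro!: integrable_circ_bounded[where B = "B\<^sup>2"] power_mono simp: norm_power)

lemma L2c_echar: "L2c (echar k)"
  by (rule L2c_bounded[where B = 1]) auto

lemma L2c_cnj: "L2c f \<Longrightarrow> L2c (\<lambda>x. cnj (f x))"
  unfolding L2c_def using borel_measurable_continuous_onI[of cnj] by (auto intro: continuous_intros)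

lemma L2c_integrable: "L2c f \<Longrightarrow> integrable circ f"
  using L2c_integrable_mult[OF _ L2c_echar[of 0], of f] by simp

text \<open>The squared distance from \<open>f\<close> to its partial sum \<open>p\<close> over
  \<open>K\<close> is nonnegative. Both mixed terms and the square of \<open>p\<close> have the same
  integral, the sum of the squared coefficients, so expanding leaves the difference of the two
  sides.\<close>

lemma Bessel_finite:
  assumes f: "L2c f" and "finite K"
  shows "(\<Sum>k\<in>K. (cmod (cfc f k))\<^sup>2) \<le> (\<integral>x. (cmod (f x))\<^sup>2 \<partial>circ)"
proof -
  let ?c = "cfc f"
  define p where "p x = (\<Sum>k\<in>K. ?c k * echar k x)" for x
  have [measurable]: "f \<in> borel_measurable borel" using f by (rule L2c_measurable)
  have pL: "L2c p"
    unfolding p_def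
    by (rule L2c_bounded[where B = "\<Sum>k\<in>K. cmod (?c k)"])
       (auto intro!: order_trans[OF norm_sum] sum_mono simp: norm_mult)
  have int1: "integrable circ (\<lambda>x. f x * cnj (f x))" "integrable circ (\<lambda>x. f x * cnj (p x))"
    "integrable circ (\<lambda>x. cnj (f x) * p x)" "integrable circ (\<lambda>x. p x * cnj (p x))"
    by (intro L2c_integrable_mult f pL L2c_cnj)+
  have cp: "(\<integral>x. f x * cnj (p x) \<partial>circ) = (\<Sum>k\<in>K. ?c k * cnj (?c k))"
  proof -
    have "(\<integral>x. f x * cnj (p x) \<partial>circ) = (\<integral>x. (\<Sum>k\<in>K. cnj (?c k) * (f x * echar (- k) x)) \<partial>circ)"
      by (simp add: p_def sum_distrib_left cnj_echar mult_ac)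
    also have "\<dots> = (\<Sum>k\<in>K. \<integral>x. cnj (?c k) * (f x * echar (- k) x) \<partial>circ)"
      by (intro Bochner_Integration.integral_sum integrable_mult_right L2c_integrable_mult f L2c_echar)
    finally show ?thesis by (simp add: cfc_def mult.commute)
  qed
  have cp': "(\<integral>x. cnj (f x) * p x \<partial>circ) = (\<Sum>k\<in>K. ?c k * cnj (?c k))"
  proof -
    have "(\<integral>x. cnj (f x) * p x \<partial>circ) = cnj (\<integral>x. f x * cnj (p x) \<partial>circ)"
      by (subst Bochner_Integration.integral_cnj[symmetric]) simp
    then show ?thesis by (simp add: cp mult.commute)
  qed
  have pp: "(\<integral>x. p x * cnj (p x) \<partial>circ) = (\<Sum>k\<in>K. ?c k * cnj (?c k))"
  proof -
    have "p x * cnj (p x) = (\<Sum>k\<in>K. \<Sum>j\<in>K. ?c k * cnj (?c j) * echar (k - j) x)" for x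
    proof -
      have "cnj (p x) = (\<Sum>j\<in>K. cnj (?c j) * echar (- j) x)" by (simp add: p_def cnj_echar)
      then have "p x * cnj (p x) = (\<Sum>k\<in>K. \<Sum>j\<in>K. ?c k * echar k x * (cnj (?c j) * echar (- j) x))"
        by (simp only: p_def sum_product)
      also have "\<dots> = (\<Sum>k\<in>K. \<Sum>j\<in>K. ?c k * cnj (?c j) * echar (k - j) x)"
      proof (intro sum.cong refl)
        fix k j
        have "echar (k - j) x = echar k x * echar (- j) x" by (simp add: echar_mult)
        then show "?c k * echar k x * (cnj (?c j) * echar (- j) x) = ?c k * cnj (?c j) * echar (k - j) x"
          by (simp only: mult_ac)
      qed
      finally show ?thesis .
    qed
    then have "(\<integral>x. p x * cnj (p x) \<partial>circ)
      = (\<integral>x. (\<Sum>k\<in>K. \<Sum>j\<in>K. ?c k * cnj (?c j) * echar (k - j) x) \<partial>circ)" by simp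
    also have "\<dots> = (\<Sum>k\<in>K. \<Sum>j\<in>K. \<integral>x. ?c k * cnj (?c j) * echar (k - j) x \<partial>circ)"
      by (subst Bochner_Integration.integral_sum, (intro Bochner_Integration.integrable_sum integrable_mult_right L2c_integrable L2c_echar))+
         (simp)
    also have "\<dots> = (\<Sum>k\<in>K. ?c k * cnj (?c k))"
      using \<open>finite K\<close> by (simp add: integral_echar if_distrib[of "\<lambda>x. _ * x"] cong: if_cong)
    finally show ?thesis .
  qed
  have sq: "complex_of_real ((cmod z)\<^sup>2) = z * cnj z" for z
    by (rule complex_norm_square)
  have "complex_of_real (\<integral>x. (cmod (f x - p x))\<^sup>2 \<partial>circ) = (\<integral>x. complex_of_real ((cmod (f x - p x))\<^sup>2) \<partial>circ)"
    by (rule integral_complex_of_real[symmetric])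
  also have "\<dots> = (\<integral>x. f x * cnj (f x) - f x * cnj (p x) - cnj (f x) * p x + p x * cnj (p x) \<partial>circ)"
    by (intro Bochner_Integration.integral_cong refl) (simp only: sq, simp add: algebra_simps)
  also have "\<dots> = (\<integral>x. f x * cnj (f x) \<partial>circ) - (\<Sum>k\<in>K. ?c k * cnj (?c k))"
    using int1 by (simp add: cp cp' pp)
  also have "\<dots> = complex_of_real ((\<integral>x. (cmod (f x))\<^sup>2 \<partial>circ) - (\<Sum>k\<in>K. (cmod (?c k))\<^sup>2))"
    by (simp only: sq[symmetric] of_real_diff of_real_sum integral_complex_of_real)
  finally have "(\<integral>x. (cmod (f x - p x))\<^sup>2 \<partial>circ) = (\<integral>x. (cmod (f x))\<^sup>2 \<partial>circ) - (\<Sum>k\<in>K. (cmod (?c k))\<^sup>2)"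
    using of_real_eq_iff by blast
  moreover have "0 \<le> (\<integral>x. (cmod (f x - p x))\<^sup>2 \<partial>circ)" by simp
  ultimately show ?thesis by simp
qed

lemma Bessel:
  assumes f: "L2c f"
  shows "(\<integral>\<^sup>+k. ennreal ((cmod (cfc f k))\<^sup>2) \<partial>count_space UNIV) \<le> ennreal (\<integral>x. (cmod (f x))\<^sup>2 \<partial>circ)"
  by (rule nn_integral_count_space_int_le) (auto simp: sum_ennreal intro!: ennreal_leI Bessel_finite[OF f])

text \<open>By Bessel the squared moduli are summable along any injective sequence of frequencies,
  hence tend to zero.\<close>

lemma Riemann_Lebesgue:
  assumes f: "L2c f" and s: "inj s"
  shows "(\<lambda>n::nat. cfc f (s n)) \<longlonglongrightarrow> 0"
proof -
  have "summable (\<lambda>n. (cmod (cfc f (s n)))\<^sup>2)"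
  proof (rule summableI_nonneg_bounded)
    fix n
    have "(\<Sum>i<n. (cmod (cfc f (s i)))\<^sup>2) = (\<Sum>k\<in>s ` {..<n}. (cmod (cfc f k))\<^sup>2)"
      using s by (subst sum.reindex) (auto intro: inj_on_subset)
    also have "\<dots> \<le> (\<integral>x. (cmod (f x))\<^sup>2 \<partial>circ)" by (intro Bessel_finite f) simp
    finally show "(\<Sum>i<n. (cmod (cfc f (s i)))\<^sup>2) \<le> (\<integral>x. (cmod (f x))\<^sup>2 \<partial>circ)" .
  qed simp
  then have "(\<lambda>n. (cmod (cfc f (s n)))\<^sup>2) \<longlonglongrightarrow> 0" by (rule summable_LIMSEQ_zero)
  then have "(\<lambda>n. sqrt ((cmod (cfc f (s n)))\<^sup>2)) \<longlonglongrightarrow> sqrt 0" by (intro tendsto_real_sqrt)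
  then show ?thesis by (simp add: tendsto_norm_zero_iff)
qed

section \<open>Size of the difference multipliers\<close>

lemma echar_conv_exp: "echar k x = exp (\<i> * of_real (2 * pi * of_int k * x))"
  by (simp add: echar_def cis_conv_exp)

lemma norm_echar_diff_1: "cmod (echar k h - 1) = 2 * \<bar>sin (pi * of_int k * h)\<bar>"
  using dist_exp_i_1[of "2 * pi * of_int k * h"] by (simp add: echar_conv_exp mult.assoc)

lemma norm_echar_diff_1_le: "cmod (echar k h - 1) \<le> 2 * pi * \<bar>of_int k\<bar> * \<bar>h\<bar>"
  using abs_sin_x_le_abs_x[of "pi * of_int k * h"] by (simp add: norm_echar_diff_1 abs_mult)

lemma echar_difference_quotient:
  assumes "\<And>n. e n \<noteq> 0" "e \<longlonglongrightarrow> 0"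
  shows "(\<lambda>n. (echar k (e n) - 1) / of_real (e n)) \<longlonglongrightarrow> 2 * of_real pi * \<i> * of_int k"
proof (cases "k = 0")
  case False
  let ?c = "2 * of_real pi * \<i> * of_int k :: complex"
  have "(\<lambda>h::complex. (exp h - 1) / h) \<midarrow>0\<rightarrow> 1"
    using DERIV_exp[of "0::complex"] by (simp add: DERIV_def)
  moreover have "filterlim (\<lambda>n. ?c * of_real (e n)) (at 0) sequentially"
    using assms False
    by (auto simp: filterlim_at intro!: tendsto_eq_intros)
  ultimately have "(\<lambda>n. (exp (?c * of_real (e n)) - 1) / (?c * of_real (e n))) \<longlonglongrightarrow> 1"
    by (rule filterlim_compose)
  then have "(\<lambda>n. ?c * ((exp (?c * of_real (e n)) - 1) / (?c * of_real (e n)))) \<longlonglongrightarrow> ?c * 1"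
    by (intro tendsto_intros)
  moreover have "?c * ((exp (?c * of_real (e n)) - 1) / (?c * of_real (e n)))
      = (echar k (e n) - 1) / of_real (e n)" for n
  proof -
    have "exp (?c * of_real (e n)) = echar k (e n)" by (simp add: echar_conv_exp mult_ac)
    moreover have "?c \<noteq> 0" using False by simp
    ultimately show ?thesis by (metis nonzero_mult_divide_mult_cancel_left times_divide_eq_right)
  qed
  ultimately show ?thesis by simp
qed simp

text \<open>Jordan's inequality: \<open>sin\<close> is concave on \<open>{0..pi / 2}\<close> and
  therefore lies above its chord.\<close>

lemma jordan_sin_ge:
  assumes "0 \<le> x" "x \<le> pi / 2"
  shows "2 / pi * x \<le> sin (x :: real)"
proof -
  have "convex_on {0..pi / 2} (\<lambda>x. - sin x)"
    by (rule f''_ge0_imp_convex[where f' = "\<lambda>x. - cos x" and f'' = sin])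
       (auto intro!: derivative_eq_intros sin_ge_zero)
  then have "- sin ((1 - 2 / pi * x) * 0 + (2 / pi * x) * (pi / 2))
      \<le> (1 - 2 / pi * x) * (- sin 0) + (2 / pi * x) * (- sin (pi / 2))"
    using assms convex_onD[of "{0..pi / 2}" "\<lambda>x. - sin x" "2 / pi * x" 0 "pi / 2"]
    by (simp add: field_simps)
  then show ?thesis by simp
qed

text \<open>The chord on the unit circle is comparable to the distance from \<open>y\<close> to the
  nearest integer; the upper half of the period follows from the symmetry of
  \<open>sin (pi * y)\<close> under \<open>y\<close> to \<open>1 - y\<close>.\<close>

lemma norm_echar_1_diff_ge:
  assumes "0 \<le> y" "y \<le> 1"
  shows "4 * min y (1 - y) \<le> cmod (echar 1 y - 1)"
proof (cases "y \<le> 1 / 2")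
  case True
  then show ?thesis
    using assms jordan_sin_ge[of "pi * y"] by (simp add: norm_echar_diff_1)
next
  case False
  have "sin (pi * y) = sin (pi * (1 - y))"
    by (simp add: right_diff_distrib sin_diff)
  then show ?thesis
    using assms False jordan_sin_ge[of "pi * (1 - y)"] by (simp add: norm_echar_diff_1)
qed

text \<open>The class in which all test functions live: the absolute values in \<open>psi\<close>
  may destroy smoothness, but they respect Lipschitz bounds. The constant is kept explicit because
  it serves as majorant in dominated convergence.\<close>

definition lip_circ :: "real \<Rightarrow> (real \<Rightarrow> real) \<Rightarrow> bool" where
  "lip_circ L u \<longleftrightarrow> (\<forall>x. u (x + 1) = u x) \<and> (\<forall>x y. \<bar>u x - u y\<bar> \<le> L * \<bar>x - y\<bar>)"

lemma lip_circ_periodic: "lip_circ L u \<Longrightarrow> u (x + 1) = u x"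
  by (simp add: lip_circ_def)

lemma lip_circD: "lip_circ L u \<Longrightarrow> \<bar>u x - u y\<bar> \<le> L * \<bar>x - y\<bar>"
  by (simp add: lip_circ_def)

lemma lip_circ_nonneg: "lip_circ L u \<Longrightarrow> 0 \<le> L"
  using lip_circD[of L u 1 0] abs_ge_zero[of "u 1 - u 0"] by simp

lemma lip_circ_continuous: "lip_circ L u \<Longrightarrow> continuous_on S u"
proof -
  assume u: "lip_circ L u"
  have "L-lipschitz_on UNIV u"
    using u lip_circ_nonneg[OF u] by (auto simp: lipschitz_on_def dist_real_def lip_circ_def)
  then show ?thesis using lipschitz_on_continuous_on continuous_on_subset by blast
qed

lemma lip_circ_measurable [measurable_dest]: "lip_circ L u \<Longrightarrow> u \<in> borel_measurable borel"
  by (intro borel_measurable_continuous_onI lip_circ_continuous)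

lemma lip_circ_bounded:
  assumes u: "lip_circ L u"
  shows "\<bar>u x\<bar> \<le> \<bar>u 0\<bar> + L"
proof -
  have "\<bar>u x - u 0\<bar> = \<bar>u (frac x) - u 0\<bar>"
    using periodic_frac[of u x] u by (simp add: lip_circ_periodic)
  also have "\<dots> \<le> L * \<bar>frac x - 0\<bar>" by (rule lip_circD[OF u])
  also have "\<dots> \<le> L * 1"
    using lip_circ_nonneg[OF u] frac_lt_1[of x] frac_ge_0[of x] by (intro mult_left_mono) auto
  finally show ?thesis by linarith
qed

lemma L2c_lip_circ: "lip_circ L u \<Longrightarrow> L2c (\<lambda>x. of_real (u x))"
  by (rule L2c_bounded[where B = "\<bar>u 0\<bar> + L"])
     (auto intro: lip_circ_bounded dest: lip_circ_measurable)

lemma lip_circ_shift: "lip_circ L u \<Longrightarrow> lip_circ L (\<lambda>x. u (x + h))"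
proof -
  assume u: "lip_circ L u"
  have "u (x + 1 + h) = u (x + h)" for x
    using lip_circ_periodic[OF u, of "x + h"] by (simp add: add_ac)
  moreover have "\<bar>u (x + h) - u (y + h)\<bar> \<le> L * \<bar>x - y\<bar>" for x y
    using lip_circD[OF u, of "x + h" "y + h"] by simp
  ultimately show ?thesis by (simp add: lip_circ_def)
qed

lemma fc_shift:
  assumes [measurable]: "f \<in> borel_measurable borel" and "\<And>x. f (x + 1) = f x"
  shows "fc (\<lambda>x. f (x + h)) k = echar k h * fc f k"
proof -
  have "fc (\<lambda>x. f (x + h)) k = (\<integral>x. echar k h * (of_real (f (x + h)) * echar (- k) (x + h)) \<partial>circ)"
  proof -
    have "echar k h * echar (- k) (x + h) = echar (- k) x" for x
      by (simp add: echar_add mult.left_commute[of "echar k h"] echar_mult)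
    then show ?thesis unfolding fc_eq_cfc cfc_def by (simp add: mult.left_commute[of "echar k h"])
  qed
  also have "\<dots> = echar k h * (\<integral>x. of_real (f (x + h)) * echar (- k) (x + h) \<partial>circ)" by simp
  also have "(\<integral>x. of_real (f (x + h)) * echar (- k) (x + h) \<partial>circ) = fc f k"
    unfolding fc_eq_cfc cfc_def
    by (rule integral_circ_shift[where f = "\<lambda>x. of_real (f x) * echar (- k) x"])
       (auto simp: assms echar_periodic)
  finally show ?thesis .
qed

lemma cfc_diff: "L2c f \<Longrightarrow> L2c g \<Longrightarrow> cfc (\<lambda>x. f x - g x) k = cfc f k - cfc g k"
  unfolding cfc_def left_diff_distrib
  by (intro Bochner_Integration.integral_diff L2c_integrable_mult L2c_echar)

lemma cfc_cmult: "cfc (\<lambda>x. c * f x) k = c * cfc f k"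
  unfolding cfc_def by (simp add: mult.assoc)

lemma L2c_cmult: "L2c f \<Longrightarrow> L2c (\<lambda>x. c * f x)"
  unfolding L2c_def by (auto simp: norm_mult power_mult_distrib)

lemma L2c_add: assumes "L2c f" "L2c g" shows "L2c (\<lambda>x. f x + g x)"
proof -
  have [measurable]: "f \<in> borel_measurable borel" "g \<in> borel_measurable borel"
    using assms by (auto simp: L2c_def)
  have "integrable circ (\<lambda>x. 2 * (cmod (f x))\<^sup>2 + 2 * (cmod (g x))\<^sup>2)"
    using assms by (auto simp: L2c_def)
  then have "integrable circ (\<lambda>x. (cmod (f x + g x))\<^sup>2)"
  proof (rule Bochner_Integration.integrable_bound)
    have "(cmod (f x + g x))\<^sup>2 \<le> 2 * (cmod (f x))\<^sup>2 + 2 * (cmod (g x))\<^sup>2" for x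
    proof -
      have "(cmod (f x + g x))\<^sup>2 \<le> (cmod (f x) + cmod (g x))\<^sup>2"
        by (intro power_mono norm_triangle_ineq) simp
      also have "\<dots> \<le> 2 * (cmod (f x))\<^sup>2 + 2 * (cmod (g x))\<^sup>2"
        using sum_squares_bound[of "cmod (f x)" "cmod (g x)"] by (simp add: power2_sum)
      finally show ?thesis .
    qed
    then show "AE x in circ. norm ((cmod (f x + g x))\<^sup>2) \<le> norm (2 * (cmod (f x))\<^sup>2 + 2 * (cmod (g x))\<^sup>2)"
      by simp
  qed simp
  then show ?thesis by (simp add: L2c_def)
qed

lemma L2c_diff: "L2c f \<Longrightarrow> L2c g \<Longrightarrow> L2c (\<lambda>x. f x - g x)"
  using L2c_add[OF _ L2c_cmult[of g "-1"], of f] by simp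

lemma fc_diff_op:
  assumes u: "lip_circ L u"
  shows "fc (diff_op h u) k = (echar k h - 1) * fc u k"
proof -
  have "fc (diff_op h u) k = fc (\<lambda>x. u (x + h)) k - fc u k"
    unfolding fc_eq_cfc diff_op_def of_real_diff
    by (intro cfc_diff L2c_lip_circ[OF lip_circ_shift[OF u]] L2c_lip_circ[OF u])
  also have "fc (\<lambda>x. u (x + h)) k = echar k h * fc u k"
    using u by (intro fc_shift) (auto simp: lip_circ_periodic dest: lip_circ_measurable)
  finally show ?thesis by (simp add: algebra_simps)
qed

lemma L2c_diff_op: "lip_circ L u \<Longrightarrow> L2c (\<lambda>x. of_real (diff_op h u x))"
  unfolding diff_op_def of_real_diff by (intro L2c_diff L2c_lip_circ lip_circ_shift)

text \<open>Bessel is applied to difference quotients, which are bounded by \<open>L\<close>. On a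
  finite set of frequencies the step may tend to zero, and the bounds on finite sets give the bound
  on the whole sum.\<close>

lemma nn_integral_Dx_fc_le:
  assumes u: "lip_circ L u"
  shows "(\<integral>\<^sup>+k. ennreal ((cmod (Dx (fc u) k))\<^sup>2) \<partial>count_space UNIV) \<le> ennreal (L\<^sup>2)"
proof (rule nn_integral_count_space_int_le)
  fix K :: "int set" assume K: "finite K"
  define e where "e n = 1 / real (Suc n)" for n
  have e: "e n > 0" "e \<longlonglongrightarrow> 0" for n
    unfolding e_def using LIMSEQ_inverse_real_of_nat by (auto simp: inverse_eq_divide)
  have "(\<Sum>k\<in>K. (cmod ((echar k (e n) - 1) / of_real (e n) * fc u k))\<^sup>2) \<le> L\<^sup>2" for n
  proof -
    let ?q = "\<lambda>x. of_real (1 / e n) * of_real (diff_op (e n) u x) :: complex"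
    have q: "L2c ?q" by (intro L2c_cmult L2c_diff_op[OF u])
    have "cfc ?q k = (echar k (e n) - 1) / of_real (e n) * fc u k" for k
      unfolding cfc_cmult using fc_diff_op[OF u, of "e n" k] by (simp add: fc_eq_cfc)
    then have "(\<Sum>k\<in>K. (cmod ((echar k (e n) - 1) / of_real (e n) * fc u k))\<^sup>2) \<le> (\<integral>x. (cmod (?q x))\<^sup>2 \<partial>circ)"
      using Bessel_finite[OF q K] by simp
    also have "\<dots> \<le> (\<integral>x. L\<^sup>2 \<partial>circ)"
    proof (rule integral_mono)
      show "integrable circ (\<lambda>x. (cmod (?q x))\<^sup>2)" using q by (simp add: L2c_def)
      fix x
      have "\<bar>diff_op (e n) u x\<bar> \<le> L * e n"
        using lip_circD[OF u, of "x + e n" x] e(1)[of n] by (simp add: diff_op_def)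
      then have "cmod (?q x) \<le> L"
        using e(1)[of n] by (simp add: norm_divide field_simps)
      then show "(cmod (?q x))\<^sup>2 \<le> L\<^sup>2" by (intro power_mono) auto
    qed simp
    finally show ?thesis by (simp add: circ.prob_space[simplified])
  qed
  moreover have "(\<lambda>n. \<Sum>k\<in>K. (cmod ((echar k (e n) - 1) / of_real (e n) * fc u k))\<^sup>2)
      \<longlonglongrightarrow> (\<Sum>k\<in>K. (cmod (2 * of_real pi * \<i> * of_int k * fc u k))\<^sup>2)"
    using e by (intro tendsto_sum tendsto_power tendsto_norm tendsto_mult tendsto_const echar_difference_quotient)
      (auto simp: less_imp_neq[THEN not_sym])
  ultimately have "(\<Sum>k\<in>K. (cmod (Dx (fc u) k))\<^sup>2) \<le> L\<^sup>2"
    unfolding Dx_def by (intro LIMSEQ_le_const2) auto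
  then show "(\<Sum>k\<in>K. ennreal ((cmod (Dx (fc u) k))\<^sup>2)) \<le> ennreal (L\<^sup>2)"
    by (simp add: sum_ennreal ennreal_leI)
qed

text \<open>Young's inequality with weight \<open>1 + k^2\<close> bounds a coefficient by its
  square, the square of its \<open>Dx\<close>, and \<open>1 / (1 + k^2)\<close>; all three are
  summable. Absolute convergence is what later allows Parseval with a merely square integrable
  partner.\<close>

lemma integrable_fc_lip_circ:
  assumes u: "lip_circ L u"
  shows "integrable (count_space UNIV) (fc u)"
proof (rule integrable_count_space_intI)
  have "ennreal (cmod (fc u k)) \<le> ennreal ((cmod (fc u k))\<^sup>2) + (ennreal ((cmod (Dx (fc u) k))\<^sup>2) + ennreal (1 / (1 + (of_int k)\<^sup>2)))" for k
  proof -
    let ?c = "cmod (fc u k)" and ?w = "1 + (real_of_int k)\<^sup>2"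
    have w: "?w > 0" by (simp add: add_pos_nonneg)
    have "2 * ?c \<le> ?w * ?c\<^sup>2 + 1 / ?w"
    proof -
      have "2 * c \<le> v * c\<^sup>2 + 1 / v" if "v > 0" for v c :: real
      proof -
        have "0 \<le> (v * c - 1)\<^sup>2 / v" using that by (intro divide_nonneg_pos) auto
        also have "\<dots> = v * c\<^sup>2 - 2 * c + 1 / v"
          using that by (simp add: field_simps power2_eq_square)
        finally show ?thesis by simp
      qed
      then show ?thesis using w by blast
    qed
    moreover have "?w * ?c\<^sup>2 \<le> ?c\<^sup>2 + (cmod (Dx (fc u) k))\<^sup>2"
    proof -
      have "1 \<le> (2 * pi)\<^sup>2" using pi_gt3 by (intro one_le_power) simp
      from mult_right_mono[OF this, of "(of_int k)\<^sup>2 * ?c\<^sup>2"]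
      have "(of_int k)\<^sup>2 * ?c\<^sup>2 \<le> (2 * pi)\<^sup>2 * ((of_int k)\<^sup>2 * ?c\<^sup>2)" by simp
      then show ?thesis by (simp add: Dx_def norm_mult power_mult_distrib algebra_simps)
    qed
    moreover have "0 \<le> ?c" by simp
    ultimately have "?c \<le> ?c\<^sup>2 + ((cmod (Dx (fc u) k))\<^sup>2 + 1 / ?w)" by linarith
    then show ?thesis using w by (simp flip: ennreal_plus)
  qed
  then have "(\<integral>\<^sup>+k. ennreal (cmod (fc u k)) \<partial>count_space UNIV)
    \<le> (\<integral>\<^sup>+k. ennreal ((cmod (fc u k))\<^sup>2) + (ennreal ((cmod (Dx (fc u) k))\<^sup>2) + ennreal (1 / (1 + (of_int k)\<^sup>2))) \<partial>count_space UNIV)"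
    by (intro nn_integral_mono) auto
  also have "\<dots> = (\<integral>\<^sup>+k. ennreal ((cmod (fc u k))\<^sup>2) \<partial>count_space UNIV) + ((\<integral>\<^sup>+k. ennreal ((cmod (Dx (fc u) k))\<^sup>2) \<partial>count_space UNIV)
     + (\<integral>\<^sup>+k. ennreal (1 / (1 + (of_int k)\<^sup>2)) \<partial>count_space UNIV))"
    by (subst nn_integral_add nn_integral_add; simp)+
  also have "\<dots> \<le> ennreal (\<integral>x. (cmod (of_real (u x)))\<^sup>2 \<partial>circ) + (ennreal (L\<^sup>2) + 5)"
    using Bessel[OF L2c_lip_circ[OF u]]
    by (intro add_mono nn_integral_Dx_fc_le[OF u] nn_integral_inverse_squares_int) (simp add: fc_eq_cfc)
  also have "\<dots> < \<infinity>" by (simp add: ennreal_add_eq_top less_top)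
  finally show "(\<integral>\<^sup>+k. ennreal (cmod (fc u k)) \<partial>count_space UNIV) < \<infinity>" .
qed

text \<open>
  With \<open>v(y) = (u(x + y) - u(x)) / (e\<^sup>2\<^sup>\<pi>\<^sup>i\<^sup>y - 1)\<close>, which is bounded, the coefficients of \<open>u(x + \<cdot>) - u(x)\<close>
  are differences of consecutive coefficients of \<open>v\<close>, so that the symmetric partial sums telescope.
\<close>

lemma Fourier_partial_sums:
  assumes u: "lip_circ L u"
  shows "(\<lambda>n. \<Sum>k\<in>{-int n..int n}. fc u k * echar k x) \<longlonglongrightarrow> of_real (u x)"
proof -
  define v where "v y = of_real (u (x + y) - u x) / (echar 1 y - 1)" for y
  have [measurable]: "u \<in> borel_measurable borel" using u by (rule lip_circ_measurable)
  have L: "0 \<le> L" using u by (rule lip_circ_nonneg)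
  have vper: "v (y + 1) = v y" for y
    using lip_circ_periodic[OF u, of "x + y"] by (simp add: v_def echar_periodic add.assoc)
  \<comment> \<open>The numerator is at most \<open>L\<close> times the distance from
    \<open>y\<close> to the nearer of 0 and 1, since \<open>u (x + y)\<close> equals
    \<open>u x\<close> at both ends; the denominator is at least four times that distance.\<close>
  have vb0: "cmod (v y) \<le> L" if y: "0 \<le> y" "y \<le> 1" for y
  proof -
    have "\<bar>u (x + y) - u x\<bar> \<le> L * min y (1 - y)"
      using lip_circD[OF u, of "x + y" x] lip_circD[OF u, of "x + y" "x + 1"] lip_circ_periodic[OF u, of x] y
      by (auto simp: min_def abs_if split: if_splits)
    also have "\<dots> \<le> L * cmod (echar 1 y - 1)"
    proof (intro mult_left_mono L)
      have "0 \<le> min y (1 - y)" using y by simp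
      then show "min y (1 - y) \<le> cmod (echar 1 y - 1)" using norm_echar_1_diff_ge[OF y] by (auto simp: min_def split: if_splits)
    qed
    finally have le: "\<bar>u (x + y) - u x\<bar> \<le> L * cmod (echar 1 y - 1)" .
    show ?thesis
    proof (cases "echar 1 y = 1")
      case False
      then have "0 < cmod (echar 1 y - 1)" by simp
      moreover have "cmod (v y) = \<bar>u (x + y) - u x\<bar> / cmod (echar 1 y - 1)"
        unfolding v_def norm_divide norm_of_real ..
      ultimately show ?thesis using le by (simp only: pos_divide_le_eq)
    qed (simp add: v_def L)
  qed
  have vb: "cmod (v y) \<le> L" for y
    using vb0[of "frac y"] periodic_frac[of v y, OF vper] frac_ge_0[of y] frac_lt_1[of y] by simp
  have "v \<in> borel_measurable borel" unfolding v_def by measurable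
  then have vL: "L2c v" using vb by (rule L2c_bounded)
  define c where "c = cfc v"
  have ue: "of_real (u (x + y)) - of_real (u x) = echar 1 y * v y - v y" if "y \<noteq> 0" "y \<noteq> 1" "y \<in> {0..1}" for y
  proof -
    have "0 < cmod (echar 1 y - 1)"
      using norm_echar_1_diff_ge[of y] that by (auto simp: min_def split: if_splits)
    then have "echar 1 y \<noteq> 1" by auto
    then have "of_real (u (x + y) - u x) = (echar 1 y - 1) * v y" by (simp add: v_def)
    then show ?thesis by (simp add: algebra_simps)
  qed
  have coef: "fc u k * echar k x = (if k = 0 then of_real (u x) else 0) + (c (k - 1) - c k)" for k
  proof -
    have "fc u k * echar k x = fc (\<lambda>y. u (y + x)) k"
      using u fc_shift[of u x k] by (simp add: lip_circ_periodic mult.commute)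
    also have "\<dots> = (\<integral>y. of_real (u x) * echar (- k) y + (v y * echar (- (k - 1)) y - v y * echar (- k) y) \<partial>circ)"
      unfolding fc_eq_cfc cfc_def
    proof (intro integral_cong_AE)
      have "AE y in lborel. y \<noteq> 0 \<and> y \<noteq> 1" by (intro AE_conjI AE_lborel_singleton)
      then have "AE y in circ. y \<noteq> 0 \<and> y \<noteq> 1"
        unfolding circ_def by (subst AE_restrict_space_iff) auto
      moreover have "AE y in circ. y \<in> {0..1}" by (intro AE_I2) simp
      ultimately show "AE y in circ. of_real (u (y + x)) * echar (- k) y
          = of_real (u x) * echar (- k) y + (v y * echar (- (k - 1)) y - v y * echar (- k) y)"
      proof eventually_elim
        case (elim y)
        have 1: "complex_of_real (u (y + x)) = of_real (u x) + (echar 1 y * v y - v y)"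
          using ue[of y] elim by (simp add: algebra_simps)
        have 2: "echar (- (k - 1)) y = echar (- k) y * echar 1 y"
          by (simp add: echar_mult algebra_simps)
        show ?case unfolding 1 2 by (simp add: algebra_simps)
      qed
    qed (use vL in \<open>measurable\<close>)
    also have "\<dots> = of_real (u x) * (\<integral>y. echar (- k) y \<partial>circ) + (c (k - 1) - c k)"
    proof -
      have i1: "integrable circ (\<lambda>y. of_real (u x) * echar (- k) y)"
        by (intro integrable_mult_right L2c_integrable L2c_echar)
      have i2: "integrable circ (\<lambda>y. v y * echar j y)" for j
        by (intro L2c_integrable_mult vL L2c_echar)
      show ?thesis
        unfolding c_def cfc_def
          Bochner_Integration.integral_add[OF i1 Bochner_Integration.integrable_diff[OF i2 i2]]
          Bochner_Integration.integral_diff[OF i2 i2] by simp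
    qed
    finally show ?thesis by (simp add: integral_echar)
  qed
  have tele: "(\<Sum>k\<in>{-int n..int n}. fc u k * echar k x) = of_real (u x) + (c (- 1 - int n) - c (int n))" for n
  proof -
    have "(\<Sum>k\<in>{-int n..int n}. c (k - 1) - c k) = c (- 1 - int n) - c (int n)"
    proof (induction n)
      case (Suc n)
      have eq: "{-int (Suc n)..int (Suc n)} = insert (int (Suc n)) (insert (- int (Suc n)) {-int n..int n})"
        by auto
      show ?case unfolding eq using Suc by (simp add: algebra_simps)
    qed simp
    moreover have "(\<Sum>k\<in>{-int n..int n}. (if k = 0 then of_real (u x) else 0)) = (of_real (u x) :: complex)"
      by (subst sum.delta) auto
    ultimately show ?thesis by (simp only: coef sum.distrib)
  qed
  have "(\<lambda>n. of_real (u x) + (c (- 1 - int n) - c (int n))) \<longlonglongrightarrow> of_real (u x) + (0 - 0)"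
    unfolding c_def by (intro tendsto_intros Riemann_Lebesgue vL) (auto simp: inj_def)
  then show ?thesis by (simp add: tele)
qed

section \<open>Parseval and weak derivatives\<close>

abbreviation L2r :: "(real \<Rightarrow> real) \<Rightarrow> bool" where
  "L2r F \<equiv> L2c (\<lambda>x. complex_of_real (F x))"

lemma cnj_fc: "cnj (fc F k) = (\<integral>x. of_real (F x) * echar k x \<partial>circ)"
  unfolding fc_eq_cfc cfc_def by (subst Bochner_Integration.integral_cnj[symmetric]) (simp add: cnj_echar)

lemma norm_fc_le:
  assumes "L2r F"
  shows "cmod (fc F k) \<le> (\<integral>x. \<bar>F x\<bar> \<partial>circ)"
  unfolding fc_eq_cfc cfc_def
  using integral_norm_bound[of circ "\<lambda>x. complex_of_real (F x) * echar (- k) x"] by (simp add: norm_mult)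

text \<open>The identity rests on \<open>u\<close>: its coefficients are absolutely summable, so the
  partial sums \<open>S\<close> are bounded by \<open>U\<close> uniformly, and
  \<open>|F| * U\<close> is an integrable majorant. The conjugate appears on \<open>fc F\<close>
  because \<open>F\<close> is real.\<close>

lemma
  assumes F: "L2r F" and u: "lip_circ L u"
  shows Parseval_integrable: "integrable (count_space UNIV) (\<lambda>k. cnj (fc F k) * fc u k)"
    and Parseval: "complex_of_real (\<integral>x. F x * u x \<partial>circ) = (\<integral>k. cnj (fc F k) * fc u k \<partial>count_space UNIV)"
proof -
  have int: "integrable (count_space UNIV) (fc u)" by (rule integrable_fc_lip_circ[OF u])
  show int2: "integrable (count_space UNIV) (\<lambda>k. cnj (fc F k) * fc u k)"
  proof (rule Bochner_Integration.integrable_bound)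
    show "integrable (count_space UNIV) (\<lambda>k. complex_of_real (\<integral>x. \<bar>F x\<bar> \<partial>circ) * fc u k)"
      using int by simp
    show "AE k in count_space UNIV. norm (cnj (fc F k) * fc u k) \<le> norm (complex_of_real (\<integral>x. \<bar>F x\<bar> \<partial>circ) * fc u k)"
      using norm_fc_le[OF F] by (auto simp: norm_mult intro!: mult_right_mono AE_I2 order_trans[OF _ abs_ge_self])
  qed simp
  define S where "S n x = (\<Sum>k\<in>{-int n..int n}. fc u k * echar k x)" for n x
  define U where "U = (\<integral>k. cmod (fc u k) \<partial>count_space UNIV)"
  have [measurable]: "u \<in> borel_measurable borel" using u by (rule lip_circ_measurable)
  have [measurable]: "(\<lambda>x. complex_of_real (F x)) \<in> borel_measurable borel" using F by (rule L2c_measurable)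
  have [measurable]: "S n \<in> borel_measurable borel" for n unfolding S_def by measurable
  have U: "cmod (S n x) \<le> U" for n x
  proof -
    have "cmod (S n x) \<le> (\<Sum>k\<in>{-int n..int n}. cmod (fc u k))"
      unfolding S_def by (rule order_trans[OF norm_sum]) (simp add: norm_mult)
    moreover have "ennreal (\<Sum>k\<in>{-int n..int n}. cmod (fc u k)) \<le> ennreal U"
    proof -
      have "ennreal U = (\<integral>\<^sup>+k. ennreal (cmod (fc u k)) \<partial>count_space UNIV)"
        unfolding U_def using int by (intro nn_integral_eq_integral[symmetric]) auto
      then show ?thesis
        using sum_le_nn_integral_count_space_int[of "{-int n..int n}" "\<lambda>k. ennreal (cmod (fc u k))"]
        by (simp add: sum_ennreal)
    qed
    moreover have "0 \<le> U" unfolding U_def by simp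
    ultimately show ?thesis by (simp add: ennreal_le_iff)
  qed
  have "(\<lambda>n. \<integral>x. of_real (F x) * S n x \<partial>circ) \<longlonglongrightarrow> (\<integral>x. of_real (F x) * of_real (u x) \<partial>circ)"
  proof (rule integral_dominated_convergence[where w = "\<lambda>x. \<bar>F x\<bar> * U"])
    show "integrable circ (\<lambda>x. \<bar>F x\<bar> * U)"
      using integrable_norm[OF L2c_integrable[OF F]] by simp
    show "AE x in circ. (\<lambda>n. of_real (F x) * S n x) \<longlonglongrightarrow> of_real (F x) * of_real (u x)"
      unfolding S_def by (intro AE_I2 tendsto_intros Fourier_partial_sums[OF u])
    show "AE x in circ. norm (of_real (F x) * S n x) \<le> \<bar>F x\<bar> * U" for n
      using U by (auto simp: norm_mult intro!: mult_left_mono)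
  qed (auto intro!: measurable_circ borel_measurable_times)
  moreover have "(\<integral>x. of_real (F x) * S n x \<partial>circ) = (\<Sum>k\<in>{-int n..int n}. cnj (fc F k) * fc u k)" for n
  proof -
    have "(\<integral>x. of_real (F x) * S n x \<partial>circ) = (\<integral>x. (\<Sum>k\<in>{-int n..int n}. fc u k * (of_real (F x) * echar k x)) \<partial>circ)"
      unfolding S_def sum_distrib_left by (simp add: mult_ac)
    also have "\<dots> = (\<Sum>k\<in>{-int n..int n}. fc u k * (\<integral>x. of_real (F x) * echar k x \<partial>circ))"
      by (subst Bochner_Integration.integral_sum) (auto intro!: integrable_mult_right L2c_integrable_mult F L2c_echar)
    finally show ?thesis by (simp add: cnj_fc mult.commute)
  qed
  ultimately have "(\<lambda>n. \<Sum>k\<in>{-int n..int n}. cnj (fc F k) * fc u k) \<longlonglongrightarrow> (\<integral>x. of_real (F x) * of_real (u x) \<partial>circ)"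
    by simp
  moreover note sum_symmetric_int_tendsto[OF int2]
  ultimately have "(\<integral>x. complex_of_real (F x) * of_real (u x) \<partial>circ) = (\<integral>k. cnj (fc F k) * fc u k \<partial>count_space UNIV)"
    by (rule LIMSEQ_unique)
  then show "complex_of_real (\<integral>x. F x * u x \<partial>circ) = (\<integral>k. cnj (fc F k) * fc u k \<partial>count_space UNIV)"
    by (simp flip: of_real_mult integral_complex_of_real)
qed

lemma lip_circ_diff: "lip_circ L u \<Longrightarrow> lip_circ L' v \<Longrightarrow> lip_circ (L + L') (\<lambda>x. u x - v x)"
proof -
  assume uv: "lip_circ L u" "lip_circ L' v"
  have "\<bar>u x - v x - (u y - v y)\<bar> \<le> (L + L') * \<bar>x - y\<bar>" for x y
    using lip_circD[OF uv(1), of x y] lip_circD[OF uv(2), of x y] by (simp add: distrib_right)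
  then show ?thesis using uv by (simp add: lip_circ_def)
qed

lemma lip_circ_diff_op: "lip_circ L u \<Longrightarrow> lip_circ (L + L) (diff_op h u)"
  unfolding diff_op_def by (intro lip_circ_diff lip_circ_shift)

lemma nn_integral_fc_square_finite:
  assumes "L2r F"
  shows "(\<integral>\<^sup>+k. ennreal ((cmod (fc F k))\<^sup>2) \<partial>count_space UNIV) < \<infinity>"
  using Bessel[OF assms] by (simp add: fc_eq_cfc) (metis ennreal_less_top le_less_trans)

lemma integrable_fc_Dx:
  assumes F: "L2r F" and u: "lip_circ L u"
  shows "integrable (count_space UNIV) (\<lambda>k. cnj (fc F k) * Dx (fc u) k)"
proof (rule integrable_count_space_intI)
  have "cmod (cnj (fc F k) * Dx (fc u) k) \<le> (cmod (fc F k))\<^sup>2 + (cmod (Dx (fc u) k))\<^sup>2" for k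
  proof -
    have "0 \<le> cmod (fc F k) * cmod (Dx (fc u) k)" by simp
    then show ?thesis
      using sum_squares_bound[of "cmod (fc F k)" "cmod (Dx (fc u) k)"]
      by (simp only: norm_mult mult.assoc complex_mod_cnj)
  qed
  then have "(\<integral>\<^sup>+k. ennreal (cmod (cnj (fc F k) * Dx (fc u) k)) \<partial>count_space UNIV)
     \<le> (\<integral>\<^sup>+k. ennreal ((cmod (fc F k))\<^sup>2) + ennreal ((cmod (Dx (fc u) k))\<^sup>2) \<partial>count_space UNIV)"
    by (intro nn_integral_mono) (simp flip: ennreal_plus add: ennreal_leI)
  also have "\<dots> = (\<integral>\<^sup>+k. ennreal ((cmod (fc F k))\<^sup>2) \<partial>count_space UNIV) + (\<integral>\<^sup>+k. ennreal ((cmod (Dx (fc u) k))\<^sup>2) \<partial>count_space UNIV)"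
    by (rule nn_integral_add) auto
  also have "\<dots> < \<infinity>"
    using nn_integral_fc_square_finite[OF F] le_less_trans[OF nn_integral_Dx_fc_le[OF u] ennreal_less_top]
    by (simp add: less_top)
  finally show "(\<integral>\<^sup>+k. ennreal (cmod (cnj (fc F k) * Dx (fc u) k)) \<partial>count_space UNIV) < \<infinity>" .
qed

text \<open>The series is the pairing of \<open>F\<close> with the distributional derivative of
  \<open>u\<close>. The limit is taken on the frequency side, where the multipliers of the quotients
  have modulus at most \<open>2 pi |k|\<close>. The null sequence is left open because harmonic and
  dyadic steps are both used.\<close>

lemma weak_derivative_limit:
  assumes F: "L2r F" and u: "lip_circ L u" and e: "\<And>n. e n \<noteq> 0" "e \<longlonglongrightarrow> 0"
  shows "(\<lambda>n. \<integral>x. F x * (diff_op (e n) u x / e n) \<partial>circ)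
    \<longlonglongrightarrow> Re (\<integral>k. cnj (fc F k) * Dx (fc u) k \<partial>count_space UNIV)"
proof -
  have "(\<lambda>n. \<integral>k. cnj (fc F k) * ((echar k (e n) - 1) / of_real (e n) * fc u k) \<partial>count_space UNIV)
      \<longlonglongrightarrow> (\<integral>k. cnj (fc F k) * Dx (fc u) k \<partial>count_space UNIV)"
  proof (rule integral_dominated_convergence[where w = "\<lambda>k. cmod (cnj (fc F k) * Dx (fc u) k)"])
    show "integrable (count_space UNIV) (\<lambda>k. cmod (cnj (fc F k) * Dx (fc u) k))"
      by (intro integrable_norm integrable_fc_Dx[OF F u])
    show "AE k in count_space UNIV. (\<lambda>n. cnj (fc F k) * ((echar k (e n) - 1) / of_real (e n) * fc u k))
        \<longlonglongrightarrow> cnj (fc F k) * Dx (fc u) k"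
      unfolding Dx_def by (intro AE_I2 tendsto_mult tendsto_const echar_difference_quotient e)
    show "AE k in count_space UNIV. norm (cnj (fc F k) * ((echar k (e n) - 1) / of_real (e n) * fc u k))
        \<le> cmod (cnj (fc F k) * Dx (fc u) k)" for n
    proof (rule AE_I2)
      fix k
      have "cmod ((echar k (e n) - 1) / of_real (e n)) \<le> 2 * pi * \<bar>of_int k\<bar>"
        using norm_echar_diff_1_le[of k "e n"] e(1)[of n] by (simp add: norm_divide pos_divide_le_eq)
      then have "cmod ((echar k (e n) - 1) / of_real (e n) * fc u k) \<le> cmod (Dx (fc u) k)"
        unfolding Dx_def norm_mult by (intro mult_right_mono) (auto simp: norm_mult)
      then show "norm (cnj (fc F k) * ((echar k (e n) - 1) / of_real (e n) * fc u k)) \<le> cmod (cnj (fc F k) * Dx (fc u) k)"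
        unfolding norm_mult[of "cnj (fc F k)"] by (rule mult_left_mono) simp
    qed
  qed auto
  moreover have "(\<integral>k. cnj (fc F k) * ((echar k (e n) - 1) / of_real (e n) * fc u k) \<partial>count_space UNIV)
      = complex_of_real (\<integral>x. F x * (diff_op (e n) u x / e n) \<partial>circ)" for n
  proof -
    have "complex_of_real (\<integral>x. F x * diff_op (e n) u x \<partial>circ)
        = (\<integral>k. cnj (fc F k) * ((echar k (e n) - 1) * fc u k) \<partial>count_space UNIV)"
      using Parseval[OF F lip_circ_diff_op[OF u], of "e n"] by (simp add: fc_diff_op[OF u])
    then show ?thesis by simp
  qed
  ultimately have "(\<lambda>n. complex_of_real (\<integral>x. F x * (diff_op (e n) u x / e n) \<partial>circ))
      \<longlonglongrightarrow> (\<integral>k. cnj (fc F k) * Dx (fc u) k \<partial>count_space UNIV)" by (simp only:)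
  from tendsto_Re[OF this] show ?thesis by simp
qed

text \<open>The bridge between increments in physical space, which the test function controls, and
  weighted sums of coefficients, which define \<open>H_norm\<close>.\<close>

lemma Parseval_diff_op:
  assumes u: "lip_circ L u"
  shows "ennreal (\<integral>x. (diff_op h u x)\<^sup>2 \<partial>circ)
    = (\<integral>\<^sup>+k. ennreal ((cmod (echar k h - 1))\<^sup>2 * (cmod (fc u k))\<^sup>2) \<partial>count_space UNIV)"
proof -
  let ?d = "diff_op h u"
  have d: "lip_circ (L + L) ?d" by (rule lip_circ_diff_op[OF u])
  have sq: "cnj (fc ?d k) * fc ?d k = complex_of_real ((cmod (fc ?d k))\<^sup>2)" for k
    by (subst complex_norm_square) (rule mult.commute)
  have int: "integrable (count_space UNIV) (\<lambda>k. (cmod (fc ?d k))\<^sup>2)"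
    using Parseval_integrable[OF L2c_lip_circ[OF d] d] unfolding sq by (simp only: complex_of_real_integrable_eq)
  have "complex_of_real (\<integral>x. ?d x * ?d x \<partial>circ) = complex_of_real (\<integral>k. (cmod (fc ?d k))\<^sup>2 \<partial>count_space UNIV)"
    using Parseval[OF L2c_lip_circ[OF d] d] unfolding sq by (simp only: integral_complex_of_real)
  then have "(\<integral>x. (?d x)\<^sup>2 \<partial>circ) = (\<integral>k. (cmod (fc ?d k))\<^sup>2 \<partial>count_space UNIV)"
    by (simp only: of_real_eq_iff power2_eq_square)
  then have "ennreal (\<integral>x. (?d x)\<^sup>2 \<partial>circ) = (\<integral>\<^sup>+k. ennreal ((cmod (fc ?d k))\<^sup>2) \<partial>count_space UNIV)"
    using int by (simp add: nn_integral_eq_integral)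
  then show ?thesis by (simp add: fc_diff_op[OF u] norm_mult power_mult_distrib)
qed

section \<open>Sobolev norms\<close>

lemma ennpow_half_square: "(ennpow x (1 / 2))\<^sup>2 = x"
  by (cases x) (auto simp: ennpow_def ennreal_power powr_half_sqrt)

lemma H_norm_square:
  "(H_norm r c)\<^sup>2 = (\<integral>\<^sup>+k. ennreal ((1 + (2 * pi * of_int k)\<^sup>2) powr r * (cmod (c k))\<^sup>2) \<partial>count_space UNIV)"
  unfolding H_norm_def ennpow_half_square nn_integral_count_space_int_eq_infsum ..

section \<open>Fractional norms through increments\<close>

lemma nn_integral_powr_0_1:
  assumes "a > -1"
  shows "(\<integral>\<^sup>+x\<in>{0<..<1}. ennreal (x powr a) \<partial>lborel) = ennreal (1 / (a + 1))"
proof -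
  have "((\<lambda>x. x powr a) has_integral 1 / (a + 1)) {0..1}"
    using has_integral_powr_from_0[OF assms, of 1] by simp
  then have "((\<lambda>x. if x \<in> {0..1} then x powr a else 0) has_integral 1 / (a + 1)) UNIV"
    by (simp only: has_integral_restrict_UNIV)
  then have "(\<integral>\<^sup>+x. ennreal (if x \<in> {0..1} then x powr a else 0) \<partial>lborel) = ennreal (1 / (a + 1))"
    by (intro nn_integral_has_integral_lborel) auto
  also have "(\<integral>\<^sup>+x. ennreal (if x \<in> {0..1} then x powr a else 0) \<partial>lborel)
      = (\<integral>\<^sup>+x\<in>{0<..<1}. ennreal (x powr a) \<partial>lborel)"
  proof (intro nn_integral_cong_AE)
    have "AE x in lborel. x \<noteq> 0 \<and> x \<noteq> (1 :: real)" by (intro AE_conjI AE_lborel_singleton)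
    then show "AE x in lborel. ennreal (if x \<in> {0..1} then x powr a else 0) = ennreal (x powr a) * indicator {0<..<1} x"
      by eventually_elim (auto simp: indicator_def)
  qed
  finally show ?thesis by simp
qed

lemma nn_integral_powr_1_inf:
  assumes "a < -1"
  shows "(\<integral>\<^sup>+x\<in>{1..}. ennreal (x powr a) \<partial>lborel) = ennreal (- 1 / (a + 1))"
proof -
  have "((\<lambda>x. x powr a) has_integral - 1 / (a + 1)) {1..}"
    using has_integral_powr_to_inf[OF assms, of 1] by simp
  then have "((\<lambda>x. if x \<in> {1..} then x powr a else 0) has_integral - 1 / (a + 1)) UNIV"
    by (simp only: has_integral_restrict_UNIV)
  then have "(\<integral>\<^sup>+x. ennreal (if x \<in> {1..} then x powr a else 0) \<partial>lborel) = ennreal (- 1 / (a + 1))"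
    by (intro nn_integral_has_integral_lborel) auto
  also have "(\<integral>\<^sup>+x. ennreal (if x \<in> {1..} then x powr a else 0) \<partial>lborel)
      = (\<integral>\<^sup>+x\<in>{1..}. ennreal (x powr a) \<partial>lborel)"
    by (intro nn_integral_cong) (auto simp: indicator_def)
  finally show ?thesis .
qed

text \<open>The normalising constant between the multiplier \<open>|k|^\<gamma>\<close> and the
  Gagliardo integral of squared increments.\<close>

definition gagliardo_const :: "real \<Rightarrow> ennreal" where
  "gagliardo_const \<gamma> = (\<integral>\<^sup>+\<rho>\<in>{0<..}. ennreal (\<rho> powr (- 1 - \<gamma>) * (cmod (echar 1 \<rho> - 1))\<^sup>2) \<partial>lborel)"

text \<open>The integrand is at most \<open>4 pi^2 \<rho>^(1 - \<gamma>)\<close> below 1 and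
  \<open>4 \<rho>^(-1 - \<gamma>)\<close> above; the former is integrable for
  \<open>\<gamma> < 2\<close>, the latter for \<open>\<gamma> > 0\<close>.\<close>

lemma gagliardo_const_finite:
  assumes "0 < \<gamma>" "\<gamma> < 2"
  shows "gagliardo_const \<gamma> < \<infinity>"
proof -
  let ?f = "\<lambda>\<rho>. ennreal (\<rho> powr (- 1 - \<gamma>) * (cmod (echar 1 \<rho> - 1))\<^sup>2)"
  have le: "?f \<rho> * indicator {0<..} \<rho> \<le> ennreal (4 * pi\<^sup>2) * (ennreal (\<rho> powr (1 - \<gamma>)) * indicator {0<..<1} \<rho>)
      + 4 * (ennreal (\<rho> powr (- 1 - \<gamma>)) * indicator {1..} \<rho>)" for \<rho> :: real
  proof (cases "0 < \<rho>")
    case \<rho>: True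
    show ?thesis
    proof (cases "\<rho> < 1")
      case True
      have "(cmod (echar 1 \<rho> - 1))\<^sup>2 \<le> (2 * pi * \<rho>)\<^sup>2"
        using norm_echar_diff_1_le[of 1 \<rho>] \<rho> by (intro power_mono) auto
      then have "\<rho> powr (- 1 - \<gamma>) * (cmod (echar 1 \<rho> - 1))\<^sup>2 \<le> \<rho> powr (- 1 - \<gamma>) * (2 * pi * \<rho>)\<^sup>2"
        by (intro mult_left_mono) auto
      also have "\<dots> = 4 * pi\<^sup>2 * (\<rho> powr (- 1 - \<gamma>) * \<rho> powr 2)"
        using \<rho> by (simp add: power_mult_distrib)
      also have "\<rho> powr (- 1 - \<gamma>) * \<rho> powr 2 = \<rho> powr (1 - \<gamma>)"
        by (simp add: powr_add[symmetric])
      finally show ?thesis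
        using \<rho> True by (simp flip: ennreal_mult add: ennreal_leI)
    next
      case False
      have "(cmod (echar 1 \<rho> - 1))\<^sup>2 \<le> 2\<^sup>2"
        using norm_triangle_ineq4[of "echar 1 \<rho>" 1] by (intro power_mono) auto
      then have "\<rho> powr (- 1 - \<gamma>) * (cmod (echar 1 \<rho> - 1))\<^sup>2 \<le> 4 * \<rho> powr (- 1 - \<gamma>)"
        by (subst mult.commute, intro mult_right_mono) auto
      from ennreal_leI[OF this] show ?thesis
        using \<rho> False ennreal_mult[of 4 "\<rho> powr (- 1 - \<gamma>)"] by simp
    qed
  qed simp
  have "gagliardo_const \<gamma> \<le> (\<integral>\<^sup>+\<rho>. ennreal (4 * pi\<^sup>2) * (ennreal (\<rho> powr (1 - \<gamma>)) * indicator {0<..<1} \<rho>)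
      + 4 * (ennreal (\<rho> powr (- 1 - \<gamma>)) * indicator {1..} \<rho>) \<partial>lborel)"
    unfolding gagliardo_const_def by (intro nn_integral_mono le)
  also have "\<dots> = ennreal (4 * pi\<^sup>2) * (\<integral>\<^sup>+\<rho>\<in>{0<..<1}. ennreal (\<rho> powr (1 - \<gamma>)) \<partial>lborel)
      + 4 * (\<integral>\<^sup>+\<rho>\<in>{1..}. ennreal (\<rho> powr (- 1 - \<gamma>)) \<partial>lborel)"
    by (simp add: nn_integral_add nn_integral_cmult)
  also have "\<dots> < \<infinity>"
    using assms by (subst nn_integral_powr_0_1 nn_integral_powr_1_inf; simp add: ennreal_mult_less_top)+
  finally show ?thesis .
qed

text \<open>On \<open>{1/4..1/2}\<close> the integrand is at least 1. Positivity and finiteness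
  together allow the constant to be cancelled in an \<open>ennreal\<close> inequality.\<close>

lemma gagliardo_const_pos:
  assumes "0 < \<gamma>"
  shows "0 < gagliardo_const \<gamma>"
proof -
  have ge: "1 \<le> \<rho> powr (- 1 - \<gamma>) * (cmod (echar 1 \<rho> - 1))\<^sup>2" if "\<rho> \<in> {1 / 4..1 / 2}" for \<rho>
  proof -
    have "1 \<le> cmod (echar 1 \<rho> - 1)"
      using norm_echar_1_diff_ge[of \<rho>] that by (auto simp: min_def split: if_splits)
    then have "1 \<le> (cmod (echar 1 \<rho> - 1))\<^sup>2" by (rule one_le_power)
    moreover have "1 \<le> \<rho> powr (- 1 - \<gamma>)"
    proof -
      have "\<rho> powr (1 + \<gamma>) \<le> 1" using that assms by (intro powr_le1) auto
      moreover have "0 < \<rho> powr (1 + \<gamma>)" using that by simp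
      moreover have "\<rho> powr (- 1 - \<gamma>) = 1 / \<rho> powr (1 + \<gamma>)"
        using powr_minus_divide[of \<rho> "1 + \<gamma>"] by simp
      ultimately show ?thesis by (simp add: le_divide_eq)
    qed
    ultimately show ?thesis using mult_mono[of 1 _ 1] by fastforce
  qed
  have "0 < ennreal (1 / 4)" by simp
  also have "ennreal (1 / 4) = (\<integral>\<^sup>+\<rho>. indicator {1 / 4..1 / 2 :: real} \<rho> \<partial>lborel)"
    by simp
  also have "\<dots> \<le> gagliardo_const \<gamma>"
    unfolding gagliardo_const_def
  proof (intro nn_integral_mono)
    fix \<rho> :: real
    show "indicator {1 / 4..1 / 2} \<rho> \<le> ennreal (\<rho> powr (- 1 - \<gamma>) * (cmod (echar 1 \<rho> - 1))\<^sup>2) * indicator {0<..} \<rho>"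
      using ge[of \<rho>] by (auto simp: indicator_def ennreal_ge_1)
  qed
  finally show ?thesis .
qed

text \<open>Substitution of \<open>|k| \<rho>\<close>; the modulus
  \<open>|echar k \<rho> - 1|\<close> depends on \<open>|k|\<close> only. At \<open>k = 0\<close>
  both sides vanish, since \<open>0 powr \<gamma> = 0\<close>.\<close>

lemma gagliardo_scaling:
  assumes "0 < \<gamma>"
  shows "(\<integral>\<^sup>+\<rho>\<in>{0<..}. ennreal (\<rho> powr (- 1 - \<gamma>) * (cmod (echar k \<rho> - 1))\<^sup>2) \<partial>lborel)
    = ennreal (\<bar>of_int k\<bar> powr \<gamma>) * gagliardo_const \<gamma>"
proof (cases "k = 0")
  case False
  define c where "c = \<bar>real_of_int k\<bar>"
  have c: "c > 0" using False by (simp add: c_def)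
  have e: "cmod (echar k \<rho> - 1) = cmod (echar 1 (c * \<rho>) - 1)" for \<rho>
    by (cases "k \<ge> 0") (auto simp: norm_echar_diff_1 c_def mult.assoc)
  let ?g = "\<lambda>\<rho>. ennreal (\<rho> powr (- 1 - \<gamma>) * (cmod (echar 1 \<rho> - 1))\<^sup>2) * indicator {0<..} \<rho>"
  have [measurable]: "?g \<in> borel_measurable borel" by measurable
  have "ennreal (c powr \<gamma>) * gagliardo_const \<gamma> = ennreal (c powr \<gamma>) * (\<integral>\<^sup>+\<rho>. ?g \<rho> \<partial>lborel)"
    by (simp add: gagliardo_const_def)
  also have "(\<integral>\<^sup>+\<rho>. ?g \<rho> \<partial>lborel) = ennreal c * (\<integral>\<^sup>+\<rho>. ?g (0 + c * \<rho>) \<partial>lborel)"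
    using c by (subst nn_integral_real_affine[where c = c and t = 0]) auto
  also have "ennreal (c powr \<gamma>) * (ennreal c * (\<integral>\<^sup>+\<rho>. ?g (0 + c * \<rho>) \<partial>lborel))
      = (\<integral>\<^sup>+\<rho>. ennreal (c powr \<gamma>) * (ennreal c * ?g (0 + c * \<rho>)) \<partial>lborel)"
    by (subst nn_integral_cmult nn_integral_cmult; measurable)+
  also have "\<dots> = (\<integral>\<^sup>+\<rho>\<in>{0<..}. ennreal (\<rho> powr (- 1 - \<gamma>) * (cmod (echar k \<rho> - 1))\<^sup>2) \<partial>lborel)"
  proof (intro nn_integral_cong)
    fix \<rho> :: real
    show "ennreal (c powr \<gamma>) * (ennreal c * ?g (0 + c * \<rho>))
        = ennreal (\<rho> powr (- 1 - \<gamma>) * (cmod (echar k \<rho> - 1))\<^sup>2) * indicator {0<..} \<rho>"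
    proof (cases "\<rho> > 0")
      case True
      have "c powr \<gamma> * (c * (c powr (- 1 - \<gamma>) * \<rho> powr (- 1 - \<gamma>))) = \<rho> powr (- 1 - \<gamma>)"
        using c by (simp add: powr_diff powr_minus field_simps)
      then show ?thesis
        using True c by (simp add: e powr_mult mult.assoc flip: ennreal_mult)
    qed (use c in \<open>simp add: zero_less_mult_iff\<close>)
  qed
  finally show ?thesis by (simp add: c_def)
qed (use assms in \<open>simp\<close>)

text \<open>An inequality between the \<open>L^2\<close> norms of all increments is integrated
  against \<open>\<rho>^(-1 - \<gamma>)\<close>. By Parseval and Tonelli this multiplies both
  seminorms by the same constant, which cancels.\<close>

lemma homogeneous_contraction:
  assumes \<gamma>: "0 < \<gamma>" "\<gamma> \<le> 2" and u: "lip_circ L u" and m: "lip_circ L' m"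
    and le: "\<And>\<rho>. (\<integral>x. (diff_op \<rho> u x)\<^sup>2 \<partial>circ) \<le> \<kappa>\<^sup>2 * (\<integral>x. (diff_op \<rho> m x)\<^sup>2 \<partial>circ)"
  shows "(\<integral>\<^sup>+k. ennreal (\<bar>of_int k\<bar> powr \<gamma>) * ennreal ((cmod (fc u k))\<^sup>2) \<partial>count_space UNIV)
    \<le> ennreal (\<kappa>\<^sup>2) * (\<integral>\<^sup>+k. ennreal (\<bar>of_int k\<bar> powr \<gamma>) * ennreal ((cmod (fc m k))\<^sup>2) \<partial>count_space UNIV)"
proof -
  let ?S = "\<lambda>\<rho> v. \<integral>\<^sup>+k. ennreal ((cmod (echar k \<rho> - 1))\<^sup>2 * (cmod (fc v k))\<^sup>2) \<partial>count_space UNIV"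
  have S: "?S \<rho> u \<le> ennreal (\<kappa>\<^sup>2) * ?S \<rho> m" for \<rho>
    using ennreal_leI[OF le[of \<rho>]] by (simp add: ennreal_mult Parseval_diff_op[OF u] Parseval_diff_op[OF m])
  show ?thesis
  proof (cases "\<gamma> = 2")
    case False
    then have \<gamma>2: "\<gamma> < 2" using \<gamma> by simp
    have T: "(\<integral>\<^sup>+\<rho>. (ennreal (\<rho> powr (- 1 - \<gamma>)) * indicator {0<..} \<rho>) * (\<integral>\<^sup>+k. ennreal ((cmod (echar k \<rho> - 1))\<^sup>2) * c k \<partial>count_space UNIV) \<partial>lborel)
      = gagliardo_const \<gamma> * (\<integral>\<^sup>+k. ennreal (\<bar>of_int k\<bar> powr \<gamma>) * c k \<partial>count_space UNIV)" for c :: "int \<Rightarrow> ennreal"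
    proof -
      have "(\<integral>\<^sup>+\<rho>. (ennreal (\<rho> powr (- 1 - \<gamma>)) * indicator {0<..} \<rho>) * (\<integral>\<^sup>+k. ennreal ((cmod (echar k \<rho> - 1))\<^sup>2) * c k \<partial>count_space UNIV) \<partial>lborel)
        = (\<integral>\<^sup>+\<rho>. \<integral>\<^sup>+k. (ennreal (\<rho> powr (- 1 - \<gamma>)) * indicator {0<..} \<rho>) * (ennreal ((cmod (echar k \<rho> - 1))\<^sup>2) * c k) \<partial>count_space UNIV \<partial>lborel)"
        by (simp add: nn_integral_cmult)
      also have "\<dots> = (\<integral>\<^sup>+k. \<integral>\<^sup>+\<rho>. (ennreal (\<rho> powr (- 1 - \<gamma>)) * indicator {0<..} \<rho>) * (ennreal ((cmod (echar k \<rho> - 1))\<^sup>2) * c k) \<partial>lborel \<partial>count_space UNIV)"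
        by (rule nn_integral_count_space_nn_integral) auto
      also have "\<dots> = (\<integral>\<^sup>+k. \<integral>\<^sup>+\<rho>. c k * (ennreal (\<rho> powr (- 1 - \<gamma>) * (cmod (echar k \<rho> - 1))\<^sup>2) * indicator {0<..} \<rho>) \<partial>lborel \<partial>count_space UNIV)"
        by (intro nn_integral_cong) (simp add: ennreal_mult mult_ac)
      also have "\<dots> = (\<integral>\<^sup>+k. c k * (ennreal (\<bar>of_int k\<bar> powr \<gamma>) * gagliardo_const \<gamma>) \<partial>count_space UNIV)"
        by (intro nn_integral_cong) (simp add: nn_integral_cmult gagliardo_scaling[OF \<gamma>(1)])
      also have "\<dots> = (\<integral>\<^sup>+k. gagliardo_const \<gamma> * (ennreal (\<bar>of_int k\<bar> powr \<gamma>) * c k) \<partial>count_space UNIV)"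
        by (simp add: mult_ac)
      finally show ?thesis by (simp add: nn_integral_cmult)
    qed
    have S': "(\<integral>\<^sup>+k. ennreal ((cmod (echar k \<rho> - 1))\<^sup>2) * ennreal ((cmod (fc u k))\<^sup>2) \<partial>count_space UNIV)
      \<le> (\<integral>\<^sup>+k. ennreal ((cmod (echar k \<rho> - 1))\<^sup>2) * (ennreal (\<kappa>\<^sup>2) * ennreal ((cmod (fc m k))\<^sup>2)) \<partial>count_space UNIV)" for \<rho>
    proof -
      have "ennreal (\<kappa>\<^sup>2) * ?S \<rho> m = (\<integral>\<^sup>+k. ennreal (\<kappa>\<^sup>2) * ennreal ((cmod (echar k \<rho> - 1))\<^sup>2 * (cmod (fc m k))\<^sup>2) \<partial>count_space UNIV)"
        by (simp add: nn_integral_cmult)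
      then show ?thesis using S[of \<rho>] by (simp add: ennreal_mult mult_ac)
    qed
    have "gagliardo_const \<gamma> * (\<integral>\<^sup>+k. ennreal (\<bar>of_int k\<bar> powr \<gamma>) * ennreal ((cmod (fc u k))\<^sup>2) \<partial>count_space UNIV)
      \<le> gagliardo_const \<gamma> * (\<integral>\<^sup>+k. ennreal (\<bar>of_int k\<bar> powr \<gamma>) * (ennreal (\<kappa>\<^sup>2) * ennreal ((cmod (fc m k))\<^sup>2)) \<partial>count_space UNIV)"
      unfolding T[symmetric] by (intro nn_integral_mono mult_left_mono S') simp
    also have "(\<integral>\<^sup>+k. ennreal (\<bar>of_int k\<bar> powr \<gamma>) * (ennreal (\<kappa>\<^sup>2) * ennreal ((cmod (fc m k))\<^sup>2)) \<partial>count_space UNIV)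
       = (\<integral>\<^sup>+k. ennreal (\<kappa>\<^sup>2) * (ennreal (\<bar>of_int k\<bar> powr \<gamma>) * ennreal ((cmod (fc m k))\<^sup>2)) \<partial>count_space UNIV)"
      by (simp add: mult_ac)
    also have "\<dots> = ennreal (\<kappa>\<^sup>2) * (\<integral>\<^sup>+k. ennreal (\<bar>of_int k\<bar> powr \<gamma>) * ennreal ((cmod (fc m k))\<^sup>2) \<partial>count_space UNIV)"
      by (rule nn_integral_cmult) simp
    finally have "gagliardo_const \<gamma> * (\<integral>\<^sup>+k. ennreal (\<bar>of_int k\<bar> powr \<gamma>) * ennreal ((cmod (fc u k))\<^sup>2) \<partial>count_space UNIV)
      \<le> gagliardo_const \<gamma> * (ennreal (\<kappa>\<^sup>2) * (\<integral>\<^sup>+k. ennreal (\<bar>of_int k\<bar> powr \<gamma>) * ennreal ((cmod (fc m k))\<^sup>2) \<partial>count_space UNIV))" .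
    then show ?thesis
      using gagliardo_const_finite[OF \<gamma>(1) \<gamma>2] gagliardo_const_pos[OF \<gamma>(1)]
      by (subst (asm) ennreal_mult_le_mult_iff) auto
  next
    \<comment> \<open>At \<open>\<gamma> = 2\<close> the Gagliardo integral diverges at
      \<open>\<rho> = 0\<close>. Here the hypothesis is used along small increments
      \<open>e n\<close>: after division by \<open>(e n)^2\<close> the right side is bounded
      uniformly in \<open>n\<close>, while on a finite set of frequencies the left side tends to the
      desired sum.\<close>
    case True
    define I where "I = (\<integral>\<^sup>+k. ennreal (\<bar>of_int k\<bar> powr \<gamma>) * ennreal ((cmod (fc m k))\<^sup>2) \<partial>count_space UNIV)"
    have pw: "\<bar>real_of_int k\<bar> powr \<gamma> = (real_of_int k)\<^sup>2" for k
      using True by (cases "k = 0") auto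
    define e where "e n = 1 / real (Suc n)" for n
    have e: "e n > 0" "e \<longlonglongrightarrow> 0" for n
      unfolding e_def using LIMSEQ_inverse_real_of_nat by (auto simp: inverse_eq_divide)
    show ?thesis
      unfolding I_def[symmetric]
    proof (rule nn_integral_count_space_int_le)
      fix K :: "int set" assume K: "finite K"
      have fin: "ennreal (\<Sum>k\<in>K. (cmod ((echar k (e n) - 1) / of_real (e n) * fc u k))\<^sup>2) \<le> ennreal (\<kappa>\<^sup>2) * (ennreal ((2 * pi)\<^sup>2) * I)" for n
      proof -
        have "ennreal (\<Sum>k\<in>K. (cmod ((echar k (e n) - 1) / of_real (e n) * fc u k))\<^sup>2)
          = ennreal (1 / (e n)\<^sup>2) * (\<Sum>k\<in>K. ennreal ((cmod (echar k (e n) - 1))\<^sup>2 * (cmod (fc u k))\<^sup>2))"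
        proof -
          have eq: "(\<Sum>k\<in>K. (cmod ((echar k (e n) - 1) / of_real (e n) * fc u k))\<^sup>2)
            = 1 / (e n)\<^sup>2 * (\<Sum>k\<in>K. (cmod (echar k (e n) - 1))\<^sup>2 * (cmod (fc u k))\<^sup>2)"
            by (simp add: norm_mult norm_divide power_mult_distrib power_divide sum_divide_distrib)
          show ?thesis unfolding eq by (simp add: sum_ennreal flip: ennreal_mult')
        qed
        also have "\<dots> \<le> ennreal (1 / (e n)\<^sup>2) * ?S (e n) u"
          by (intro mult_left_mono sum_le_nn_integral_count_space_int K) simp
        also have "\<dots> \<le> ennreal (1 / (e n)\<^sup>2) * (ennreal (\<kappa>\<^sup>2) * ?S (e n) m)"
          by (intro mult_left_mono S) simp
        also have "\<dots> = ennreal (\<kappa>\<^sup>2) * (\<integral>\<^sup>+k. ennreal (1 / (e n)\<^sup>2) * ennreal ((cmod (echar k (e n) - 1))\<^sup>2 * (cmod (fc m k))\<^sup>2) \<partial>count_space UNIV)"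
          by (simp add: nn_integral_cmult mult_ac)
        also have "\<dots> \<le> ennreal (\<kappa>\<^sup>2) * (\<integral>\<^sup>+k. ennreal ((2 * pi)\<^sup>2) * (ennreal (\<bar>of_int k\<bar> powr \<gamma>) * ennreal ((cmod (fc m k))\<^sup>2)) \<partial>count_space UNIV)"
        proof (intro mult_left_mono nn_integral_mono)
          fix k :: int
          have "(cmod (echar k (e n) - 1))\<^sup>2 \<le> (2 * pi * \<bar>of_int k\<bar> * \<bar>e n\<bar>)\<^sup>2"
            by (intro power_mono norm_echar_diff_1_le) simp
          then have "1 / (e n)\<^sup>2 * (cmod (echar k (e n) - 1))\<^sup>2 \<le> (2 * pi)\<^sup>2 * (of_int k)\<^sup>2"
            using e(1)[of n] by (simp add: power_mult_distrib divide_le_eq)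
          then have "1 / (e n)\<^sup>2 * (cmod (echar k (e n) - 1))\<^sup>2 * (cmod (fc m k))\<^sup>2 \<le> (2 * pi)\<^sup>2 * (of_int k)\<^sup>2 * (cmod (fc m k))\<^sup>2"
            by (intro mult_right_mono) auto
          then show "ennreal (1 / (e n)\<^sup>2) * ennreal ((cmod (echar k (e n) - 1))\<^sup>2 * (cmod (fc m k))\<^sup>2)
            \<le> ennreal ((2 * pi)\<^sup>2) * (ennreal (\<bar>of_int k\<bar> powr \<gamma>) * ennreal ((cmod (fc m k))\<^sup>2))"
            unfolding pw by (simp flip: ennreal_mult add: mult.assoc ennreal_leI)
        qed simp
        finally show ?thesis by (simp add: nn_integral_cmult I_def)
      qed
      have "(\<lambda>n. ennreal (\<Sum>k\<in>K. (cmod ((echar k (e n) - 1) / of_real (e n) * fc u k))\<^sup>2))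
          \<longlonglongrightarrow> ennreal (\<Sum>k\<in>K. (cmod (2 * of_real pi * \<i> * of_int k * fc u k))\<^sup>2)"
        using e by (intro tendsto_ennrealI tendsto_sum tendsto_power tendsto_norm tendsto_mult tendsto_const echar_difference_quotient)
          (auto simp: less_imp_neq[THEN not_sym])
      then have "ennreal (\<Sum>k\<in>K. (cmod (2 * of_real pi * \<i> * of_int k * fc u k))\<^sup>2) \<le> ennreal (\<kappa>\<^sup>2) * (ennreal ((2 * pi)\<^sup>2) * I)"
        by (rule LIMSEQ_le_const2) (use fin in auto)
      also have "ennreal (\<Sum>k\<in>K. (cmod (2 * of_real pi * \<i> * of_int k * fc u k))\<^sup>2)
          = ennreal ((2 * pi)\<^sup>2) * (\<Sum>k\<in>K. ennreal (\<bar>of_int k\<bar> powr \<gamma>) * ennreal ((cmod (fc u k))\<^sup>2))"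
      proof -
        have eq: "(\<Sum>k\<in>K. (cmod (2 * of_real pi * \<i> * of_int k * fc u k))\<^sup>2)
            = (2 * pi)\<^sup>2 * (\<Sum>k\<in>K. (of_int k)\<^sup>2 * (cmod (fc u k))\<^sup>2)"
          by (simp add: norm_mult power_mult_distrib sum_distrib_left mult.assoc)
        show ?thesis unfolding pw eq by (simp add: sum_ennreal flip: ennreal_mult')
      qed
      finally have "ennreal ((2 * pi)\<^sup>2) * (\<Sum>k\<in>K. ennreal (\<bar>of_int k\<bar> powr \<gamma>) * ennreal ((cmod (fc u k))\<^sup>2))
          \<le> ennreal ((2 * pi)\<^sup>2) * (ennreal (\<kappa>\<^sup>2) * I)"
        by (simp add: mult_ac)
      then show "(\<Sum>k\<in>K. ennreal (\<bar>of_int k\<bar> powr \<gamma>) * ennreal ((cmod (fc u k))\<^sup>2)) \<le> ennreal (\<kappa>\<^sup>2) * I"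
        by (subst (asm) ennreal_mult_le_mult_iff) auto
    qed
  qed
qed

text \<open>The homogeneous and the inhomogeneous weight are comparable for
  \<open>k \<noteq> 0\<close>, where \<open>1 \<le> (2 pi k)^2\<close> costs the factor 2; at
  \<open>k = 0\<close> the coefficient of \<open>u\<close> vanishes by \<open>mean\<close>.\<close>

lemma H_norm_contraction:
  assumes \<gamma>: "0 < \<gamma>" "\<gamma> \<le> 2" and u: "lip_circ L u" and m: "lip_circ L' m" and mean: "fc u 0 = 0"
    and le: "\<And>\<rho>. (\<integral>x. (diff_op \<rho> u x)\<^sup>2 \<partial>circ) \<le> \<kappa>\<^sup>2 * (\<integral>x. (diff_op \<rho> m x)\<^sup>2 \<partial>circ)"
  shows "(H_norm (\<gamma> / 2) (fc u))\<^sup>2 \<le> ennreal (2 * \<kappa>\<^sup>2) * (H_norm (\<gamma> / 2) (fc m))\<^sup>2"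
proof -
  let ?w = "\<lambda>k. (1 + (2 * pi * real_of_int k)\<^sup>2) powr (\<gamma> / 2)"
  have eq: "(2 * pi) powr \<gamma> * \<bar>of_int k\<bar> powr \<gamma> = ((2 * pi * real_of_int k)\<^sup>2) powr (\<gamma> / 2)" for k
  proof -
    have "(2 * pi * real_of_int k)\<^sup>2 = (2 * pi * \<bar>of_int k\<bar>) powr 2"
      by (cases "k = 0") (auto simp: power_mult_distrib)
    then have "((2 * pi * real_of_int k)\<^sup>2) powr (\<gamma> / 2) = (2 * pi * \<bar>of_int k\<bar>) powr \<gamma>"
      by (simp only: powr_powr) simp
    then show ?thesis by (simp only: powr_mult)
  qed
  have lower: "(2 * pi) powr \<gamma> * \<bar>of_int k\<bar> powr \<gamma> \<le> ?w k" for k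
    unfolding eq using \<gamma> by (intro powr_mono2) auto
  have upper: "?w k \<le> 2 * ((2 * pi) powr \<gamma> * \<bar>of_int k\<bar> powr \<gamma>)" if "k \<noteq> 0" for k
  proof -
    have k: "1 \<le> \<bar>real_of_int k\<bar>" using that by linarith
    have "1 * 1 \<le> 2 * pi * \<bar>real_of_int k\<bar>"
      using pi_gt3 k by (intro mult_mono) auto
    then have "1 \<le> (2 * pi * \<bar>real_of_int k\<bar>)\<^sup>2" by (intro one_le_power) simp
    also have "\<dots> = (2 * pi * real_of_int k)\<^sup>2" by (simp add: power_mult_distrib)
    finally have "?w k \<le> (2 * (2 * pi * real_of_int k)\<^sup>2) powr (\<gamma> / 2)"
      using \<gamma> by (intro powr_mono2) auto
    also have "\<dots> = 2 powr (\<gamma> / 2) * ((2 * pi * real_of_int k)\<^sup>2) powr (\<gamma> / 2)"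
      by (simp only: powr_mult)
    also have "((2 * pi * real_of_int k)\<^sup>2) powr (\<gamma> / 2) = (2 * pi) powr \<gamma> * \<bar>of_int k\<bar> powr \<gamma>"
      by (rule eq[symmetric])
    also have "2 powr (\<gamma> / 2) * \<dots> \<le> 2 powr 1 * \<dots>"
      using \<gamma> by (intro mult_right_mono powr_mono) auto
    finally show ?thesis by simp
  qed
  let ?c = "ennreal ((2 * pi) powr \<gamma>)"
  let ?I = "\<lambda>v. \<integral>\<^sup>+k. ennreal (\<bar>of_int k\<bar> powr \<gamma>) * ennreal ((cmod (fc v k))\<^sup>2) \<partial>count_space UNIV"
  have "(H_norm (\<gamma> / 2) (fc u))\<^sup>2 \<le> (\<integral>\<^sup>+k. (2 * ?c) * (ennreal (\<bar>of_int k\<bar> powr \<gamma>) * ennreal ((cmod (fc u k))\<^sup>2)) \<partial>count_space UNIV)"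
    unfolding H_norm_square
  proof (intro nn_integral_mono)
    fix k :: int
    have "?w k * (cmod (fc u k))\<^sup>2 \<le> 2 * ((2 * pi) powr \<gamma> * \<bar>of_int k\<bar> powr \<gamma>) * (cmod (fc u k))\<^sup>2"
      using upper[of k] mean by (cases "k = 0") (auto intro!: mult_right_mono)
    then have "ennreal (?w k * (cmod (fc u k))\<^sup>2) \<le> ennreal (2 * ((2 * pi) powr \<gamma> * \<bar>of_int k\<bar> powr \<gamma>) * (cmod (fc u k))\<^sup>2)"
      by (rule ennreal_leI)
    also have "\<dots> = (2 * ?c) * (ennreal (\<bar>of_int k\<bar> powr \<gamma>) * ennreal ((cmod (fc u k))\<^sup>2))"
      by (simp add: ennreal_mult mult.assoc)
    finally show "ennreal (?w k * (cmod (fc u k))\<^sup>2) \<le> (2 * ?c) * (ennreal (\<bar>of_int k\<bar> powr \<gamma>) * ennreal ((cmod (fc u k))\<^sup>2))" .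
  qed
  also have "\<dots> = (2 * ?c) * ?I u" by (simp add: nn_integral_cmult)
  also have "\<dots> \<le> (2 * ?c) * (ennreal (\<kappa>\<^sup>2) * ?I m)"
    by (intro mult_left_mono homogeneous_contraction[OF \<gamma> u m le]) simp
  also have "\<dots> = ennreal (2 * \<kappa>\<^sup>2) * (?c * ?I m)"
    by (simp add: ennreal_mult mult_ac)
  also have "?c * ?I m = (\<integral>\<^sup>+k. ?c * (ennreal (\<bar>of_int k\<bar> powr \<gamma>) * ennreal ((cmod (fc m k))\<^sup>2)) \<partial>count_space UNIV)"
    by (simp add: nn_integral_cmult)
  also have "\<dots> \<le> (H_norm (\<gamma> / 2) (fc m))\<^sup>2"
    unfolding H_norm_square
  proof (intro nn_integral_mono)
    fix k :: int
    have "(2 * pi) powr \<gamma> * \<bar>of_int k\<bar> powr \<gamma> * (cmod (fc m k))\<^sup>2 \<le> ?w k * (cmod (fc m k))\<^sup>2"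
      by (intro mult_right_mono lower) simp
    then show "?c * (ennreal (\<bar>of_int k\<bar> powr \<gamma>) * ennreal ((cmod (fc m k))\<^sup>2)) \<le> ennreal (?w k * (cmod (fc m k))\<^sup>2)"
      by (simp flip: ennreal_mult add: mult.assoc ennreal_leI)
  qed
  finally show ?thesis by (simp add: mult_left_mono)
qed

text \<open>Young's inequality, frequency by frequency. The parameter is meant to be the increment
  \<open>h\<close>: for \<open>d = fc (psi m h)\<close>, whose norm is of order \<open>h\<close>,
  both terms become linear in \<open>h\<close>. A product that is not integrable has Bochner
  integral zero.\<close>

lemma pairing_le:
  fixes c d :: "int \<Rightarrow> complex"
  assumes h: "h > 0"
  shows "ennreal (cmod (\<integral>k. cnj (c k) * d k \<partial>count_space UNIV))
    \<le> ennreal h * (H_norm (- r) c)\<^sup>2 + ennreal (1 / h) * (H_norm r d)\<^sup>2"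
proof (cases "integrable (count_space UNIV) (\<lambda>k. cnj (c k) * d k)")
  case True
  let ?w = "\<lambda>k. 1 + (2 * pi * real_of_int k)\<^sup>2"
  have "ennreal (cmod (\<integral>k. cnj (c k) * d k \<partial>count_space UNIV)) \<le> (\<integral>\<^sup>+k. ennreal (cmod (cnj (c k) * d k)) \<partial>count_space UNIV)"
    using True by (rule integral_norm_bound_ennreal)
  also have "\<dots> \<le> (\<integral>\<^sup>+k. ennreal h * ennreal (?w k powr (- r) * (cmod (c k))\<^sup>2)
      + ennreal (1 / h) * ennreal (?w k powr r * (cmod (d k))\<^sup>2) \<partial>count_space UNIV)"
  proof (intro nn_integral_mono)
    fix k :: int
    have w: "?w k > 0" by (simp add: add_pos_nonneg)
    define p where "p = ?w k powr r"
    have p: "p > 0" using w by (simp add: p_def)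
    have am: "x * y \<le> h / p * x\<^sup>2 + p / h * y\<^sup>2" if "x \<ge> 0" "y \<ge> 0" for x y
    proof -
      have "0 \<le> (h * x - p * y)\<^sup>2 / (p * h)" using p h by (intro divide_nonneg_pos) auto
      also have "\<dots> = h / p * x\<^sup>2 + p / h * y\<^sup>2 - 2 * (x * y)"
        using p h by (simp add: field_simps power2_eq_square)
      finally show ?thesis using mult_nonneg_nonneg[OF that] by linarith
    qed
    have "cmod (cnj (c k) * d k) \<le> h * (?w k powr (- r) * (cmod (c k))\<^sup>2) + 1 / h * (?w k powr r * (cmod (d k))\<^sup>2)"
      using am[of "cmod (c k)" "cmod (d k)"] by (simp add: norm_mult p_def powr_minus_divide)
    then show "ennreal (cmod (cnj (c k) * d k)) \<le> ennreal h * ennreal (?w k powr (- r) * (cmod (c k))\<^sup>2)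
      + ennreal (1 / h) * ennreal (?w k powr r * (cmod (d k))\<^sup>2)"
      using h by (simp flip: ennreal_mult ennreal_plus add: ennreal_leI)
  qed
  also have "\<dots> = ennreal h * (H_norm (- r) c)\<^sup>2 + ennreal (1 / h) * (H_norm r d)\<^sup>2"
    unfolding H_norm_square by (simp add: nn_integral_add nn_integral_cmult)
  finally show ?thesis .
qed (simp add: not_integrable_integral_eq)

lemma H_norm_Dx_le: "(H_norm (r - 1) (Dx c))\<^sup>2 \<le> (H_norm r c)\<^sup>2"
  unfolding H_norm_square
proof (intro nn_integral_mono ennreal_leI)
  fix k :: int
  let ?w = "1 + (2 * pi * real_of_int k)\<^sup>2"
  have w: "?w > 0" by (simp add: add_pos_nonneg)
  have "?w powr (r - 1) * (cmod (Dx c k))\<^sup>2 = ?w powr (r - 1) * (2 * pi * real_of_int k)\<^sup>2 * (cmod (c k))\<^sup>2"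
    by (simp add: Dx_def norm_mult power_mult_distrib)
  also have "\<dots> \<le> ?w powr (r - 1) * ?w * (cmod (c k))\<^sup>2"
    by (intro mult_right_mono mult_left_mono) auto
  also have "?w powr (r - 1) * ?w = ?w powr r"
    using w by (simp add: powr_diff)
  finally show "?w powr (r - 1) * (cmod (Dx c k))\<^sup>2 \<le> ?w powr r * (cmod (c k))\<^sup>2" .
qed

section \<open>The test function\<close>

text \<open>One family of finite measures covers the time interval, the circle
  \<open>seg 0 1\<close> and the range of the increment \<open>z\<close>, so that a single Fubini
  lemma serves every pair of them.\<close>

definition seg :: "real \<Rightarrow> real \<Rightarrow> real measure" where
  "seg a b = restrict_space lborel {a..b}"

lemma space_seg [simp]: "space (seg a b) = {a..b}"
  by (simp add: seg_def space_restrict_space)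

lemma circ_eq_seg: "circ = seg 0 1"
  by (simp add: circ_def seg_def)

lemma measurable_seg [measurable (raw)]:
  "f \<in> borel_measurable borel \<Longrightarrow> f \<in> borel_measurable (seg a b)"
  unfolding seg_def by (intro measurable_restrict_space1) simp

lemma measurable_ident_seg: "(\<lambda>x. x) \<in> measurable (seg a b) borel"
  by (rule measurable_seg) simp

lemma emeasure_seg: "a \<le> b \<Longrightarrow> emeasure (seg a b) {a..b} = ennreal (b - a)"
  by (simp add: seg_def emeasure_restrict_space)

lemma finite_measure_seg: "finite_measure (seg a b)"
  by (rule finite_measureI) (cases "a \<le> b"; simp add: seg_def emeasure_restrict_space space_restrict_space)

lemma measure_seg [simp]: "a \<le> b \<Longrightarrow> measure (seg a b) {a..b} = b - a"
  by (simp add: measure_def emeasure_seg)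

lemma integrable_seg_bounded:
  fixes f :: "real \<Rightarrow> real"
  assumes "f \<in> borel_measurable borel" "\<And>x. x \<in> {a..b} \<Longrightarrow> \<bar>f x\<bar> \<le> B"
  shows "integrable (seg a b) f"
  using assms by (intro finite_measure.integrable_const_bound[OF finite_measure_seg, where B = B]) (auto intro!: AE_I2)

lemma integral_seg_le:
  fixes f :: "real \<Rightarrow> real"
  assumes "a \<le> b" "\<And>x. x \<in> {a..b} \<Longrightarrow> \<bar>f x\<bar> \<le> B"
  shows "\<bar>\<integral>x. f x \<partial>seg a b\<bar> \<le> (b - a) * B"
proof (cases "integrable (seg a b) f")
  case True
  have "\<bar>\<integral>x. f x \<partial>seg a b\<bar> \<le> (\<integral>x. \<bar>f x\<bar> \<partial>seg a b)"
    using integral_norm_bound[of "seg a b" f] by simp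
  also have "\<dots> \<le> (\<integral>x. B \<partial>seg a b)"
  proof (rule integral_mono)
    show "integrable (seg a b) (\<lambda>x. B)"
      using finite_measure.integrable_const[OF finite_measure_seg] by blast
  qed (use True assms in auto)
  finally show ?thesis using assms by simp
next
  case False
  have "0 \<le> \<bar>f a\<bar>" by simp
  also have "\<dots> \<le> B" using assms by simp
  finally have "0 \<le> B" .
  then show ?thesis using False assms(1) by (simp add: not_integrable_integral_eq)
qed

lemma measurable_pair_seg:
  assumes "f \<in> borel_measurable (borel \<Otimes>\<^sub>M borel)"
  shows "f \<in> borel_measurable (seg a b \<Otimes>\<^sub>M seg c d)"
proof -
  have "(\<lambda>p. (fst p, snd p)) \<in> measurable (seg a b \<Otimes>\<^sub>M seg c d) (borel \<Otimes>\<^sub>M borel)"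
    by (intro measurable_Pair measurable_compose[OF measurable_fst measurable_ident_seg]
        measurable_compose[OF measurable_snd measurable_ident_seg])
  from measurable_compose[OF this assms] show ?thesis by simp
qed

lemma borel_measurable_integral_seg:
  fixes f :: "'a \<Rightarrow> real \<Rightarrow> 'b::{banach, second_countable_topology}"
  assumes "(\<lambda>(x, y). f x y) \<in> borel_measurable (M \<Otimes>\<^sub>M borel)"
  shows "(\<lambda>x. \<integral>y. f x y \<partial>seg c d) \<in> borel_measurable M"
proof -
  interpret finite_measure "seg c d" by (rule finite_measure_seg)
  have "(\<lambda>p. (fst p, snd p)) \<in> measurable (M \<Otimes>\<^sub>M seg c d) (M \<Otimes>\<^sub>M borel)"
    by (intro measurable_Pair measurable_fst measurable_compose[OF measurable_snd measurable_ident_seg])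
  from measurable_compose[OF this assms] have "(\<lambda>(x, y). f x y) \<in> borel_measurable (M \<Otimes>\<^sub>M seg c d)"
    by simp
  then show ?thesis by (rule borel_measurable_lebesgue_integral)
qed

lemma
  fixes f :: "real \<Rightarrow> real \<Rightarrow> real"
  assumes f: "(\<lambda>(x, y). f x y) \<in> borel_measurable (borel \<Otimes>\<^sub>M borel)"
    and B: "\<And>x y. x \<in> {a..b} \<Longrightarrow> y \<in> {c..d} \<Longrightarrow> \<bar>f x y\<bar> \<le> B"
  shows Fubini_seg: "(\<integral>x. (\<integral>y. f x y \<partial>seg c d) \<partial>seg a b) = (\<integral>y. (\<integral>x. f x y \<partial>seg a b) \<partial>seg c d)"
    and integrable_integral_seg: "integrable (seg a b) (\<lambda>x. \<integral>y. f x y \<partial>seg c d)"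
proof -
  interpret X: finite_measure "seg a b" by (rule finite_measure_seg)
  interpret Y: finite_measure "seg c d" by (rule finite_measure_seg)
  interpret XY: pair_sigma_finite "seg a b" "seg c d" ..
  have fin: "finite_measure (seg a b \<Otimes>\<^sub>M seg c d)"
    by (rule finite_measure_pair_measure[OF Y.finite_measure_axioms X.finite_measure_axioms])
  have int: "integrable (seg a b \<Otimes>\<^sub>M seg c d) (\<lambda>(x, y). f x y)"
  proof (rule finite_measure.integrable_const_bound[OF fin])
    show "AE p in seg a b \<Otimes>\<^sub>M seg c d. norm (case p of (x, y) \<Rightarrow> f x y) \<le> B"
      using B by (intro AE_I2) (auto simp: space_pair_measure)
  qed (rule measurable_pair_seg[OF f])
  from XY.Fubini_integral[OF int]
  show "(\<integral>x. (\<integral>y. f x y \<partial>seg c d) \<partial>seg a b) = (\<integral>y. (\<integral>x. f x y \<partial>seg a b) \<partial>seg c d)" by simp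
  from XY.integrable_fst[OF int] show "integrable (seg a b) (\<lambda>x. \<integral>y. f x y \<partial>seg c d)" by simp
qed

text \<open>Cauchy-Schwarz against the constant 1, in the form that the variance of \<open>g\<close>
  about its mean \<open>I / h\<close> is nonnegative.\<close>

lemma integral_seg_square_le:
  fixes g :: "real \<Rightarrow> real" and h :: real
  assumes h: "0 < h" and g: "g \<in> borel_measurable borel" "\<And>x. x \<in> {0..h} \<Longrightarrow> \<bar>g x\<bar> \<le> B"
  shows "(\<integral>z. g z \<partial>seg 0 h)\<^sup>2 \<le> h * (\<integral>z. (g z)\<^sup>2 \<partial>seg 0 h)"
proof -
  interpret finite_measure "seg 0 h" by (rule finite_measure_seg)
  define I where "I = (\<integral>z. g z \<partial>seg 0 h)"
  have int: "integrable (seg 0 h) g" "integrable (seg 0 h) (\<lambda>z. (g z)\<^sup>2)"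
  proof -
    show "integrable (seg 0 h) g" by (rule integrable_seg_bounded[OF g])
    show "integrable (seg 0 h) (\<lambda>z. (g z)\<^sup>2)"
    proof (rule integrable_seg_bounded)
      show "\<bar>(g x)\<^sup>2\<bar> \<le> B\<^sup>2" if "x \<in> {0..h}" for x
        using power_mono[OF g(2)[OF that], of 2] by simp
    qed (use g(1) in measurable)
  qed
  have "0 \<le> (\<integral>z. (g z - I / h)\<^sup>2 \<partial>seg 0 h)" by simp
  also have "\<dots> = (\<integral>z. (g z)\<^sup>2 - 2 * (I / h) * g z + (I / h)\<^sup>2 \<partial>seg 0 h)"
    by (simp add: power2_diff algebra_simps)
  also have "\<dots> = (\<integral>z. (g z)\<^sup>2 \<partial>seg 0 h) - 2 * (I / h) * I + (I / h)\<^sup>2 * h"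
    using int h by (simp add: I_def measure_seg)
  also have "\<dots> = (\<integral>z. (g z)\<^sup>2 \<partial>seg 0 h) - I\<^sup>2 / h"
    using h by (simp add: power2_eq_square)
  finally show ?thesis using h by (simp add: I_def field_simps)
qed

text \<open>The centre point occurs in both absolute values and is charged twice. The weights 2, 1,
  1, of sum 4, are the origin of every 4 in the bounds for \<open>psi\<close>.\<close>

lemma four_point:
  fixes p q r p' q' r' :: real
  shows "\<bar>(\<bar>p - q\<bar> - \<bar>r - p\<bar>) - (\<bar>p' - q'\<bar> - \<bar>r' - p'\<bar>)\<bar> \<le> 2 * \<bar>p - p'\<bar> + \<bar>q - q'\<bar> + \<bar>r - r'\<bar>"
proof -
  have two: "\<bar>\<bar>a - b\<bar> - \<bar>a' - b'\<bar>\<bar> \<le> \<bar>a - a'\<bar> + \<bar>b - b'\<bar>" for a b a' b' :: real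
    by linarith
  show ?thesis
    using two[of p q p' q'] two[of r p r' p']
      abs_triangle_ineq4[of "\<bar>p - q\<bar> - \<bar>p' - q'\<bar>" "\<bar>r - p\<bar> - \<bar>r' - p'\<bar>"]
    by (simp add: algebra_simps)
qed

definition psi :: "(real \<Rightarrow> real) \<Rightarrow> real \<Rightarrow> real \<Rightarrow> real" where
  "psi f h x = (\<integral>z. \<bar>f x - f (x - z)\<bar> - \<bar>f (x + z) - f x\<bar> \<partial>seg 0 h)"

lemma diff_op_bound: "lip_circ L f \<Longrightarrow> \<bar>diff_op \<rho> f x\<bar> \<le> L * \<bar>\<rho>\<bar>"
  using lip_circD[of L f "x + \<rho>" x] by (simp add: diff_op_def)

lemma diff_op_measurable: "lip_circ L f \<Longrightarrow> diff_op \<rho> f \<in> borel_measurable borel"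
  by (rule lip_circ_measurable[OF lip_circ_diff_op])

context
  fixes L h :: real and f :: "real \<Rightarrow> real" assumes f: "lip_circ L f" and h: "0 < h"
begin

lemma psi_integrable: "integrable (seg 0 h) (\<lambda>z. \<bar>f x - f (x - z)\<bar> - \<bar>f (x + z) - f x\<bar>)"
proof (rule integrable_seg_bounded[where B = "L * h"])
  note [measurable] = lip_circ_measurable[OF f]
  show "(\<lambda>z. \<bar>f x - f (x - z)\<bar> - \<bar>f (x + z) - f x\<bar>) \<in> borel_measurable borel" by measurable
  fix z assume "z \<in> {0..h}"
  then have "L * \<bar>z\<bar> \<le> L * h" using lip_circ_nonneg[OF f] by (intro mult_left_mono) auto
  then show "\<bar>\<bar>f x - f (x - z)\<bar> - \<bar>f (x + z) - f x\<bar>\<bar> \<le> L * h"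
    using lip_circD[OF f, of x "x - z"] lip_circD[OF f, of "x + z" x] by simp
qed

text \<open>The bound of \<open>four_point\<close> for a translation by \<open>\<rho>\<close>. Its
  three terms are rotations of one function, so for every \<open>z\<close> its mean over the circle
  is four times the mean of \<open>|diff_op \<rho> f|\<close>.\<close>

definition psi_majorant where
  "psi_majorant \<rho> x z = 2 * \<bar>diff_op \<rho> f x\<bar> + \<bar>diff_op \<rho> f (x - z)\<bar> + \<bar>diff_op \<rho> f (x + z)\<bar>"

lemma psi_majorant_bound: "\<bar>psi_majorant \<rho> x z\<bar> \<le> 4 * (L * \<bar>\<rho>\<bar>)"
  using diff_op_bound[OF f, of \<rho> x] diff_op_bound[OF f, of \<rho> "x - z"] diff_op_bound[OF f, of \<rho> "x + z"]
  by (simp add: psi_majorant_def)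

lemma psi_majorant_measurable: "(\<lambda>(x, z). psi_majorant \<rho> x z) \<in> borel_measurable (borel \<Otimes>\<^sub>M borel)"
proof -
  note [measurable] = diff_op_measurable[OF f]
  show ?thesis unfolding psi_majorant_def by measurable
qed

lemma psi_majorant_measurable_snd: "(\<lambda>z. psi_majorant \<rho> x z) \<in> borel_measurable borel"
proof -
  note [measurable] = diff_op_measurable[OF f]
  show ?thesis unfolding psi_majorant_def by measurable
qed

lemma psi_difference: "\<bar>diff_op \<rho> (psi f h) x\<bar> \<le> (\<integral>z. psi_majorant \<rho> x z \<partial>seg 0 h)"
proof -
  have eq: "diff_op \<rho> (psi f h) x = (\<integral>z. (\<bar>f (x + \<rho>) - f (x + \<rho> - z)\<bar> - \<bar>f (x + \<rho> + z) - f (x + \<rho>)\<bar>)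
      - (\<bar>f x - f (x - z)\<bar> - \<bar>f (x + z) - f x\<bar>) \<partial>seg 0 h)"
    unfolding diff_op_def psi_def by (intro Bochner_Integration.integral_diff[symmetric] psi_integrable)
  have "\<bar>diff_op \<rho> (psi f h) x\<bar> \<le> (\<integral>z. \<bar>(\<bar>f (x + \<rho>) - f (x + \<rho> - z)\<bar> - \<bar>f (x + \<rho> + z) - f (x + \<rho>)\<bar>)
      - (\<bar>f x - f (x - z)\<bar> - \<bar>f (x + z) - f x\<bar>)\<bar> \<partial>seg 0 h)"
    unfolding eq by (rule integral_abs_bound)
  also have "\<dots> \<le> (\<integral>z. psi_majorant \<rho> x z \<partial>seg 0 h)"
  proof (rule integral_mono)
    show "integrable (seg 0 h) (\<lambda>z. psi_majorant \<rho> x z)"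
      by (rule integrable_seg_bounded[where f = "psi_majorant \<rho> x", OF psi_majorant_measurable_snd psi_majorant_bound])
    show "integrable (seg 0 h) (\<lambda>z. \<bar>(\<bar>f (x + \<rho>) - f (x + \<rho> - z)\<bar> - \<bar>f (x + \<rho> + z) - f (x + \<rho>)\<bar>)
      - (\<bar>f x - f (x - z)\<bar> - \<bar>f (x + z) - f x\<bar>)\<bar>)"
      by (rule integrable_abs, rule Bochner_Integration.integrable_diff; rule psi_integrable)
    fix z
    have e: "x + \<rho> - z = x - z + \<rho>" "x + \<rho> + z = x + z + \<rho>" by simp_all
    show "\<bar>(\<bar>f (x + \<rho>) - f (x + \<rho> - z)\<bar> - \<bar>f (x + \<rho> + z) - f (x + \<rho>)\<bar>)
      - (\<bar>f x - f (x - z)\<bar> - \<bar>f (x + z) - f x\<bar>)\<bar> \<le> psi_majorant \<rho> x z"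
      using four_point[of "f (x + \<rho>)" "f (x + \<rho> - z)" "f (x + \<rho> + z)" "f x" "f (x - z)" "f (x + z)"]
      by (simp only: psi_majorant_def diff_op_def e)
  qed
  finally show ?thesis .
qed

lemma psi_lip_circ: "lip_circ (4 * h * L) (psi f h)"
  unfolding lip_circ_def
proof (intro conjI allI)
  fix x y
  show "psi f h (x + 1) = psi f h x"
  proof -
    have "f (x + 1 - z) = f (x - z)" "f (x + 1 + z) = f (x + z)" for z
      using lip_circ_periodic[OF f, of "x - z"] lip_circ_periodic[OF f, of "x + z"] by (simp_all add: algebra_simps)
    then show ?thesis by (simp add: psi_def lip_circ_periodic[OF f])
  qed
  have "\<bar>psi f h x - psi f h y\<bar> = \<bar>diff_op (x - y) (psi f h) y\<bar>" by (simp add: diff_op_def)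
  also have "\<dots> \<le> (\<integral>z. psi_majorant (x - y) y z \<partial>seg 0 h)" by (rule psi_difference)
  also have "\<dots> \<le> \<bar>\<integral>z. psi_majorant (x - y) y z \<partial>seg 0 h\<bar>" by simp
  also have "\<dots> \<le> (h - 0) * (4 * (L * \<bar>x - y\<bar>))" using h by (intro integral_seg_le psi_majorant_bound) simp
  finally show "\<bar>psi f h x - psi f h y\<bar> \<le> 4 * h * L * \<bar>x - y\<bar>" by (simp add: mult_ac)
qed

lemma psi_L1_difference:
  "(\<integral>x. \<bar>diff_op \<rho> (psi f h) x\<bar> \<partial>circ) \<le> 4 * h * (\<integral>x. \<bar>diff_op \<rho> f x\<bar> \<partial>circ)"
proof -
  note [measurable] = lip_circ_measurable[OF f] diff_op_measurable[OF f] psi_majorant_measurable_snd lip_circ_measurable[OF psi_lip_circ]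
  have per: "diff_op \<rho> f (x + 1) = diff_op \<rho> f x" for x
    using lip_circ_periodic[OF lip_circ_diff_op[OF f]] .
  have i1: "integrable circ (\<lambda>x. \<bar>diff_op \<rho> f (x + c)\<bar>)" for c
    by (rule integrable_circ_bounded[where B = "L * \<bar>\<rho>\<bar>"]) (use diff_op_bound[OF f] in auto)
  have "(\<integral>x. \<bar>diff_op \<rho> (psi f h) x\<bar> \<partial>circ) \<le> (\<integral>x. (\<integral>z. psi_majorant \<rho> x z \<partial>seg 0 h) \<partial>circ)"
  proof (rule integral_mono)
    show "integrable circ (\<lambda>x. \<bar>diff_op \<rho> (psi f h) x\<bar>)"
      using lip_circD[OF psi_lip_circ] unfolding diff_op_def
      by (intro integrable_circ_bounded[where B = "4 * h * L * \<bar>\<rho>\<bar>"]) (auto, metis add_diff_cancel_left')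
    show "integrable circ (\<lambda>x. \<integral>z. psi_majorant \<rho> x z \<partial>seg 0 h)"
      unfolding circ_eq_seg by (rule integrable_integral_seg[OF psi_majorant_measurable psi_majorant_bound])
  qed (rule psi_difference)
  also have "\<dots> = (\<integral>z. (\<integral>x. psi_majorant \<rho> x z \<partial>circ) \<partial>seg 0 h)"
    unfolding circ_eq_seg by (rule Fubini_seg[OF psi_majorant_measurable psi_majorant_bound])
  also have "\<dots> = (\<integral>z. 4 * (\<integral>x. \<bar>diff_op \<rho> f x\<bar> \<partial>circ) \<partial>seg 0 h)"
  proof (intro Bochner_Integration.integral_cong refl)
    fix z
    have s: "(\<integral>x. \<bar>diff_op \<rho> f (x + c)\<bar> \<partial>circ) = (\<integral>x. \<bar>diff_op \<rho> f x\<bar> \<partial>circ)" for c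
      by (rule integral_circ_shift[where f = "\<lambda>x. \<bar>diff_op \<rho> f x\<bar>"]) (auto simp: per)
    show "(\<integral>x. psi_majorant \<rho> x z \<partial>circ) = 4 * (\<integral>x. \<bar>diff_op \<rho> f x\<bar> \<partial>circ)"
      using i1[of 0] i1[of "-z"] i1[of z] s[of "-z"] s[of z] unfolding psi_majorant_def by simp
  qed
  finally show ?thesis using h by (simp add: mult_ac)
qed

text \<open>Cauchy-Schwarz in \<open>z\<close> yields one factor \<open>h\<close>, the integration
  over \<open>z\<close> the other. The inequality
  \<open>(2 p + q + r)^2 \<le> 8 p^2 + 4 q^2 + 4 r^2\<close> is convexity with weights 2, 1, 1;
  after rotation its right side has total weight 16.\<close>

lemma psi_L2_difference:
  "(\<integral>x. (diff_op \<rho> (psi f h) x)\<^sup>2 \<partial>circ) \<le> (4 * h)\<^sup>2 * (\<integral>x. (diff_op \<rho> f x)\<^sup>2 \<partial>circ)"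
proof -
  note [measurable] = lip_circ_measurable[OF f] diff_op_measurable[OF f] psi_majorant_measurable_snd lip_circ_measurable[OF psi_lip_circ]
  have per: "diff_op \<rho> f (x + 1) = diff_op \<rho> f x" for x
    using lip_circ_periodic[OF lip_circ_diff_op[OF f]] .
  define G where "G x z = 8 * (diff_op \<rho> f x)\<^sup>2 + 4 * (diff_op \<rho> f (x - z))\<^sup>2 + 4 * (diff_op \<rho> f (x + z))\<^sup>2" for x z
  have b2: "(diff_op \<rho> f x)\<^sup>2 \<le> (L * \<bar>\<rho>\<bar>)\<^sup>2" for x
    using power_mono[OF diff_op_bound[OF f, of \<rho> x], of 2] by simp
  have i1: "integrable circ (\<lambda>x. (diff_op \<rho> f (x + c))\<^sup>2)" for c
    by (rule integrable_circ_bounded[where B = "(L * \<bar>\<rho>\<bar>)\<^sup>2"]) (use b2 in auto)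
  have GB: "\<bar>G x z\<bar> \<le> 16 * (L * \<bar>\<rho>\<bar>)\<^sup>2" for x z
    using b2[of x] b2[of "x - z"] b2[of "x + z"] by (simp add: G_def)
  have Gm [measurable]: "(\<lambda>(x, z). h * G x z) \<in> borel_measurable (borel \<Otimes>\<^sub>M borel)"
    unfolding G_def by measurable
  have hGB: "\<bar>h * G x z\<bar> \<le> h * (16 * (L * \<bar>\<rho>\<bar>)\<^sup>2)" for x z
    unfolding abs_mult using h GB by (intro mult_mono) auto
  have dG: "(psi_majorant \<rho> x z)\<^sup>2 \<le> G x z" for x z
  proof -
    have "(2 * p + q + r)\<^sup>2 \<le> 8 * p\<^sup>2 + 4 * q\<^sup>2 + 4 * r\<^sup>2" for p q r :: real
    proof -
      have "0 \<le> 2 * (p - q)\<^sup>2 + 2 * (p - r)\<^sup>2 + (q - r)\<^sup>2 + 0 * p" by simp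
      then show ?thesis by (simp add: power2_eq_square algebra_simps)
    qed
    from this[of "\<bar>diff_op \<rho> f x\<bar>" "\<bar>diff_op \<rho> f (x - z)\<bar>" "\<bar>diff_op \<rho> f (x + z)\<bar>"]
    show ?thesis by (simp add: psi_majorant_def G_def)
  qed
  have "(\<integral>x. (diff_op \<rho> (psi f h) x)\<^sup>2 \<partial>circ) \<le> (\<integral>x. (\<integral>z. h * G x z \<partial>seg 0 h) \<partial>circ)"
  proof (rule integral_mono)
    show "integrable circ (\<lambda>x. (diff_op \<rho> (psi f h) x)\<^sup>2)"
    proof (rule integrable_circ_bounded[where B = "(4 * h * L * \<bar>\<rho>\<bar>)\<^sup>2"])
      show "norm ((diff_op \<rho> (psi f h) x)\<^sup>2) \<le> (4 * h * L * \<bar>\<rho>\<bar>)\<^sup>2" for x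
        using power_mono[OF lip_circD[OF psi_lip_circ, of "x + \<rho>" x], of 2] by (simp add: diff_op_def)
    qed (simp add: diff_op_def)
    show "integrable circ (\<lambda>x. \<integral>z. h * G x z \<partial>seg 0 h)"
      unfolding circ_eq_seg by (rule integrable_integral_seg[OF Gm hGB])
    fix x
    have "(diff_op \<rho> (psi f h) x)\<^sup>2 \<le> (\<integral>z. psi_majorant \<rho> x z \<partial>seg 0 h)\<^sup>2"
      using power_mono[OF psi_difference[of \<rho> x], of 2] by simp
    also have "\<dots> \<le> h * (\<integral>z. (psi_majorant \<rho> x z)\<^sup>2 \<partial>seg 0 h)"
      by (rule integral_seg_square_le[where B = "4 * (L * \<bar>\<rho>\<bar>)"]) (simp_all add: h psi_majorant_bound)
    also have "\<dots> \<le> h * (\<integral>z. G x z \<partial>seg 0 h)"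
    proof (intro mult_left_mono integral_mono)
      show "integrable (seg 0 h) (\<lambda>z. (psi_majorant \<rho> x z)\<^sup>2)"
      proof (rule integrable_seg_bounded)
        show "\<bar>(psi_majorant \<rho> x z)\<^sup>2\<bar> \<le> 16 * (L * \<bar>\<rho>\<bar>)\<^sup>2" for z
          using dG[of x z] GB[of x z] by simp
      qed simp
      show "integrable (seg 0 h) (\<lambda>z. G x z)"
        by (rule integrable_seg_bounded[where B = "16 * (L * \<bar>\<rho>\<bar>)\<^sup>2"]) (simp add: G_def, rule GB)
    qed (use h dG in auto)
    finally show "(diff_op \<rho> (psi f h) x)\<^sup>2 \<le> (\<integral>z. h * G x z \<partial>seg 0 h)" by simp
  qed
  also have "\<dots> = (\<integral>z. (\<integral>x. h * G x z \<partial>circ) \<partial>seg 0 h)"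
    unfolding circ_eq_seg by (rule Fubini_seg[OF Gm hGB])
  also have "\<dots> = (\<integral>z. h * (16 * (\<integral>x. (diff_op \<rho> f x)\<^sup>2 \<partial>circ)) \<partial>seg 0 h)"
  proof (intro Bochner_Integration.integral_cong refl)
    fix z
    have s: "(\<integral>x. (diff_op \<rho> f (x + c))\<^sup>2 \<partial>circ) = (\<integral>x. (diff_op \<rho> f x)\<^sup>2 \<partial>circ)" for c
      by (rule integral_circ_shift[where f = "\<lambda>x. (diff_op \<rho> f x)\<^sup>2"]) (auto simp: per)
    show "(\<integral>x. h * G x z \<partial>circ) = h * (16 * (\<integral>x. (diff_op \<rho> f x)\<^sup>2 \<partial>circ))"
      using i1[of 0] i1[of "-z"] i1[of z] s[of "-z"] s[of z] unfolding G_def by simp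
  qed
  finally show ?thesis using h by (simp add: power2_eq_square mult_ac)
qed

text \<open>For \<open>c = \<partial>\<^sub>t f\<close> the right-hand side is the time derivative of
  \<open>\<integral>\<integral> \<bar>\<delta>\<^sub>z f\<bar> \<delta>\<^sub>z f / 2\<close> over \<open>0 < z < h\<close>.\<close>

lemma psi_pairing:
  assumes c [measurable]: "c \<in> borel_measurable borel" and cper: "\<And>x. c (x + 1) = c x" and cB: "\<And>x. \<bar>c x\<bar> \<le> B"
  shows "(\<integral>x. c x * psi f h x \<partial>circ) = (\<integral>x. (\<integral>z. \<bar>diff_op z f x\<bar> * diff_op z c x \<partial>seg 0 h) \<partial>circ)"
proof -
  note [measurable] = lip_circ_measurable[OF f]
  have B: "0 \<le> B" using cB[of 0] by simp
  have L: "0 \<le> L" by (rule lip_circ_nonneg[OF f])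
  have d: "\<bar>f (x + z) - f x\<bar> \<le> L * h" "\<bar>f x - f (x - z)\<bar> \<le> L * h" if "z \<in> {0..h}" for x z
  proof -
    have "L * \<bar>z\<bar> \<le> L * h" using that L by (intro mult_left_mono) auto
    then show "\<bar>f (x + z) - f x\<bar> \<le> L * h" "\<bar>f x - f (x - z)\<bar> \<le> L * h"
      using lip_circD[OF f, of "x + z" x] lip_circD[OF f, of x "x - z"] by auto
  qed
  have b: "\<bar>c y * \<bar>f (x + z) - f x\<bar>\<bar> \<le> B * (L * h)" "\<bar>c y * \<bar>f x - f (x - z)\<bar>\<bar> \<le> B * (L * h)" if "z \<in> {0..h}" for x y z
    unfolding abs_mult using d[OF that, of x] cB[of y] B by (auto intro!: mult_mono)
  have i1: "integrable circ (\<lambda>x. c (x + p) * \<bar>f (x + z) - f x\<bar>)" "integrable circ (\<lambda>x. c (x + p) * \<bar>f x - f (x - z)\<bar>)"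
    if "z \<in> {0..h}" for p z
    using b[OF that] by (auto intro!: integrable_circ_bounded[where B = "B * (L * h)"])
  have "(\<integral>x. c x * psi f h x \<partial>circ)
      = (\<integral>x. (\<integral>z. c x * (\<bar>f x - f (x - z)\<bar> - \<bar>f (x + z) - f x\<bar>) \<partial>seg 0 h) \<partial>circ)"
    by (simp add: psi_def)
  also have "\<dots> = (\<integral>z. (\<integral>x. c x * (\<bar>f x - f (x - z)\<bar> - \<bar>f (x + z) - f x\<bar>) \<partial>circ) \<partial>seg 0 h)"
    unfolding circ_eq_seg
  proof (rule Fubini_seg[where B = "B * (L * h) + B * (L * h)"])
    show "\<bar>c x * (\<bar>f x - f (x - z)\<bar> - \<bar>f (x + z) - f x\<bar>)\<bar> \<le> B * (L * h) + B * (L * h)" if "z \<in> {0..h}" for x z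
      unfolding right_diff_distrib using b[OF that, of x x] by linarith
  qed measurable
  also have "\<dots> = (\<integral>z. (\<integral>x. \<bar>diff_op z f x\<bar> * diff_op z c x \<partial>circ) \<partial>seg 0 h)"
  proof (rule Bochner_Integration.integral_cong[OF refl])
    fix z assume "z \<in> space (seg 0 h)"
    then have z: "z \<in> {0..h}" by simp
    \<comment> \<open>Rotation by \<open>z\<close> acts as a discrete integration by parts: it turns
      the backward difference into the forward one and moves the shift onto
      \<open>c\<close>.\<close>
    have "(\<integral>x. c x * \<bar>f x - f (x - z)\<bar> \<partial>circ) = (\<integral>x. c (x + z) * \<bar>f (x + z) - f x\<bar> \<partial>circ)"
    proof -
      have "f (x + 1 - z) = f (x - z)" for x
        using lip_circ_periodic[OF f, of "x - z"] by (simp add: algebra_simps)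
      then show ?thesis
        using integral_circ_shift[of "\<lambda>x. c x * \<bar>f x - f (x - z)\<bar>" z]
        by (simp add: cper lip_circ_periodic[OF f])
    qed
    moreover have "\<bar>diff_op z f x\<bar> * diff_op z c x = c (x + z) * \<bar>f (x + z) - f x\<bar> - c x * \<bar>f (x + z) - f x\<bar>" for x
      by (simp add: diff_op_def algebra_simps)
    ultimately show "(\<integral>x. c x * (\<bar>f x - f (x - z)\<bar> - \<bar>f (x + z) - f x\<bar>) \<partial>circ) = (\<integral>x. \<bar>diff_op z f x\<bar> * diff_op z c x \<partial>circ)"
      using i1[OF z, of 0] i1[OF z, of z] by (simp add: right_diff_distrib)
  qed
  also have "\<dots> = (\<integral>x. (\<integral>z. \<bar>diff_op z f x\<bar> * diff_op z c x \<partial>seg 0 h) \<partial>circ)"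
  proof -
    have "(\<lambda>(x, z). \<bar>diff_op z f x\<bar> * diff_op z c x) \<in> borel_measurable (borel \<Otimes>\<^sub>M borel)"
      unfolding diff_op_def by measurable
    moreover have "\<bar>\<bar>diff_op z f x\<bar> * diff_op z c x\<bar> \<le> B * (L * h) + B * (L * h)" if "x \<in> {0..1}" "z \<in> {0..h}" for x z
    proof -
      have "\<bar>diff_op z f x\<bar> * diff_op z c x = c (x + z) * \<bar>f (x + z) - f x\<bar> - c x * \<bar>f (x + z) - f x\<bar>"
        by (simp add: diff_op_def algebra_simps)
      then show ?thesis using b(1)[OF that(2), of "x + z" x] b(1)[OF that(2), of x x] by linarith
    qed
    ultimately show ?thesis
      unfolding circ_eq_seg by (rule Fubini_seg[symmetric])
  qed
  finally show ?thesis .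
qed

text \<open>The pairing with the constant 1, whose increments vanish. A vanishing mean is what makes
  the homogeneous seminorm of \<open>psi f h\<close> control its full norm.\<close>

lemma fc_psi_0: "fc (psi f h) 0 = 0"
proof -
  have "(\<integral>x. psi f h x \<partial>circ) = 0"
    using psi_pairing[of "\<lambda>_. 1" 1] by (simp add: diff_op_def)
  then show ?thesis by (simp add: fc_eq_cfc cfc_def)
qed

end

section \<open>The quadratic flux\<close>

text \<open>The integrand of \<open>m^2 * psi m h - psi (m^3) h / 3\<close> with its occurrences of
  \<open>m\<close> separated: \<open>u\<close> is the value at the point of differentiation,
  \<open>v\<close> the value at the moving point, \<open>w\<close> the value at the shifted
  point.\<close>

definition qf :: "real \<Rightarrow> real \<Rightarrow> real \<Rightarrow> real" where
  "qf u v w = u\<^sup>2 * \<bar>v - w\<bar> - \<bar>v ^ 3 - w ^ 3\<bar> / 3"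

lemma cube_diff: "v ^ 3 - w ^ 3 = (v - w) * (v\<^sup>2 + v * w + w\<^sup>2)" for v w :: real
  by (simp add: power2_eq_square power3_eq_cube algebra_simps)

lemma quadratic_form_nonneg: "0 \<le> v\<^sup>2 + v * w + w\<^sup>2" for v w :: real
proof -
  have "0 \<le> (v + w / 2)\<^sup>2 + 3 / 4 * w\<^sup>2" by simp
  then show ?thesis by (simp add: power2_eq_square algebra_simps)
qed

lemma abs_cube_diff: "\<bar>v ^ 3 - w ^ 3\<bar> = \<bar>v - w\<bar> * (v\<^sup>2 + v * w + w\<^sup>2)" for v w :: real
  unfolding cube_diff abs_mult using quadratic_form_nonneg[of v w] by simp

text \<open>Apart from \<open>|v - w|\<close> the function has the factor
  \<open>u^2 - (v^2 + v w + w^2) / 3\<close>, which vanishes at \<open>u = v = w\<close> and is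
  therefore of the order of the distances to \<open>u\<close>.\<close>

lemma qf_le:
  assumes "\<bar>u\<bar> \<le> B" "\<bar>v\<bar> \<le> B" "\<bar>w\<bar> \<le> B" and d: "\<bar>u - v\<bar> \<le> d" "\<bar>u - w\<bar> \<le> d"
  shows "\<bar>qf u v w\<bar> \<le> \<bar>v - w\<bar> * (2 * B * d)"
proof -
  have B: "0 \<le> B" "0 \<le> d" using assms by linarith+
  have bound: "\<bar>p * q\<bar> \<le> B * d" if "\<bar>p\<bar> \<le> B" "\<bar>q\<bar> \<le> d" for p q
    unfolding abs_mult using that B by (intro mult_mono) auto
  \<comment> \<open>The three groups are \<open>u^2 - v^2\<close>, \<open>u^2 - v w\<close> and
    \<open>u^2 - w^2\<close>; this leaves six products, each at most \<open>B * d\<close>.\<close>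
  have "3 * u\<^sup>2 - (v\<^sup>2 + v * w + w\<^sup>2)
    = u * (u - v) + v * (u - v) + (u * (u - v) + v * (u - w)) + (u * (u - w) + w * (u - w))"
    by (simp add: power2_eq_square algebra_simps)
  moreover have "\<bar>u * (u - v)\<bar> \<le> B * d" "\<bar>v * (u - v)\<bar> \<le> B * d" "\<bar>v * (u - w)\<bar> \<le> B * d"
    "\<bar>u * (u - w)\<bar> \<le> B * d" "\<bar>w * (u - w)\<bar> \<le> B * d"
    by (intro bound assms)+
  ultimately have "\<bar>3 * u\<^sup>2 - (v\<^sup>2 + v * w + w\<^sup>2)\<bar> \<le> 6 * (B * d)"
    unfolding abs_le_iff by linarith
  moreover have "qf u v w = \<bar>v - w\<bar> * ((3 * u\<^sup>2 - (v\<^sup>2 + v * w + w\<^sup>2)) / 3)"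
    by (simp add: qf_def abs_cube_diff algebra_simps diff_divide_distrib)
  ultimately show ?thesis
    using mult_left_mono[of "\<bar>3 * u\<^sup>2 - (v\<^sup>2 + v * w + w\<^sup>2)\<bar> / 3" "2 * B * d" "\<bar>v - w\<bar>"]
    by (simp only: abs_mult abs_divide) simp
qed

text \<open>The function \<open>v \<mapsto> qf u v w\<close> is flat at \<open>v = u\<close>, whatever \<open>w\<close>: this is what makes the rough part of the
  flux cancel.\<close>

lemma qf_flat:
  assumes B: "\<bar>u\<bar> \<le> B" "\<bar>v\<bar> \<le> B" "\<bar>w\<bar> \<le> B"
  shows "\<bar>qf u v w - qf u u w\<bar> \<le> 4 * B * (v - u)\<^sup>2"
proof -
  have cubic: "u\<^sup>2 * (v - u) - (v ^ 3 - u ^ 3) / 3 = - (v - u)\<^sup>2 * (v + 2 * u) / 3"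
    by (simp add: power2_eq_square power3_eq_cube field_simps)
  \<comment> \<open>The generous \<open>12 * B\<close> becomes \<open>4 * B\<close> after division
    by 3, the same constant as in the third case below.\<close>
  have "\<bar>v + 2 * u\<bar> \<le> 12 * B" using B by linarith
  then have small: "\<bar>(v - u)\<^sup>2 * (v + 2 * u) / 3\<bar> \<le> 4 * B * (v - u)\<^sup>2"
    using mult_left_mono[of "\<bar>v + 2 * u\<bar>" "12 * B" "(v - u)\<^sup>2"] by (simp add: abs_mult mult_ac)
  have mono: "p ^ 3 \<le> q ^ 3" if "p \<le> q" for p q :: real
    using that by (simp add: power_mono_odd)
  \<comment> \<open>Either \<open>w\<close> lies on one side of both \<open>u\<close> and
    \<open>v\<close>, both absolute values open with the same sign and \<open>w\<close> drops out,
    leaving the cubic identity; or \<open>w\<close> lies between them, and \<open>qf_le\<close> is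
    already quadratic in \<open>v - u\<close>.\<close>
  consider "w \<le> v" "w \<le> u" | "v \<le> w" "u \<le> w" | "\<bar>u - w\<bar> \<le> \<bar>v - u\<bar>" "\<bar>v - w\<bar> \<le> \<bar>v - u\<bar>"
    by linarith
  then show ?thesis
  proof cases
    case 1
    then have "qf u v w - qf u u w = u\<^sup>2 * (v - u) - (v ^ 3 - u ^ 3) / 3"
      using mono[of w v] mono[of w u] by (simp add: qf_def field_simps)
    then show ?thesis using small cubic by simp
  next
    case 2
    then have "qf u v w - qf u u w = - (u\<^sup>2 * (v - u) - (v ^ 3 - u ^ 3) / 3)"
      using mono[of v w] mono[of u w] by (simp add: qf_def field_simps)
    then show ?thesis using small cubic by simp
  next
    case 3
    have "\<bar>qf u v w\<bar> \<le> \<bar>v - w\<bar> * (2 * B * \<bar>v - u\<bar>)" "\<bar>qf u u w\<bar> \<le> \<bar>u - w\<bar> * (2 * B * \<bar>v - u\<bar>)"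
      using 3 B by (intro qf_le; simp add: abs_minus_commute)+
    moreover have "\<bar>v - w\<bar> * (2 * B * \<bar>v - u\<bar>) \<le> \<bar>v - u\<bar> * (2 * B * \<bar>v - u\<bar>)"
      "\<bar>u - w\<bar> * (2 * B * \<bar>v - u\<bar>) \<le> \<bar>v - u\<bar> * (2 * B * \<bar>v - u\<bar>)"
      using 3 B by (intro mult_right_mono; simp)+
    moreover have "\<bar>v - u\<bar> * (2 * B * \<bar>v - u\<bar>) = 2 * B * (v - u)\<^sup>2"
    proof -
      have "\<bar>v - u\<bar> * (2 * B * \<bar>v - u\<bar>) = 2 * B * (\<bar>v - u\<bar> * \<bar>v - u\<bar>)" by (simp only: mult_ac)
      then show ?thesis by (simp only: abs_mult_self_eq power2_eq_square)
    qed
    ultimately show ?thesis by linarith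
  qed
qed

lemma continuous_antiderivative:
  fixes Q :: "real \<Rightarrow> real"
  assumes Q: "continuous_on UNIV Q"
  obtains P where "\<And>x. (P has_real_derivative Q x) (at x)"
proof
  fix x :: real
  let ?a = "- \<bar>x\<bar> - 1" and ?b = "\<bar>x\<bar> + 1"
  have "((\<lambda>u. LBINT y=ereal 0..ereal u. Q y) has_vector_derivative Q x) (at x within {?a..?b})"
    by (rule interval_integral_FTC2) (use Q in \<open>auto intro: continuous_on_subset\<close>)
  then have "((\<lambda>u. LBINT y=ereal 0..ereal u. Q y) has_vector_derivative Q x) (at x)"
    by (subst (asm) at_within_interior) (auto simp: interior_atLeastAtMost_real)
  then show "((\<lambda>u. LBINT y=ereal 0..ereal u. Q y) has_real_derivative Q x) (at x)"
    by (simp add: has_real_derivative_iff_has_vector_derivative)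
qed

lemma integral_seg_FTC:
  fixes F f :: "real \<Rightarrow> real"
  assumes "a \<le> b" "\<And>x. (F has_real_derivative f x) (at x)" "continuous_on UNIV f"
  shows "(\<integral>x. f x \<partial>seg a b) = F b - F a"
proof -
  have "(\<integral>x. f x \<partial>seg a b) = (\<integral>x. f x * indicator {a..b} x \<partial>lborel)"
    unfolding seg_def by (subst integral_restrict_space) (auto simp: mult.commute)
  also have "\<dots> = F b - F a"
    using assms by (intro integral_FTC_Icc_real) (auto simp: continuous_on_eq_continuous_at)
  finally show ?thesis .
qed

text \<open>The boundary values at \<open>z = h\<close> of the forward and the backward half of the
  flux. Those at \<open>z = 0\<close> are absent because \<open>qf u u u = 0\<close>.\<close>

definition flux_density :: "(real \<Rightarrow> real) \<Rightarrow> real \<Rightarrow> real \<Rightarrow> real" where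
  "flux_density m h y = qf (m y) (m y) (m (y + h)) + qf (m y) (m y) (m (y - h))"

lemma qf_continuous: "continuous_on S (\<lambda>w. qf u v w)"
  unfolding qf_def by (intro continuous_intros) auto

lemma measurable_qf [measurable]:
  assumes [measurable]: "f \<in> borel_measurable M" "g \<in> borel_measurable M" "k \<in> borel_measurable M"
  shows "(\<lambda>x. qf (f x) (g x) (k x)) \<in> borel_measurable M"
  unfolding qf_def by measurable

lemma qf_abs_le:
  assumes "\<bar>u\<bar> \<le> B" "\<bar>v\<bar> \<le> B" "\<bar>w\<bar> \<le> B"
  shows "\<bar>qf u v w\<bar> \<le> 8 * B ^ 3"
proof -
  have "0 \<le> B" using assms by linarith
  have "\<bar>qf u v w\<bar> \<le> \<bar>v - w\<bar> * (2 * B * (2 * B))" using assms by (intro qf_le) auto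
  also have "\<dots> \<le> (2 * B) * (2 * B * (2 * B))" using assms \<open>0 \<le> B\<close> by (intro mult_right_mono) auto
  finally show ?thesis by (simp add: power3_eq_cube)
qed

text \<open>With \<open>S = v^2 + v u + u^2\<close>, the two ends of an increment combine to
  \<open>p\<close> times \<open>(a + a') / 2 * p^2 / 3 + (a' - a) / 2 * (v^2 - u^2)\<close>, because
  \<open>u^2 + v^2 - 2 S / 3 = p^2 / 3\<close>. The first part is coercive; the second is bounded by
  \<open>d * S\<close>, and \<open>p * S\<close> is the increment of the cube.\<close>

lemma flux_pointwise:
  fixes a a' u v :: real
  assumes "a0 \<le> a" "a0 \<le> a'" "\<bar>a' - a\<bar> \<le> d"
  shows "a0 / 3 * \<bar>v - u\<bar> ^ 3 - d * \<bar>v ^ 3 - u ^ 3\<bar> \<le> a * qf u u v + a' * qf v v u"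
proof -
  define p where "p = \<bar>v - u\<bar>"
  define S where "S = v\<^sup>2 + v * u + u\<^sup>2"
  have p: "0 \<le> p" by (simp add: p_def)
  have S: "0 \<le> S" unfolding S_def by (rule quadratic_form_nonneg)
  have p2: "p\<^sup>2 = v\<^sup>2 - 2 * (v * u) + u\<^sup>2"
    unfolding p_def by (simp add: power2_eq_square algebra_simps)
  \<comment> \<open>\<open>2 * S\<close> equals \<open>(v + u)^2 + v^2 + u^2\<close>.\<close>
  have "\<bar>v\<^sup>2 - u\<^sup>2\<bar> \<le> 2 * S"
  proof -
    have "(v + u)\<^sup>2 = v\<^sup>2 + 2 * (v * u) + u\<^sup>2" by (simp add: power2_sum)
    then have "0 \<le> v\<^sup>2 + 2 * (v * u) + u\<^sup>2" by (metis zero_le_power2)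
    moreover have "\<bar>p - q\<bar> \<le> 2 * (p + r + q)" if "0 \<le> p + 2 * r + q" "0 \<le> p" "0 \<le> q" for p q r :: real
      using that by (intro abs_leI) (simp_all add: algebra_simps)
    ultimately show ?thesis unfolding S_def by simp
  qed
  then have "\<bar>(a' - a) / 2 * (v\<^sup>2 - u\<^sup>2)\<bar> \<le> d / 2 * (2 * S)"
    unfolding abs_mult using assms(3) by (intro mult_mono) auto
  then have 1: "- (d * S) \<le> (a' - a) / 2 * (v\<^sup>2 - u\<^sup>2)" by simp
  have 2: "a0 / 3 * p\<^sup>2 \<le> (a + a') / 2 * (p\<^sup>2 / 3)"
    using mult_right_mono[of a0 "(a + a') / 2" "p\<^sup>2 / 3"] assms by simp
  have "a * (u\<^sup>2 - S / 3) + a' * (v\<^sup>2 - S / 3) = (a + a') / 2 * (p\<^sup>2 / 3) + (a' - a) / 2 * (v\<^sup>2 - u\<^sup>2)"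
    unfolding p2 S_def by (simp add: field_simps)
  then have "a0 / 3 * p\<^sup>2 - d * S \<le> a * (u\<^sup>2 - S / 3) + a' * (v\<^sup>2 - S / 3)" using 1 2 by linarith
  from mult_left_mono[OF this p]
  have "p * (a0 / 3 * p\<^sup>2 - d * S) \<le> p * (a * (u\<^sup>2 - S / 3) + a' * (v\<^sup>2 - S / 3))" .
  moreover have "p * (a0 / 3 * p\<^sup>2 - d * S) = a0 / 3 * p ^ 3 - d * (p * S)"
    by (simp add: power2_eq_square power3_eq_cube algebra_simps)
  moreover have "a * qf u u v + a' * qf v v u = p * (a * (u\<^sup>2 - S / 3) + a' * (v\<^sup>2 - S / 3))"
  proof -
    have q1: "qf v v u = p * (v\<^sup>2 - S / 3)"
      unfolding qf_def abs_cube_diff p_def S_def by (simp add: algebra_simps)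
    have q2: "qf u u v = p * (u\<^sup>2 - S / 3)"
      unfolding qf_def abs_cube_diff p_def S_def by (simp add: abs_minus_commute[of u v] algebra_simps)
    show ?thesis unfolding q1 q2 by (simp only: distrib_left mult.left_commute)
  qed
  moreover have "\<bar>v ^ 3 - u ^ 3\<bar> = p * S" by (simp add: abs_cube_diff p_def S_def)
  ultimately show ?thesis by (simp add: p_def)
qed

lemma diff_quotient_le:
  assumes "lip_circ K f" "k \<noteq> 0"
  shows "\<bar>diff_op k f x / k\<bar> \<le> K"
  using lip_circD[OF assms(1), of "x + k" x] assms(2) by (simp add: diff_op_def abs_divide pos_divide_le_eq)

context
  fixes L L' h B :: real and m :: "real \<Rightarrow> real"
  assumes m: "lip_circ L m" and N: "lip_circ L' (\<lambda>x. m x ^ 3)" and h: "0 < h" and mB: "\<And>x. \<bar>m x\<bar> \<le> B"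
begin

text \<open>\<open>X\<close> is the combination with the factor \<open>m^2\<close> frozen at
  \<open>y\<close>; \<open>X0\<close> also freezes the moving value \<open>m x\<close>. By
  \<open>qf_flat\<close> the two differ by a multiple of \<open>(x - y)^2\<close>, so their
  difference quotients at \<open>y\<close> have the same limit.\<close>

lemma psi_flux_limit:
  assumes e: "\<And>n. e n \<noteq> 0" "e \<longlonglongrightarrow> 0"
  shows "(\<lambda>n. (m y)\<^sup>2 * (diff_op (e n) (psi m h) y / e n) - diff_op (e n) (psi (\<lambda>x. m x ^ 3) h) y / e n / 3)
    \<longlonglongrightarrow> - flux_density m h y"
proof -
  have mc: "continuous_on UNIV m" by (rule lip_circ_continuous[OF m])
  have [measurable]: "m \<in> borel_measurable borel" by (rule lip_circ_measurable[OF m])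
  have B: "0 \<le> B" using mB[of 0] by linarith
  define u where "u = m y"
  define X where "X x = u\<^sup>2 * psi m h x - psi (\<lambda>x. m x ^ 3) h x / 3" for x
  define X0 where "X0 x = (\<integral>z. qf u u (m (x - z)) - qf u u (m (x + z)) \<partial>seg 0 h)" for x
  have int: "integrable (seg 0 h) (\<lambda>z. qf u v (m (x - z)) - qf u v (m (x + z)))" if "\<bar>v\<bar> \<le> B" for x v
    using qf_abs_le[of u B v, OF _ that] mB
    by (intro Bochner_Integration.integrable_diff integrable_seg_bounded[where B = "8 * B ^ 3"]) (auto simp: u_def)
  have Xq: "X x = (\<integral>z. qf u (m x) (m (x - z)) - qf u (m x) (m (x + z)) \<partial>seg 0 h)" for x
  proof -
    have "X x = (\<integral>z. u\<^sup>2 * (\<bar>m x - m (x - z)\<bar> - \<bar>m (x + z) - m x\<bar>)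
        - (\<bar>m x ^ 3 - m (x - z) ^ 3\<bar> - \<bar>m (x + z) ^ 3 - m x ^ 3\<bar>) / 3 \<partial>seg 0 h)"
      unfolding X_def psi_def using psi_integrable[OF m h, of x] psi_integrable[OF N h, of x]
      by simp
    also have "\<dots> = (\<integral>z. qf u (m x) (m (x - z)) - qf u (m x) (m (x + z)) \<partial>seg 0 h)"
      by (intro Bochner_Integration.integral_cong refl)
         (simp add: qf_def abs_minus_commute[of "m x"] abs_minus_commute[of "m x ^ 3"] algebra_simps diff_divide_distrib)
    finally show ?thesis .
  qed
  have close: "\<bar>X x - X0 x\<bar> \<le> 8 * B * h * L\<^sup>2 * (x - y)\<^sup>2" for x
  proof -
    have "\<bar>X x - X0 x\<bar> = \<bar>\<integral>z. (qf u (m x) (m (x - z)) - qf u (m x) (m (x + z))) - (qf u u (m (x - z)) - qf u u (m (x + z))) \<partial>seg 0 h\<bar>"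
      unfolding Xq X0_def using int[OF mB, of x x] int[of u x] mB by (simp add: u_def)
    also have "\<dots> \<le> (h - 0) * (8 * B * (m x - u)\<^sup>2)"
    proof (rule integral_seg_le)
      fix z
      have "\<bar>qf u (m x) w - qf u u w\<bar> \<le> 4 * B * (m x - u)\<^sup>2" if "\<bar>w\<bar> \<le> B" for w
        using mB that by (intro qf_flat) (auto simp: u_def)
      from this[OF mB[of "x - z"]] this[OF mB[of "x + z"]]
      show "\<bar>qf u (m x) (m (x - z)) - qf u (m x) (m (x + z)) - (qf u u (m (x - z)) - qf u u (m (x + z)))\<bar> \<le> 8 * B * (m x - u)\<^sup>2"
        by linarith
    qed (use h in simp)
    also have "\<dots> \<le> h * (8 * B * (L\<^sup>2 * (x - y)\<^sup>2))"
    proof -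
      have "(m x - u)\<^sup>2 \<le> (L * \<bar>x - y\<bar>)\<^sup>2"
        using power_mono[OF lip_circD[OF m, of x y], of 2] by (simp add: u_def)
      then show ?thesis using h B by (simp add: power_mult_distrib mult_left_mono)
    qed
    finally show ?thesis by (simp add: mult_ac)
  qed
  define Q where "Q w = qf u u (m w)" for w
  have Qc: "continuous_on UNIV Q"
    unfolding Q_def by (rule continuous_on_compose2[OF qf_continuous mc]) auto
  obtain P where P: "\<And>x. (P has_real_derivative Q x) (at x)"
    using continuous_antiderivative[OF Qc] by blast
  \<comment> \<open>In \<open>X0\<close> the function \<open>m\<close> is evaluated at
    \<open>x - z\<close> and \<open>x + z\<close> only, so the integral over \<open>z\<close> is
    explicit in an antiderivative of \<open>Q\<close>. Its derivative at \<open>y\<close> contains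
    \<open>2 * Q y\<close>, which is zero.\<close>
  have X0P: "X0 x = 2 * P x - P (x - h) - P (x + h)" for x
  proof -
    have "((\<lambda>z. P (x - z)) has_real_derivative Q (x - z) * (0 - 1)) (at z)" for z
      by (rule DERIV_chain2[OF P], rule DERIV_diff[OF DERIV_const DERIV_ident])
    from DERIV_minus[OF this] have D: "((\<lambda>z. - P (x - z)) has_real_derivative Q (x - z)) (at z)" for z by simp
    have "((\<lambda>z. P (x + z)) has_real_derivative Q (x + z) * (0 + 1)) (at z)" for z
      by (rule DERIV_chain2[OF P], rule DERIV_add[OF DERIV_const DERIV_ident])
    then have D': "((\<lambda>z. P (x + z)) has_real_derivative Q (x + z)) (at z)" for z by simp
    have "(\<integral>z. Q (x - z) \<partial>seg 0 h) = - P (x - h) - - P (x - 0)"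
      by (rule integral_seg_FTC[OF _ D])
         (use h Qc in \<open>auto intro!: continuous_on_compose2[OF Qc] continuous_intros\<close>)
    moreover have "(\<integral>z. Q (x + z) \<partial>seg 0 h) = P (x + h) - P (x + 0)"
      by (rule integral_seg_FTC[OF _ D'])
         (use h Qc in \<open>auto intro!: continuous_on_compose2[OF Qc] continuous_intros\<close>)
    moreover have "integrable (seg 0 h) (\<lambda>z. Q (x - z))" "integrable (seg 0 h) (\<lambda>z. Q (x + z))"
    proof -
      have b: "\<bar>Q z\<bar> \<le> 8 * B ^ 3" for z
        unfolding Q_def u_def by (intro qf_abs_le mB)
      have "(\<lambda>z. Q (x - z)) \<in> borel_measurable borel" "(\<lambda>z. Q (x + z)) \<in> borel_measurable borel"
        unfolding Q_def by measurable
      from integrable_seg_bounded[OF this(1) b] integrable_seg_bounded[OF this(2) b]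
      show "integrable (seg 0 h) (\<lambda>z. Q (x - z))" "integrable (seg 0 h) (\<lambda>z. Q (x + z))" .
    qed
    ultimately show ?thesis by (simp add: X0_def Q_def)
  qed
  have "(X0 has_real_derivative 2 * Q y - Q (y - h) - Q (y + h)) (at y)"
    unfolding X0P[abs_def] by (auto intro!: derivative_eq_intros DERIV_chain2[OF P])
  moreover have "Q y = 0" by (simp add: Q_def qf_def u_def)
  ultimately have "((\<lambda>k. (X0 (y + k) - X0 y) / k) \<longlongrightarrow> - Q (y - h) - Q (y + h)) (at 0)"
    by (simp add: DERIV_def)
  moreover have "filterlim e (at 0) sequentially"
    using e by (auto simp: filterlim_at)
  ultimately have lim0: "(\<lambda>n. (X0 (y + e n) - X0 y) / e n) \<longlonglongrightarrow> - Q (y - h) - Q (y + h)"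
    by (rule filterlim_compose)
  have "(\<lambda>n. (X (y + e n) - X0 (y + e n)) / e n) \<longlonglongrightarrow> 0"
  proof (rule Lim_null_comparison)
    show "\<forall>\<^sub>F n in sequentially. norm ((X (y + e n) - X0 (y + e n)) / e n) \<le> 8 * B * h * L\<^sup>2 * \<bar>e n\<bar>"
    proof (rule always_eventually, rule allI)
      fix n
      have "(e n)\<^sup>2 = \<bar>e n\<bar> * \<bar>e n\<bar>" by (simp add: power2_eq_square)
      then have "\<bar>X (y + e n) - X0 (y + e n)\<bar> \<le> 8 * B * h * L\<^sup>2 * \<bar>e n\<bar> * \<bar>e n\<bar>"
        using close[of "y + e n"] by (simp add: mult.assoc)
      then show "norm ((X (y + e n) - X0 (y + e n)) / e n) \<le> 8 * B * h * L\<^sup>2 * \<bar>e n\<bar>"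
        using e(1)[of n] by (simp add: pos_divide_le_eq)
    qed
    show "(\<lambda>n. 8 * B * h * L\<^sup>2 * \<bar>e n\<bar>) \<longlonglongrightarrow> 0"
      using e(2) by (auto intro!: tendsto_eq_intros)
  qed
  from tendsto_add[OF lim0 this]
  have "(\<lambda>n. (X0 (y + e n) - X0 y) / e n + (X (y + e n) - X0 (y + e n)) / e n) \<longlonglongrightarrow> - Q (y - h) - Q (y + h)"
    by simp
  moreover have "X y = X0 y" using close[of y] by simp
  then have "(X0 (y + k) - X0 y) / k + (X (y + k) - X0 (y + k)) / k
     = (m y)\<^sup>2 * (diff_op k (psi m h) y / k) - diff_op k (psi (\<lambda>x. m x ^ 3) h) y / k / 3" for k
  proof -
    have "(X0 (y + k) - X0 y) / k + (X (y + k) - X0 (y + k)) / k = (X (y + k) - X y) / k"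
      using \<open>X y = X0 y\<close> by (simp add: diff_divide_distrib)
    also have "X (y + k) - X y = (m y)\<^sup>2 * diff_op k (psi m h) y - diff_op k (psi (\<lambda>x. m x ^ 3) h) y / 3"
      by (simp add: X_def u_def diff_op_def right_diff_distrib diff_divide_distrib)
    finally show ?thesis by (simp add: diff_divide_distrib)
  qed
  moreover have "- Q (y - h) - Q (y + h) = - flux_density m h y"
    by (simp add: Q_def u_def flux_density_def)
  ultimately show ?thesis by simp
qed

text \<open>The pointwise limit is integrated against \<open>a\<close>. Both pairings are limits
  along the same steps \<open>e n\<close>, and the Lipschitz constants of the two test functions
  provide a constant majorant.\<close>

lemma weak_flux_identity:
  assumes a [measurable]: "a \<in> borel_measurable borel" and aB: "\<And>x. \<bar>a x\<bar> \<le> A0"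
  shows "Re (\<integral>k. cnj (fc (\<lambda>x. a x * (m x)\<^sup>2) k) * Dx (fc (psi m h)) k \<partial>count_space UNIV)
    = Re (\<integral>k. cnj (fc a k) * Dx (fc (psi (\<lambda>x. m x ^ 3) h)) k \<partial>count_space UNIV) / 3
      - (\<integral>x. a x * flux_density m h x \<partial>circ)"
proof -
  have [measurable]: "m \<in> borel_measurable borel" by (rule lip_circ_measurable[OF m])
  have B: "0 \<le> B" using mB[of 0] by linarith
  have A0: "0 \<le> A0" using aB[of 0] by linarith
  let ?N = "\<lambda>x. m x ^ 3"
  note pm = psi_lip_circ[OF m h] and pN = psi_lip_circ[OF N h]
  have [measurable]: "psi m h \<in> borel_measurable borel" "psi ?N h \<in> borel_measurable borel"
    by (rule lip_circ_measurable[OF pm], rule lip_circ_measurable[OF pN])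
  have m2: "(m x)\<^sup>2 \<le> B\<^sup>2" for x using power_mono[OF mB[of x], of 2] by simp
  have am: "\<bar>a x * (m x)\<^sup>2\<bar> \<le> A0 * B\<^sup>2" for x
    using mult_mono[OF aB[of x] m2[of x]] A0 by (simp add: abs_mult)
  have aL: "L2r a" by (rule L2c_bounded[where B = A0]) (use aB in auto)
  have amL: "L2r (\<lambda>x. a x * (m x)\<^sup>2)"
    by (rule L2c_bounded[where B = "A0 * B\<^sup>2"]) (use am in \<open>auto simp del: of_real_mult of_real_power\<close>)
  define e where "e n = 1 / real (Suc n)" for n
  have e: "e n \<noteq> 0" "e \<longlonglongrightarrow> 0" for n
    unfolding e_def using LIMSEQ_inverse_real_of_nat by (auto simp: inverse_eq_divide)
  have l1: "(\<lambda>n. \<integral>x. (a x * (m x)\<^sup>2) * (diff_op (e n) (psi m h) x / e n) \<partial>circ)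
    \<longlonglongrightarrow> Re (\<integral>k. cnj (fc (\<lambda>x. a x * (m x)\<^sup>2) k) * Dx (fc (psi m h)) k \<partial>count_space UNIV)"
    by (rule weak_derivative_limit[OF amL pm e])
  have l2: "(\<lambda>n. \<integral>x. a x * (diff_op (e n) (psi ?N h) x / e n) \<partial>circ)
    \<longlonglongrightarrow> Re (\<integral>k. cnj (fc a k) * Dx (fc (psi ?N h)) k \<partial>count_space UNIV)"
    by (rule weak_derivative_limit[OF aL pN e])
  let ?d1 = "\<lambda>n x. diff_op (e n) (psi m h) x / e n" and ?d2 = "\<lambda>n x. diff_op (e n) (psi ?N h) x / e n"
  have b1: "\<bar>(a x * (m x)\<^sup>2) * ?d1 n x\<bar> \<le> A0 * B\<^sup>2 * (4 * h * L)" for n x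
    unfolding abs_mult[of "a x * (m x)\<^sup>2"]
    using am[of x] diff_quotient_le[OF pm e(1)[of n], of x] A0 by (intro mult_mono) auto
  have b2: "\<bar>a x * ?d2 n x\<bar> \<le> A0 * (4 * h * L')" for n x
    unfolding abs_mult[of "a x"]
    using aB[of x] diff_quotient_le[OF pN e(1)[of n], of x] A0 by (intro mult_mono) auto
  have meas [measurable]: "(\<lambda>x. ?d1 n x) \<in> borel_measurable borel" "(\<lambda>x. ?d2 n x) \<in> borel_measurable borel" for n
    unfolding diff_op_def by measurable
  have i1: "integrable circ (\<lambda>x. (a x * (m x)\<^sup>2) * ?d1 n x)" and i2: "integrable circ (\<lambda>x. a x * ?d2 n x)" for n
    by (rule integrable_circ_bounded[where B = "A0 * B\<^sup>2 * (4 * h * L)"], measurable, use b1 in simp)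
       (rule integrable_circ_bounded[where B = "A0 * (4 * h * L')"], measurable, use b2 in simp)
  have tri: "\<bar>p - q / 3\<bar> \<le> c + c'" if "\<bar>p\<bar> \<le> c" "\<bar>q\<bar> \<le> c'" for p q c c' :: real
    using that by linarith
  have eq: "(\<integral>x. (a x * (m x)\<^sup>2) * ?d1 n x \<partial>circ) - (\<integral>x. a x * ?d2 n x \<partial>circ) / 3
     = (\<integral>x. a x * ((m x)\<^sup>2 * ?d1 n x - ?d2 n x / 3) \<partial>circ)" for n
  proof -
    have "(\<integral>x. p x \<partial>circ) - (\<integral>x. q x \<partial>circ) / 3 = (\<integral>x. p x - q x / 3 \<partial>circ)"
      if "integrable circ p" "integrable circ q" for p q :: "real \<Rightarrow> real"
      using that by simp
    from this[OF i1[of n] i2[of n]] show ?thesis by (simp add: algebra_simps)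
  qed
  have "(\<lambda>n. \<integral>x. a x * ((m x)\<^sup>2 * ?d1 n x - ?d2 n x / 3) \<partial>circ) \<longlonglongrightarrow> (\<integral>x. a x * (- flux_density m h x) \<partial>circ)"
  proof (rule integral_dominated_convergence[where w = "\<lambda>_. A0 * B\<^sup>2 * (4 * h * L) + A0 * (4 * h * L')"])
    show "(\<lambda>x. a x * (- flux_density m h x)) \<in> borel_measurable circ"
      unfolding flux_density_def by measurable
    show "AE x in circ. (\<lambda>n. a x * ((m x)\<^sup>2 * ?d1 n x - ?d2 n x / 3)) \<longlonglongrightarrow> a x * (- flux_density m h x)"
      by (intro AE_I2 tendsto_mult tendsto_const psi_flux_limit e)
    show "AE x in circ. norm (a x * ((m x)\<^sup>2 * ?d1 n x - ?d2 n x / 3)) \<le> A0 * B\<^sup>2 * (4 * h * L) + A0 * (4 * h * L')" for n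
    proof (rule AE_I2)
      fix x
      have "a x * ((m x)\<^sup>2 * ?d1 n x - ?d2 n x / 3) = (a x * (m x)\<^sup>2) * ?d1 n x - a x * ?d2 n x / 3"
        by (simp add: algebra_simps)
      then show "norm (a x * ((m x)\<^sup>2 * ?d1 n x - ?d2 n x / 3)) \<le> A0 * B\<^sup>2 * (4 * h * L) + A0 * (4 * h * L')"
        using tri[OF b1[of x n] b2[of x n]] by (simp only: real_norm_def)
    qed
    show "(\<lambda>x. a x * ((m x)\<^sup>2 * ?d1 n x - ?d2 n x / 3)) \<in> borel_measurable circ" for n
    proof (rule measurable_circ)
      note [measurable] = meas[of n]
      show "(\<lambda>x. a x * ((m x)\<^sup>2 * ?d1 n x - ?d2 n x / 3)) \<in> borel_measurable borel"
        by (rule borel_measurable_times[OF a borel_measurable_diff[OF borel_measurable_times[OF _ meas(1)] borel_measurable_divide[OF meas(2)]]]) simp_all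
    qed
    show "integrable circ (\<lambda>_. A0 * B\<^sup>2 * (4 * h * L) + A0 * (4 * h * L'))" by simp
  qed
  moreover have "(\<lambda>n. \<integral>x. a x * ((m x)\<^sup>2 * ?d1 n x - ?d2 n x / 3) \<partial>circ)
     \<longlonglongrightarrow> Re (\<integral>k. cnj (fc (\<lambda>x. a x * (m x)\<^sup>2) k) * Dx (fc (psi m h)) k \<partial>count_space UNIV)
      - Re (\<integral>k. cnj (fc a k) * Dx (fc (psi ?N h)) k \<partial>count_space UNIV) / 3"
    unfolding eq[symmetric] by (intro tendsto_diff tendsto_divide tendsto_const l1 l2) simp
  ultimately have "(\<integral>x. a x * (- flux_density m h x) \<partial>circ)
      = Re (\<integral>k. cnj (fc (\<lambda>x. a x * (m x)\<^sup>2) k) * Dx (fc (psi m h)) k \<partial>count_space UNIV)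
      - Re (\<integral>k. cnj (fc a k) * Dx (fc (psi ?N h)) k \<partial>count_space UNIV) / 3"
    by (rule LIMSEQ_unique)
  then show ?thesis by simp
qed

text \<open>The backward half of the flux density is rotated by \<open>h\<close>. Both halves then
  involve the same pair \<open>m x\<close>, \<open>m (x + h)\<close>, weighted with \<open>a\<close>
  at the respective end, as in \<open>flux_pointwise\<close>.\<close>

lemma flux_lower_bound:
  assumes a [measurable]: "a \<in> borel_measurable borel" and aB: "\<And>x. \<bar>a x\<bar> \<le> A0" and aper: "\<And>x. a (x + 1) = a x"
    and alow: "\<And>x. a0 \<le> a x" and ah: "\<And>x. \<bar>a (x + h) - a x\<bar> \<le> d"
  shows "a0 / 3 * (\<integral>x. \<bar>diff_op h m x\<bar> ^ 3 \<partial>circ) - d * (\<integral>x. \<bar>diff_op h (\<lambda>x. m x ^ 3) x\<bar> \<partial>circ)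
    \<le> (\<integral>x. a x * flux_density m h x \<partial>circ)"
proof -
  have [measurable]: "m \<in> borel_measurable borel" by (rule lip_circ_measurable[OF m])
  have A0: "0 \<le> A0" using aB[of 0] by linarith
  have B: "0 \<le> B" using mB[of 0] by linarith
  define N where "N x = m x ^ 3" for x
  have qb: "\<bar>a y * qf (m x) (m x) (m w)\<bar> \<le> A0 * (8 * B ^ 3)" for x y w
    unfolding abs_mult using aB qf_abs_le[OF mB mB mB] A0 by (intro mult_mono) auto
  have iq: "integrable circ (\<lambda>x. a (x + c) * qf (m (x + p)) (m (x + p)) (m (x + q)))" for c p q
    by (rule integrable_circ_bounded[where B = "A0 * (8 * B ^ 3)"]) (use qb in auto)
  have im: "integrable circ (\<lambda>x. \<bar>diff_op h m x\<bar> ^ 3)"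
  proof (rule integrable_circ_bounded)
    show "norm (\<bar>diff_op h m x\<bar> ^ 3) \<le> (2 * B) ^ 3" for x
    proof -
      have "\<bar>diff_op h m x\<bar> \<le> 2 * B" using mB[of x] mB[of "x + h"] unfolding diff_op_def by linarith
      from power_mono[OF this, of 3] show ?thesis by (simp add: power_abs)
    qed
  qed (simp add: diff_op_def)
  have iN: "integrable circ (\<lambda>x. \<bar>diff_op h N x\<bar>)"
  proof (rule integrable_circ_bounded)
    have "lip_circ L' N" using N by (simp add: N_def[abs_def])
    from lip_circD[OF this] show "norm \<bar>diff_op h N x\<bar> \<le> L' * h" for x
      using h unfolding diff_op_def by (metis abs_of_pos add_diff_cancel_left' real_norm_def abs_abs)
  qed (simp add: diff_op_def N_def)
  have mper: "m (x + 1 + c) = m (x + c)" for x c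
    using lip_circ_periodic[OF m, of "x + c"] by (simp add: add_ac)
  have shift: "(\<integral>x. a x * qf (m x) (m x) (m (x - h)) \<partial>circ) = (\<integral>x. a (x + h) * qf (m (x + h)) (m (x + h)) (m x) \<partial>circ)"
    using integral_circ_shift[of "\<lambda>x. a x * qf (m x) (m x) (m (x - h))" h] mper[of _ 0] mper[of _ "-h"]
    by (simp add: aper)
  have "a0 / 3 * (\<integral>x. \<bar>diff_op h m x\<bar> ^ 3 \<partial>circ) - d * (\<integral>x. \<bar>diff_op h N x\<bar> \<partial>circ)
      = (\<integral>x. a0 / 3 * \<bar>diff_op h m x\<bar> ^ 3 - d * \<bar>diff_op h N x\<bar> \<partial>circ)"
    using im iN by simp
  also have "\<dots> \<le> (\<integral>x. a x * qf (m x) (m x) (m (x + h)) + a (x + h) * qf (m (x + h)) (m (x + h)) (m x) \<partial>circ)"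
  proof (rule integral_mono)
    show "integrable circ (\<lambda>x. a0 / 3 * \<bar>diff_op h m x\<bar> ^ 3 - d * \<bar>diff_op h N x\<bar>)"
      using im iN by simp
    show "integrable circ (\<lambda>x. a x * qf (m x) (m x) (m (x + h)) + a (x + h) * qf (m (x + h)) (m (x + h)) (m x))"
      using iq[of 0 0 h] iq[of h h 0] by simp
    fix x
    show "a0 / 3 * \<bar>diff_op h m x\<bar> ^ 3 - d * \<bar>diff_op h N x\<bar>
        \<le> a x * qf (m x) (m x) (m (x + h)) + a (x + h) * qf (m (x + h)) (m (x + h)) (m x)"
      unfolding diff_op_def N_def
      using flux_pointwise[OF alow[of x] alow[of "x + h"] ah[of x], of "m (x + h)" "m x"] by simp
  qed
  also have "\<dots> = (\<integral>x. a x * qf (m x) (m x) (m (x + h)) \<partial>circ) + (\<integral>x. a (x + h) * qf (m (x + h)) (m (x + h)) (m x) \<partial>circ)"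
    using iq[of 0 0 h] iq[of h h 0] by simp
  also have "\<dots> = (\<integral>x. a x * flux_density m h x \<partial>circ)"
    unfolding shift[symmetric] flux_density_def distrib_left
    using iq[of 0 0 h] iq[of 0 0 "-h"] by simp
  finally show ?thesis by (simp add: N_def[abs_def])
qed

end

section \<open>Duality between Hoelder and Besov spaces\<close>

text \<open>
  The pairing of \<open>a \<in> C\<^sup>\<beta>\<close> with \<open>\<partial>g\<close>, \<open>g \<in> B\<^sup>1\<^sup>-\<^sup>\<beta>\<^sub>1\<^sub>,\<^sub>1\<close>, is the limit of \<open>D(\<epsilon>) = \<integral> a \<delta>\<^sub>\<epsilon>g / \<epsilon>\<close>, and
  \<open>D(\<epsilon>) - D(2 \<epsilon>) = \<integral> (a - a(\<cdot> - \<epsilon>)) \<delta>\<^sub>\<epsilon>g / (2 \<epsilon>)\<close>. Summing over \<open>\<epsilon> = r / 2\<^sup>n\<close> and averaging over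
  \<open>1/2 < r < 1\<close> produces the difference norm of \<open>g\<close>.
\<close>

lemma difference_quotient_halving:
  assumes a [measurable]: "a \<in> borel_measurable borel" and aB: "\<And>x. \<bar>a x\<bar> \<le> A" and aper: "\<And>x. a (x + 1) = a x"
    and ah: "\<And>x y. \<bar>a x - a y\<bar> \<le> A * \<bar>x - y\<bar> powr \<beta>"
    and g: "lip_circ L g" and e: "0 < \<epsilon>"
  shows "\<bar>(\<integral>x. a x * (diff_op \<epsilon> g x / \<epsilon>) \<partial>circ) - (\<integral>x. a x * (diff_op (2 * \<epsilon>) g x / (2 * \<epsilon>)) \<partial>circ)\<bar>
    \<le> A / 2 * \<epsilon> powr (\<beta> - 1) * (\<integral>x. \<bar>diff_op \<epsilon> g x\<bar> \<partial>circ)"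
proof -
  have [measurable]: "g \<in> borel_measurable borel" by (rule lip_circ_measurable[OF g])
  have A: "0 \<le> A" using aB[of 0] by linarith
  let ?d = "diff_op \<epsilon> g"
  have d: "lip_circ (L + L) ?d" by (rule lip_circ_diff_op[OF g])
  have [measurable]: "?d \<in> borel_measurable borel" by (rule lip_circ_measurable[OF d])
  have db: "\<bar>?d x\<bar> \<le> L * \<epsilon>" for x using lip_circD[OF g, of "x + \<epsilon>" x] e by (simp add: diff_op_def)
  have b: "\<bar>a x * ?d y\<bar> \<le> A * (L * \<epsilon>)" for x y
    unfolding abs_mult using aB db A by (intro mult_mono) auto
  have i: "integrable circ (\<lambda>x. a (x + p) * ?d (x + q))" for p q
    by (rule integrable_circ_bounded[where B = "A * (L * \<epsilon>)"]) (use b in auto)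
  have id: "integrable circ (\<lambda>x. \<bar>?d x\<bar>)"
    by (rule integrable_circ_bounded[where B = "L * \<epsilon>"]) (use db in auto)
  \<comment> \<open>Passing the shift from the increment to \<open>a\<close> converts a second
    difference of \<open>g\<close> into a product of first differences, which is where the Hoelder
    bound acts.\<close>
  have shift: "(\<integral>x. a x * ?d (x + \<epsilon>) \<partial>circ) = (\<integral>x. a (x - \<epsilon>) * ?d x \<partial>circ)"
  proof -
    have "a (x + 1 - \<epsilon>) = a (x - \<epsilon>)" for x using aper[of "x - \<epsilon>"] by (simp add: algebra_simps)
    then show ?thesis
      using integral_circ_shift[of "\<lambda>x. a (x - \<epsilon>) * ?d x" \<epsilon>] by (simp add: lip_circ_periodic[OF d])
  qed
  have "diff_op (2 * \<epsilon>) g x = ?d x + ?d (x + \<epsilon>)" for x by (simp add: diff_op_def algebra_simps)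
  then have "(\<integral>x. a x * diff_op (2 * \<epsilon>) g x \<partial>circ) = (\<integral>x. a x * ?d x \<partial>circ) + (\<integral>x. a (x - \<epsilon>) * ?d x \<partial>circ)"
    using i[of 0 0] i[of 0 \<epsilon>] by (simp add: distrib_left shift)
  then have "(\<integral>x. a x * (?d x / \<epsilon>) \<partial>circ) - (\<integral>x. a x * (diff_op (2 * \<epsilon>) g x / (2 * \<epsilon>)) \<partial>circ)
      = ((\<integral>x. a x * ?d x \<partial>circ) - (\<integral>x. a (x - \<epsilon>) * ?d x \<partial>circ)) / (2 * \<epsilon>)"
    using e by (simp add: field_simps)
  also have "(\<integral>x. a x * ?d x \<partial>circ) - (\<integral>x. a (x - \<epsilon>) * ?d x \<partial>circ) = (\<integral>x. (a x - a (x - \<epsilon>)) * ?d x \<partial>circ)"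
    using i[of 0 0] i[of "- \<epsilon>" 0] by (simp add: left_diff_distrib)
  finally have eq: "(\<integral>x. a x * (?d x / \<epsilon>) \<partial>circ) - (\<integral>x. a x * (diff_op (2 * \<epsilon>) g x / (2 * \<epsilon>)) \<partial>circ)
      = (\<integral>x. (a x - a (x - \<epsilon>)) * ?d x \<partial>circ) / (2 * \<epsilon>)" .
  have "\<bar>\<integral>x. (a x - a (x - \<epsilon>)) * ?d x \<partial>circ\<bar> \<le> (\<integral>x. \<bar>(a x - a (x - \<epsilon>)) * ?d x\<bar> \<partial>circ)"
    by (rule integral_abs_bound)
  also have "\<dots> \<le> (\<integral>x. A * \<epsilon> powr \<beta> * \<bar>?d x\<bar> \<partial>circ)"
  proof (rule integral_mono)
    have "integrable circ (\<lambda>x. a x * ?d x - a (x - \<epsilon>) * ?d x)"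
      using i[of 0 0] i[of "- \<epsilon>" 0] by simp
    then show "integrable circ (\<lambda>x. \<bar>(a x - a (x - \<epsilon>)) * ?d x\<bar>)"
      by (intro integrable_abs) (simp add: left_diff_distrib)
    show "integrable circ (\<lambda>x. A * \<epsilon> powr \<beta> * \<bar>?d x\<bar>)" using id by simp
    fix x
    show "\<bar>(a x - a (x - \<epsilon>)) * ?d x\<bar> \<le> A * \<epsilon> powr \<beta> * \<bar>?d x\<bar>"
      unfolding abs_mult using ah[of x "x - \<epsilon>"] e by (intro mult_right_mono) auto
  qed
  finally have le: "\<bar>\<integral>x. (a x - a (x - \<epsilon>)) * ?d x \<partial>circ\<bar> \<le> A * \<epsilon> powr \<beta> * (\<integral>x. \<bar>?d x\<bar> \<partial>circ)" by simp
  have "\<epsilon> powr \<beta> = \<epsilon> powr (\<beta> - 1) * \<epsilon>" using e by (simp add: powr_diff)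
  with divide_right_mono[OF le, of "2 * \<epsilon>"] e show ?thesis
    unfolding eq by (simp add: abs_divide abs_mult)
qed

lemma Hoelder_Besov_duality:
  assumes \<beta>: "\<beta> < 1" and a [measurable]: "a \<in> borel_measurable borel" and aB: "\<And>x. \<bar>a x\<bar> \<le> A" and aper: "\<And>x. a (x + 1) = a x"
    and ah: "\<And>x y. \<bar>a x - a y\<bar> \<le> A * \<bar>x - y\<bar> powr \<beta>"
    and g: "lip_circ L g"
  shows "ennreal \<bar>Re (\<integral>k. cnj (fc a k) * Dx (fc g) k \<partial>count_space UNIV)\<bar>
    \<le> ennreal (3 * A) * (\<integral>\<^sup>+\<rho>\<in>{0<..<1}. ennreal (\<rho> powr (\<beta> - 2) * (\<integral>x. \<bar>diff_op \<rho> g x\<bar> \<partial>circ)) \<partial>lborel)"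
proof -
  have [measurable]: "g \<in> borel_measurable borel" by (rule lip_circ_measurable[OF g])
  have A: "0 \<le> A" using aB[of 0] by linarith
  have aL: "L2r a" by (rule L2c_bounded[where B = A]) (use aB in auto)
  define lm where "lm = Re (\<integral>k. cnj (fc a k) * Dx (fc g) k \<partial>count_space UNIV)"
  define D where "D \<epsilon> = (\<integral>x. a x * (diff_op \<epsilon> g x / \<epsilon>) \<partial>circ)" for \<epsilon>
  define d where "d \<rho> = (\<integral>x. \<bar>diff_op \<rho> g x\<bar> \<partial>circ)" for \<rho>
  define w where "w \<rho> = ennreal (\<rho> powr (\<beta> - 2) * d \<rho>)" for \<rho>
  have d0: "0 \<le> d \<rho>" for \<rho> by (simp add: d_def)
  have dm [measurable]: "d \<in> borel_measurable borel"
    unfolding d_def circ_eq_seg diff_op_def by (rule borel_measurable_integral_seg) measurable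
  have wm [measurable]: "w \<in> borel_measurable borel" unfolding w_def by measurable
  define I where "I = (\<integral>\<^sup>+\<rho>\<in>{0<..<1}. w \<rho> \<partial>lborel)"
  \<comment> \<open>The telescoped sum for one \<open>r\<close>. The coarsest scale
    \<open>e 0 = r\<close> has no partner and is estimated directly by
    \<open>A * w r\<close>.\<close>
  have pw: "ennreal \<bar>lm\<bar> \<le> ennreal A * w r + (\<Sum>j. ennreal (A / 2) * (ennreal (1 / 2 ^ Suc j) * w (r / 2 ^ Suc j)))"
    if r: "1 / 2 < r" "r < 1" for r
  proof -
    define e where "e n = r / 2 ^ n" for n
    have e: "0 < e n" "e n \<noteq> 0" for n using r by (auto simp: e_def)
    have "(\<lambda>n. r * (1 / 2) ^ n) \<longlonglongrightarrow> r * 0"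
      by (intro tendsto_intros LIMSEQ_power_zero) simp
    then have e0: "e \<longlonglongrightarrow> 0" by (simp add: e_def[abs_def] power_one_over)
    have lim: "(\<lambda>n. D (e n)) \<longlonglongrightarrow> lm"
      unfolding D_def lm_def by (rule weak_derivative_limit[OF aL g e(2) e0])
    define t where "t j = A / 2 * e (Suc j) powr (\<beta> - 1) * d (e (Suc j))" for j
    have t0: "0 \<le> t j" for j using A d0 by (simp add: t_def)
    have "\<bar>D (e n)\<bar> \<le> \<bar>D r\<bar> + (\<Sum>j<n. t j)" for n
    proof (induction n)
      case (Suc n)
      have "e n = 2 * e (Suc n)" by (simp add: e_def)
      then have "\<bar>D (e (Suc n)) - D (e n)\<bar> \<le> t n"
        using difference_quotient_halving[OF a aB aper ah g e(1)[of "Suc n"]] by (simp add: D_def t_def d_def)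
      then show ?case using Suc by simp
    qed (simp add: e_def)
    then have "ennreal \<bar>D (e n)\<bar> \<le> ennreal \<bar>D r\<bar> + (\<Sum>j. ennreal (t j))" for n
    proof -
      have "ennreal \<bar>D (e n)\<bar> \<le> ennreal (\<bar>D r\<bar> + (\<Sum>j<n. t j))"
        using \<open>\<bar>D (e n)\<bar> \<le> \<bar>D r\<bar> + (\<Sum>j<n. t j)\<close> by (rule ennreal_leI)
      also have "\<dots> = ennreal \<bar>D r\<bar> + (\<Sum>j<n. ennreal (t j))"
        using t0 by (simp add: sum_nonneg sum_ennreal)
      also have "(\<Sum>j<n. ennreal (t j)) \<le> (\<Sum>j. ennreal (t j))"
        by (rule sum_le_suminf) (auto intro: summableI)
      finally show ?thesis by (simp add: add_left_mono)
    qed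
    moreover have "(\<lambda>n. ennreal \<bar>D (e n)\<bar>) \<longlonglongrightarrow> ennreal \<bar>lm\<bar>"
      by (intro tendsto_ennrealI tendsto_rabs lim)
    ultimately have "ennreal \<bar>lm\<bar> \<le> ennreal \<bar>D r\<bar> + (\<Sum>j. ennreal (t j))"
      using LIMSEQ_le_const2 by blast
    also have "ennreal \<bar>D r\<bar> \<le> ennreal A * w r"
    proof -
      have "\<bar>D r\<bar> \<le> (\<integral>x. \<bar>a x * (diff_op r g x / r)\<bar> \<partial>circ)"
        unfolding D_def by (rule integral_abs_bound)
      also have "\<dots> \<le> (\<integral>x. A / r * \<bar>diff_op r g x\<bar> \<partial>circ)"
      proof (rule integral_mono)
        have db: "\<bar>diff_op r g x\<bar> \<le> L * r" for x using lip_circD[OF g, of "x + r" x] r by (simp add: diff_op_def)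
        have [measurable]: "diff_op r g \<in> borel_measurable borel" unfolding diff_op_def by measurable
        show i: "integrable circ (\<lambda>x. A / r * \<bar>diff_op r g x\<bar>)"
          by (intro integrable_mult_right integrable_circ_bounded[where B = "L * r"]) (use db in auto)
        show le: "\<bar>a x * (diff_op r g x / r)\<bar> \<le> A / r * \<bar>diff_op r g x\<bar>" for x
          using mult_right_mono[OF aB[of x], of "\<bar>diff_op r g x\<bar> / r"] r by (simp add: abs_mult abs_divide)
        show "integrable circ (\<lambda>x. \<bar>a x * (diff_op r g x / r)\<bar>)"
        proof (rule Bochner_Integration.integrable_bound[OF i])
          show "AE x in circ. norm \<bar>a x * (diff_op r g x / r)\<bar> \<le> norm (A / r * \<bar>diff_op r g x\<bar>)"
            using order_trans[OF le abs_ge_self] by (intro AE_I2) (simp only: real_norm_def abs_idempotent)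
        qed simp
      qed
      also have "\<dots> = A * (1 / r * d r)" by (simp add: d_def)
      also have "\<dots> \<le> A * (r powr (\<beta> - 2) * d r)"
      proof (intro mult_left_mono mult_right_mono d0 A)
        have "r powr (- 1) \<le> r powr (\<beta> - 2)" using r \<beta> by (intro powr_mono') auto
        then show "1 / r \<le> r powr (\<beta> - 2)" using r powr_minus_divide[of r 1] by simp
      qed
      finally show ?thesis using A d0 by (simp add: w_def ennreal_leI flip: ennreal_mult)
    qed
    also have "(\<Sum>j. ennreal (t j)) \<le> (\<Sum>j. ennreal (A / 2) * (ennreal (1 / 2 ^ Suc j) * w (r / 2 ^ Suc j)))"
    proof (intro suminf_le summableI)
      fix j
      \<comment> \<open>One factor \<open>e (Suc j)\<close> is at most \<open>1 / 2 ^ Suc j\<close>,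
        the Jacobian of the dyadic substitution; what remains is the Besov weight
        \<open>\<beta> - 2\<close>.\<close>
      have "e (Suc j) powr (\<beta> - 1) = e (Suc j) * e (Suc j) powr (\<beta> - 2)"
        using e(1)[of "Suc j"] by (simp add: powr_diff power2_eq_square)
      also have "\<dots> \<le> 1 / 2 ^ Suc j * e (Suc j) powr (\<beta> - 2)"
        using r by (intro mult_right_mono) (auto simp: e_def divide_right_mono)
      finally have "t j \<le> A / 2 * (1 / 2 ^ Suc j * e (Suc j) powr (\<beta> - 2)) * d (e (Suc j))"
        unfolding t_def using A d0 by (intro mult_right_mono mult_left_mono) auto
      also have "\<dots> = A / 2 * (1 / 2 ^ Suc j * (e (Suc j) powr (\<beta> - 2) * d (e (Suc j))))" by simp
      finally have "ennreal (t j) \<le> ennreal (A / 2 * (1 / 2 ^ Suc j * (e (Suc j) powr (\<beta> - 2) * d (e (Suc j)))))"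
        by (rule ennreal_leI)
      also have "\<dots> = ennreal (A / 2) * (ennreal (1 / 2 ^ Suc j) * w (r / 2 ^ Suc j))"
        using A d0[of "e (Suc j)"]
        by (subst ennreal_mult, simp, simp, subst ennreal_mult, simp, simp, simp only: w_def e_def)
      finally show "ennreal (t j) \<le> ennreal (A / 2) * (ennreal (1 / 2 ^ Suc j) * w (r / 2 ^ Suc j))" .
    qed
    finally show ?thesis by (simp add: add_mono)
  qed
  \<comment> \<open>Division by \<open>2 ^ Suc j\<close> maps \<open>{1/2<..<1}\<close> onto
    \<open>J (Suc j)\<close>. These intervals are disjoint, so the sum over the scales is one
    integral, bounded by \<open>I\<close>.\<close>
  define J where "J j = {1 / 2 ^ Suc j<..<1 / (2 :: real) ^ j}" for j :: nat
  have scale: "(\<integral>\<^sup>+r\<in>{1/2<..<1}. ennreal (1 / 2 ^ Suc j) * w (r / 2 ^ Suc j) \<partial>lborel) = (\<integral>\<^sup>+\<rho>\<in>J (Suc j). w \<rho> \<partial>lborel)" for j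
  proof -
    let ?c = "2 ^ Suc j :: real"
    have "(\<integral>\<^sup>+\<rho>\<in>J (Suc j). w \<rho> \<partial>lborel) = ennreal (1 / ?c) * (\<integral>\<^sup>+r. w (0 + 1 / ?c * r) * indicator (J (Suc j)) (0 + 1 / ?c * r) \<partial>lborel)"
      by (subst nn_integral_real_affine[where c = "1 / ?c" and t = 0]) (auto simp: J_def)
    also have "\<dots> = (\<integral>\<^sup>+r. ennreal (1 / ?c) * (w (0 + 1 / ?c * r) * indicator (J (Suc j)) (0 + 1 / ?c * r)) \<partial>lborel)"
      by (rule nn_integral_cmult[symmetric]) (simp add: J_def)
    also have "\<dots> = (\<integral>\<^sup>+r\<in>{1/2<..<1}. ennreal (1 / ?c) * w (r / ?c) \<partial>lborel)"
    proof (intro nn_integral_cong)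
      fix r :: real
      have "0 + 1 / ?c * r \<in> J (Suc j) \<longleftrightarrow> r \<in> {1/2<..<1}"
        unfolding J_def by (simp add: field_simps)
      then show "ennreal (1 / ?c) * (w (0 + 1 / ?c * r) * indicator (J (Suc j)) (0 + 1 / ?c * r)) = ennreal (1 / ?c) * w (r / ?c) * indicator {1/2<..<1} r"
        by (simp add: indicator_def)
    qed
    finally show ?thesis by simp
  qed
  have J0: "J j \<subseteq> {0<..<1}" for j
  proof
    fix x assume "x \<in> J j"
    then have "1 / 2 ^ Suc j < x" "x < 1 / 2 ^ j" by (auto simp: J_def)
    moreover have "(0 :: real) < 1 / 2 ^ Suc j" "1 / (2 :: real) ^ j \<le> 1" by simp_all
    ultimately show "x \<in> {0<..<1}" unfolding greaterThanLessThan_iff by linarith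
  qed
  have disj: "disjoint_family J"
  proof -
    have "J i \<inter> J j = {}" if "i < j" for i j
    proof -
      have "(2 :: real) ^ Suc i \<le> 2 ^ j" using that by (intro power_increasing) auto
      then have "1 / (2 :: real) ^ j \<le> 1 / 2 ^ Suc i" by (intro divide_left_mono) auto
      then show ?thesis unfolding J_def by auto
    qed
    then show ?thesis unfolding disjoint_family_on_def by (metis Int_commute linorder_neqE_nat)
  qed
  \<comment> \<open>The range of \<open>r\<close> has length \<open>1 / 2\<close>. The right side
    amounts to \<open>A + A / 2\<close> times \<open>I\<close>, and doubling gives the constant
    \<open>3 * A\<close>.\<close>
  have "ennreal \<bar>lm\<bar> * ennreal (1 / 2) = (\<integral>\<^sup>+r\<in>{1/2<..<1::real}. ennreal \<bar>lm\<bar> \<partial>lborel)"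
    by (simp add: nn_integral_cmult_indicator)
  also have "\<dots> \<le> (\<integral>\<^sup>+r. ennreal A * (w r * indicator {1/2<..<1} r)
       + (\<Sum>j. ennreal (A / 2) * (ennreal (1 / 2 ^ Suc j) * w (r / 2 ^ Suc j) * indicator {1/2<..<1} r)) \<partial>lborel)"
  proof (intro nn_integral_mono)
    fix r :: real
    show "ennreal \<bar>lm\<bar> * indicator {1/2<..<1} r \<le> ennreal A * (w r * indicator {1/2<..<1} r)
       + (\<Sum>j. ennreal (A / 2) * (ennreal (1 / 2 ^ Suc j) * w (r / 2 ^ Suc j) * indicator {1/2<..<1} r))"
      using pw[of r] by (cases "r \<in> {1/2<..<1}") auto
  qed
  also have "\<dots> = ennreal A * (\<integral>\<^sup>+r\<in>{1/2<..<1}. w r \<partial>lborel)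
       + (\<Sum>j. ennreal (A / 2) * (\<integral>\<^sup>+r\<in>{1/2<..<1}. ennreal (1 / 2 ^ Suc j) * w (r / 2 ^ Suc j) \<partial>lborel))"
  proof -
    let ?s = "\<lambda>j r. ennreal (A / 2) * (ennreal (1 / 2 ^ Suc j) * w (r / 2 ^ Suc j) * indicator {1/2<..<1} r)"
    have m: "?s j \<in> borel_measurable lborel" for j by simp
    have "(\<integral>\<^sup>+r. ?s j r \<partial>lborel) = ennreal (A / 2) * (\<integral>\<^sup>+r\<in>{1/2<..<1}. ennreal (1 / 2 ^ Suc j) * w (r / 2 ^ Suc j) \<partial>lborel)" for j
      by (rule nn_integral_cmult) simp
    moreover have "(\<integral>\<^sup>+r. (\<Sum>j. ?s j r) \<partial>lborel) = (\<Sum>j. \<integral>\<^sup>+r. ?s j r \<partial>lborel)"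
      by (rule nn_integral_suminf, rule m)
    moreover have "(\<integral>\<^sup>+r. ennreal A * (w r * indicator {1/2<..<1} r) + (\<Sum>j. ?s j r) \<partial>lborel)
      = (\<integral>\<^sup>+r. ennreal A * (w r * indicator {1/2<..<1} r) \<partial>lborel) + (\<integral>\<^sup>+r. (\<Sum>j. ?s j r) \<partial>lborel)"
      by (rule nn_integral_add) measurable
    moreover have "(\<integral>\<^sup>+r. ennreal A * (w r * indicator {1/2<..<1} r) \<partial>lborel) = ennreal A * (\<integral>\<^sup>+r\<in>{1/2<..<1}. w r \<partial>lborel)"
      by (rule nn_integral_cmult) simp
    ultimately show ?thesis by simp
  qed
  also have "(\<integral>\<^sup>+r\<in>{1/2<..<1}. w r \<partial>lborel) \<le> I"
    unfolding I_def by (intro nn_integral_mono) (auto simp: indicator_def)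
  also have "(\<Sum>j. ennreal (A / 2) * (\<integral>\<^sup>+r\<in>{1/2<..<1}. ennreal (1 / 2 ^ Suc j) * w (r / 2 ^ Suc j) \<partial>lborel))
      = ennreal (A / 2) * (\<Sum>j. \<integral>\<^sup>+\<rho>\<in>J (Suc j). w \<rho> \<partial>lborel)"
    unfolding scale by (rule ennreal_suminf_cmult)
  also have "(\<Sum>j. \<integral>\<^sup>+\<rho>\<in>J (Suc j). w \<rho> \<partial>lborel) = (\<integral>\<^sup>+\<rho>\<in>(\<Union>j. J (Suc j)). w \<rho> \<partial>lborel)"
  proof -
    have "disjoint_family (\<lambda>j. J (Suc j))" using disj by (auto simp: disjoint_family_on_def)
    then show ?thesis by (intro nn_integral_disjoint_family[symmetric]) (auto simp: J_def)
  qed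
  also have "\<dots> \<le> I"
    unfolding I_def
  proof (intro nn_integral_mono mult_left_mono)
    have "(\<Union>j. J (Suc j)) \<subseteq> {0<..<1}" using J0 by blast
    then show "indicator (\<Union>j. J (Suc j)) \<rho> \<le> (indicator {0<..<1} \<rho> :: ennreal)" for \<rho>
      by (cases "\<rho> \<in> (\<Union>j. J (Suc j))") (simp_all only: indicator_simps subsetD order_refl, simp_all)
  qed simp
  finally have "ennreal \<bar>lm\<bar> * ennreal (1 / 2) \<le> ennreal A * I + ennreal (A / 2) * I"
    by (simp add: add_mono mult_left_mono)
  then have "2 * (ennreal \<bar>lm\<bar> * ennreal (1 / 2)) \<le> 2 * (ennreal A * I + ennreal (A / 2) * I)"
    by (rule mult_left_mono) simp
  also have "\<dots> = ennreal (3 * A) * I"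
  proof -
    have "ennreal (3 * A) = 2 * (ennreal A + ennreal (A / 2))"
      using A ennreal_mult'[of 2 "A + A / 2"] by (simp flip: ennreal_plus)
    then show ?thesis by (simp add: distrib_right mult.assoc)
  qed
  also have "2 * (ennreal \<bar>lm\<bar> * ennreal (1 / 2)) = ennreal \<bar>lm\<bar>"
  proof -
    have "ennreal \<bar>lm\<bar> * ennreal (1 / 2) = ennreal (\<bar>lm\<bar> / 2)"
      by (subst ennreal_mult[symmetric]) auto
    then show ?thesis using ennreal_mult'[of 2 "\<bar>lm\<bar> / 2"] by (simp only:) simp
  qed
  finally show ?thesis by (simp add: lm_def I_def w_def d_def)
qed

section \<open>The estimate\<close>

text \<open>The equation is paired with \<open>psi m h\<close> on the frequency side. The pairing
  with \<open>c\<close>, the time derivative, keeps its sign because only its integral over time is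
  small; \<open>ennreal\<close> on the left cuts off negative values. \<open>Ac\<close> is an
  abstract sequence, known through the equation and one norm bound.\<close>

lemma fixed_time_estimate:
  fixes \<gamma> \<beta> M A a0 h B L L' :: real
  assumes \<gamma>: "0 < \<gamma>" "\<gamma> \<le> 2" and \<beta>: "\<beta> < 1" and M: "0 \<le> M" and h: "0 < h"
    and m: "lip_circ L m" and N: "lip_circ L' (\<lambda>x. m x ^ 3)" and mB: "\<And>x. \<bar>m x\<bar> \<le> B"
    and a [measurable]: "a \<in> borel_measurable borel" and aB: "\<And>x. \<bar>a x\<bar> \<le> A" and aper: "\<And>x. a (x + 1) = a x"
    and ah: "\<And>x y. \<bar>a x - a y\<bar> \<le> A * \<bar>x - y\<bar> powr \<beta>" and alow: "\<And>x. a0 \<le> a x"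
    and G: "L2r G" and c: "L2r c"
    and eq: "\<And>k. fc c k + Ac k = Dx (fc (\<lambda>y. a y * (m y)\<^sup>2 + G y)) k"
    and op: "H_norm (- \<gamma> / 2) Ac \<le> ennreal M * H_norm (\<gamma> / 2) (fc m)"
  shows "ennreal (a0 / 3 * (\<integral>x. \<bar>diff_op h m x\<bar> ^ 3 \<partial>circ) - (\<integral>x. c x * psi m h x \<partial>circ))
    \<le> ennreal (A * h powr \<beta>) * ennreal (\<integral>x. \<bar>diff_op h (\<lambda>x. m x ^ 3) x\<bar> \<partial>circ)
      + (ennreal (4 * h) * (ennreal A * (\<integral>\<^sup>+\<rho>\<in>{0<..<1}. ennreal (\<rho> powr (\<beta> - 2) * (\<integral>x. \<bar>diff_op \<rho> (\<lambda>x. m x ^ 3) x\<bar> \<partial>circ)) \<partial>lborel))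
      + ennreal h * (ennreal (M\<^sup>2 + 64) * (H_norm (\<gamma> / 2) (fc m))\<^sup>2 + (H_norm (1 - \<gamma> / 2) (fc G))\<^sup>2))"
proof -
  let ?N = "\<lambda>x. m x ^ 3"
  define p where "p = psi m h"
  define pN where "pN = psi ?N h"
  have p: "lip_circ (4 * h * L) p" unfolding p_def by (rule psi_lip_circ[OF m h])
  have pN: "lip_circ (4 * h * L') pN" unfolding pN_def by (rule psi_lip_circ[OF N h])
  have [measurable]: "m \<in> borel_measurable borel" by (rule lip_circ_measurable[OF m])
  have A: "0 \<le> A" using aB[of 0] by linarith
  define F where "F x = a x * (m x)\<^sup>2" for x
  have FL: "L2r F"
  proof (rule L2c_bounded)
    show "cmod (complex_of_real (F x)) \<le> A * B\<^sup>2" for x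
    proof -
      have "(m x)\<^sup>2 \<le> B\<^sup>2" using power_mono[OF mB[of x], of 2] by simp
      then have "\<bar>a x\<bar> * (m x)\<^sup>2 \<le> A * B\<^sup>2" using aB[of x] A by (intro mult_mono) auto
      then show ?thesis by (simp add: F_def norm_mult norm_power)
    qed
  qed (simp add: F_def)
  have fFG: "fc (\<lambda>y. a y * (m y)\<^sup>2 + G y) k = fc F k + fc G k" for k
  proof -
    have "fc (\<lambda>y. a y * (m y)\<^sup>2 + G y) k = cfc (\<lambda>y. of_real (F y) - (-1) * of_real (G y)) k"
      by (simp add: fc_eq_cfc F_def)
    also have "\<dots> = cfc (\<lambda>y. of_real (F y)) k - cfc (\<lambda>y. (-1) * of_real (G y)) k"
      by (rule cfc_diff[OF FL L2c_cmult[OF G]])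
    also have "\<dots> = fc F k + fc G k" unfolding cfc_cmult by (simp add: fc_eq_cfc)
    finally show ?thesis .
  qed
  define sF where "sF = (\<integral>k. cnj (fc F k) * Dx (fc p) k \<partial>count_space UNIV)"
  define sG where "sG = (\<integral>k. cnj (Dx (fc G) k) * fc p k \<partial>count_space UNIV)"
  define sA where "sA = (\<integral>k. cnj (Ac k) * fc p k \<partial>count_space UNIV)"
  have parts: "cnj (Dx (fc K) k) * fc p k = - (cnj (fc K k) * Dx (fc p) k)" for K k
    by (simp add: Dx_def)
  have iF: "integrable (count_space UNIV) (\<lambda>k. cnj (fc F k) * Dx (fc p) k)" by (rule integrable_fc_Dx[OF FL p])
  have iG: "integrable (count_space UNIV) (\<lambda>k. cnj (Dx (fc G) k) * fc p k)"
    unfolding parts using integrable_fc_Dx[OF G p] by simp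
  have ic: "integrable (count_space UNIV) (\<lambda>k. cnj (fc c k) * fc p k)" by (rule Parseval_integrable[OF c p])
  \<comment> \<open>The equation writes the operator pairing as a combination of three summable
    ones, which justifies splitting the sum.\<close>
  have Aeq: "cnj (Ac k) * fc p k = cnj (Dx (fc G) k) * fc p k - cnj (fc F k) * Dx (fc p) k - cnj (fc c k) * fc p k" for k
  proof -
    have Ac: "Ac k = Dx (fc F) k + Dx (fc G) k - fc c k"
      using eq[of k] unfolding Dx_def fFG by (simp add: algebra_simps eq_diff_eq)
    show ?thesis unfolding Ac using parts[of F k] by (simp add: algebra_simps)
  qed
  have "sA = sG - sF - complex_of_real (\<integral>x. c x * p x \<partial>circ)"
    unfolding sA_def sG_def sF_def Aeq Parseval[OF c p] using iF iG ic by simp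
  then have cp: "(\<integral>x. c x * p x \<partial>circ) = Re sG - Re sF - Re sA" by (simp add: complex_eq_iff)
  define sN where "sN = Re (\<integral>k. cnj (fc a k) * Dx (fc pN) k \<partial>count_space UNIV)"
  have sF: "Re sF = sN / 3 - (\<integral>x. a x * flux_density m h x \<partial>circ)"
    unfolding sF_def sN_def p_def pN_def F_def by (rule weak_flux_identity[OF m N h mB a aB])
  define \<delta>N where "\<delta>N = (\<integral>x. \<bar>diff_op h ?N x\<bar> \<partial>circ)"
  have \<delta>N0: "0 \<le> \<delta>N" by (simp add: \<delta>N_def)
  have low: "a0 / 3 * (\<integral>x. \<bar>diff_op h m x\<bar> ^ 3 \<partial>circ) - A * h powr \<beta> * \<delta>N \<le> (\<integral>x. a x * flux_density m h x \<partial>circ)"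
    unfolding \<delta>N_def
  proof (rule flux_lower_bound[OF m N h mB a aB aper alow])
    show "\<bar>a (x + h) - a x\<bar> \<le> A * h powr \<beta>" for x using ah[of "x + h" x] h by simp
  qed
  have "a0 / 3 * (\<integral>x. \<bar>diff_op h m x\<bar> ^ 3 \<partial>circ) - (\<integral>x. c x * p x \<partial>circ)
      \<le> A * h powr \<beta> * \<delta>N + (\<bar>sN\<bar> / 3 + (cmod sG + cmod sA))"
    using low sF cp abs_Re_le_cmod[of sG] abs_Re_le_cmod[of sA] abs_ge_self[of sN] abs_ge_minus_self[of sN] by linarith
  then have "ennreal (a0 / 3 * (\<integral>x. \<bar>diff_op h m x\<bar> ^ 3 \<partial>circ) - (\<integral>x. c x * p x \<partial>circ))
      \<le> ennreal (A * h powr \<beta> * \<delta>N + (\<bar>sN\<bar> / 3 + (cmod sG + cmod sA)))"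
    by (rule ennreal_leI)
  also have "\<dots> = ennreal (A * h powr \<beta>) * ennreal \<delta>N + (ennreal (\<bar>sN\<bar> / 3) + (ennreal (cmod sG) + ennreal (cmod sA)))"
    using A \<delta>N0 by (simp add: ennreal_mult)
  also have "ennreal (\<bar>sN\<bar> / 3) \<le> ennreal (4 * h) * (ennreal A * (\<integral>\<^sup>+\<rho>\<in>{0<..<1}. ennreal (\<rho> powr (\<beta> - 2) * (\<integral>x. \<bar>diff_op \<rho> ?N x\<bar> \<partial>circ)) \<partial>lborel))"
    (is "_ \<le> _ * (_ * ?W)")
  proof -
    have [measurable]: "(\<lambda>\<rho>. \<integral>x. \<bar>diff_op \<rho> ?N x\<bar> \<partial>circ) \<in> borel_measurable borel"
      unfolding circ_eq_seg diff_op_def by (rule borel_measurable_integral_seg) measurable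
    have "ennreal \<bar>sN\<bar> \<le> ennreal (3 * A) * (\<integral>\<^sup>+\<rho>\<in>{0<..<1}. ennreal (\<rho> powr (\<beta> - 2) * (\<integral>x. \<bar>diff_op \<rho> pN x\<bar> \<partial>circ)) \<partial>lborel)"
      unfolding sN_def by (rule Hoelder_Besov_duality[OF \<beta> a aB aper ah pN])
    also have "\<dots> \<le> ennreal (3 * A) * (\<integral>\<^sup>+\<rho>. ennreal (4 * h) * (ennreal (\<rho> powr (\<beta> - 2) * (\<integral>x. \<bar>diff_op \<rho> ?N x\<bar> \<partial>circ)) * indicator {0<..<1} \<rho>) \<partial>lborel)"
    proof (intro mult_left_mono nn_integral_mono)
      fix \<rho> :: real
      have "\<rho> powr (\<beta> - 2) * (\<integral>x. \<bar>diff_op \<rho> pN x\<bar> \<partial>circ) \<le> \<rho> powr (\<beta> - 2) * (4 * h * (\<integral>x. \<bar>diff_op \<rho> ?N x\<bar> \<partial>circ))"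
        unfolding pN_def by (intro mult_left_mono psi_L1_difference[OF N h]) simp
      then have "ennreal (\<rho> powr (\<beta> - 2) * (\<integral>x. \<bar>diff_op \<rho> pN x\<bar> \<partial>circ)) \<le> ennreal (4 * h * (\<rho> powr (\<beta> - 2) * (\<integral>x. \<bar>diff_op \<rho> ?N x\<bar> \<partial>circ)))"
        by (intro ennreal_leI) (simp add: mult_ac)
      also have "\<dots> = ennreal (4 * h) * ennreal (\<rho> powr (\<beta> - 2) * (\<integral>x. \<bar>diff_op \<rho> ?N x\<bar> \<partial>circ))"
        using h by (intro ennreal_mult) auto
      finally show "ennreal (\<rho> powr (\<beta> - 2) * (\<integral>x. \<bar>diff_op \<rho> pN x\<bar> \<partial>circ)) * indicator {0<..<1} \<rho>
          \<le> ennreal (4 * h) * (ennreal (\<rho> powr (\<beta> - 2) * (\<integral>x. \<bar>diff_op \<rho> ?N x\<bar> \<partial>circ)) * indicator {0<..<1} \<rho>)"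
        by (simp add: indicator_def)
    qed simp
    also have "\<dots> = ennreal (3 * A) * (ennreal (4 * h) * ?W)"
      by (subst nn_integral_cmult) auto
    finally have "ennreal (1 / 3) * ennreal \<bar>sN\<bar> \<le> ennreal (1 / 3) * (ennreal (3 * A) * (ennreal (4 * h) * ?W))"
      by (rule mult_left_mono) simp
    also have "\<dots> = (ennreal (1 / 3) * ennreal (3 * A)) * (ennreal (4 * h) * ?W)" by (simp only: mult.assoc)
    \<comment> \<open>The factor 3 of the duality estimate is cancelled by the \<open>1 / 3\<close>
      that accompanies the cube.\<close>
    also have "ennreal (1 / 3) * ennreal (3 * A) = ennreal A"
      using A by (subst ennreal_mult[symmetric]) auto
    also have "ennreal (1 / 3) * ennreal \<bar>sN\<bar> = ennreal (\<bar>sN\<bar> / 3)"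
      by (subst ennreal_mult[symmetric]) auto
    finally show ?thesis by (simp only: mult.left_commute)
  qed
  also have "ennreal (cmod sG) + ennreal (cmod sA) \<le> ennreal h * (ennreal (M\<^sup>2 + 64) * (H_norm (\<gamma> / 2) (fc m))\<^sup>2 + (H_norm (1 - \<gamma> / 2) (fc G))\<^sup>2)"
  proof -
    let ?Hm = "(H_norm (\<gamma> / 2) (fc m))\<^sup>2" and ?HG = "(H_norm (1 - \<gamma> / 2) (fc G))\<^sup>2"
    \<comment> \<open>\<open>32\<close> is \<open>2 * 4^2\<close>: the 4 is the total weight of
      \<open>psi_majorant\<close>, the 2 stems from the inhomogeneous norm, and
      \<open>h^2 / h\<close> leaves one power of \<open>h\<close>. The bound is spent on
      \<open>G\<close> and on the operator, hence 64 in the claim.\<close>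
    have Hp: "ennreal (1 / h) * (H_norm (\<gamma> / 2) (fc p))\<^sup>2 \<le> ennreal h * (ennreal 32 * ?Hm)"
    proof -
      have "(H_norm (\<gamma> / 2) (fc p))\<^sup>2 \<le> ennreal (2 * (4 * h)\<^sup>2) * ?Hm"
        unfolding p_def
        by (rule H_norm_contraction[OF \<gamma> psi_lip_circ[OF m h] m fc_psi_0[OF m h] psi_L2_difference[OF m h]])
      then have "ennreal (1 / h) * (H_norm (\<gamma> / 2) (fc p))\<^sup>2 \<le> ennreal (1 / h) * (ennreal (2 * (4 * h)\<^sup>2) * ?Hm)"
        by (rule mult_left_mono) simp
      also have "\<dots> = (ennreal (1 / h) * ennreal (2 * (4 * h)\<^sup>2)) * ?Hm" by (simp only: mult.assoc)
      also have "ennreal (1 / h) * ennreal (2 * (4 * h)\<^sup>2) = ennreal h * ennreal 32"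
        using h by (subst (1 2) ennreal_mult[symmetric]) (auto simp: power2_eq_square)
      finally show ?thesis by (simp only: mult.assoc)
    qed
    have "ennreal (cmod sG) \<le> ennreal h * (H_norm (- (\<gamma> / 2)) (Dx (fc G)))\<^sup>2 + ennreal (1 / h) * (H_norm (\<gamma> / 2) (fc p))\<^sup>2"
      unfolding sG_def by (rule pairing_le[OF h])
    also have "\<dots> \<le> ennreal h * ?HG + ennreal h * (ennreal 32 * ?Hm)"
      using H_norm_Dx_le[of "1 - \<gamma> / 2" "fc G"] by (intro add_mono mult_left_mono Hp) auto
    finally have 1: "ennreal (cmod sG) \<le> ennreal h * ?HG + ennreal h * (ennreal 32 * ?Hm)" .
    have "ennreal (cmod sA) \<le> ennreal h * (H_norm (- (\<gamma> / 2)) Ac)\<^sup>2 + ennreal (1 / h) * (H_norm (\<gamma> / 2) (fc p))\<^sup>2"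
      unfolding sA_def by (rule pairing_le[OF h])
    also have "\<dots> \<le> ennreal h * (ennreal (M\<^sup>2) * ?Hm) + ennreal h * (ennreal 32 * ?Hm)"
    proof (intro add_mono mult_left_mono Hp)
      have "(H_norm (- (\<gamma> / 2)) Ac)\<^sup>2 \<le> (ennreal M * H_norm (\<gamma> / 2) (fc m))\<^sup>2"
        using op by (intro power_mono) auto
      then show "(H_norm (- (\<gamma> / 2)) Ac)\<^sup>2 \<le> ennreal (M\<^sup>2) * ?Hm"
        using M by (simp add: power_mult_distrib ennreal_power)
    qed simp
    finally have 2: "ennreal (cmod sA) \<le> ennreal h * (ennreal (M\<^sup>2) * ?Hm) + ennreal h * (ennreal 32 * ?Hm)" .
    have "ennreal (M\<^sup>2 + 64) = ennreal (M\<^sup>2) + (ennreal 32 + ennreal 32)"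
    proof -
      have "M\<^sup>2 + 64 = M\<^sup>2 + (32 + 32)" by simp
      also have "ennreal \<dots> = ennreal (M\<^sup>2) + ennreal (32 + 32)" by (rule ennreal_plus) simp_all
      also have "ennreal (32 + 32) = ennreal 32 + ennreal 32" by (rule ennreal_plus) simp_all
      finally show ?thesis .
    qed
    then have "ennreal h * (ennreal (M\<^sup>2 + 64) * ?Hm + ?HG)
      = (ennreal h * ?HG + ennreal h * (ennreal 32 * ?Hm)) + (ennreal h * (ennreal (M\<^sup>2) * ?Hm) + ennreal h * (ennreal 32 * ?Hm))"
      by (simp only: distrib_left distrib_right add_ac)
    then show ?thesis using add_mono[OF 1 2] by simp
  qed
  finally show ?thesis by (simp add: p_def \<delta>N_def add_mono)
qed

section \<open>Smooth space-time data and the time integral\<close>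

lemma integral_seg_FTC_within:
  fixes F f :: "real \<Rightarrow> real"
  assumes "a \<le> b" "\<And>x. x \<in> {a..b} \<Longrightarrow> (F has_real_derivative f x) (at x within {a..b})" "continuous_on {a..b} f"
  shows "(\<integral>x. f x \<partial>seg a b) = F b - F a"
proof -
  have "(\<integral>x. f x \<partial>seg a b) = (\<integral>x. indicator {a..b} x *\<^sub>R f x \<partial>lborel)"
    unfolding seg_def by (subst integral_restrict_space) auto
  also have "\<dots> = F b - F a"
    using assms by (intro integral_FTC_Icc) (auto simp: has_real_derivative_iff_has_vector_derivative)
  finally show ?thesis .
qed

lemma periodic_strip_bounded:
  fixes f :: "real \<Rightarrow> real \<Rightarrow> real"
  assumes "continuous_on ({0..T} \<times> UNIV) (\<lambda>(t, y). f t y)" and per: "\<And>t y. t \<in> {0..T} \<Longrightarrow> f t (y + 1) = f t y"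
  obtains B where "0 \<le> B" "\<And>t y. t \<in> {0..T} \<Longrightarrow> \<bar>f t y\<bar> \<le> B"
proof -
  have "compact ((\<lambda>(t, y). f t y) ` ({0..T} \<times> {0..1}))"
    by (intro compact_continuous_image continuous_on_subset[OF assms(1)] compact_Times) auto
  then obtain B where B: "\<And>p. p \<in> {0..T} \<times> {0..1} \<Longrightarrow> \<bar>(\<lambda>(t, y). f t y) p\<bar> \<le> B"
    using compact_imp_bounded[THEN bounded_imp_bdd_above] unfolding bounded_iff
    by (metis (no_types, lifting) bounded_iff compact_imp_bounded image_eqI real_norm_def)
  show ?thesis
  proof (rule that)
    show "0 \<le> max B 0" by simp
    fix t y assume t: "t \<in> {0..T}"
    have "f t y = f t (frac y)" using periodic_frac[of "f t" y] per[OF t] by simp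
    moreover have "frac y \<in> {0..1}" using frac_ge_0[of y] frac_lt_1[of y] by auto
    ultimately show "\<bar>f t y\<bar> \<le> max B 0" using B[of "(t, frac y)"] t by auto
  qed
qed

lemma continuous_on_pair_measurable:
  fixes f :: "real \<Rightarrow> real \<Rightarrow> real"
  assumes "continuous_on UNIV (\<lambda>(t, y). f t y)"
  shows "(\<lambda>(t, y). f t y) \<in> borel_measurable (borel \<Otimes>\<^sub>M borel)"
  unfolding borel_prod by (rule borel_measurable_continuous_onI[OF assms])

text \<open>Freezing the data outside \<open>{0..T}\<close> makes \<open>\<mu>\<close> and
  \<open>c\<close> continuous on the whole plane, hence jointly Borel measurable, with bounds valid
  at every real time. The uniform constants come from compactness of one period of the
  strip.\<close>

lemma smooth_spacetime_extension:
  assumes T: "0 < T" and sm: "smooth_spacetime T m"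
  obtains \<mu> c :: "real \<Rightarrow> real \<Rightarrow> real" and L B :: real where
    "\<And>t. t \<in> {0..T} \<Longrightarrow> \<mu> t = m t"
    "continuous_on UNIV (\<lambda>(t, y). \<mu> t y)" "continuous_on UNIV (\<lambda>(t, y). c t y)"
    "\<And>t. lip_circ L (\<mu> t)" "\<And>t y. \<bar>\<mu> t y\<bar> \<le> B" "\<And>t y. \<bar>c t y\<bar> \<le> B" "\<And>t y. c t (y + 1) = c t y"
    "\<And>t y. t \<in> {0..T} \<Longrightarrow> ((\<lambda>\<tau>. \<mu> \<tau> y) has_real_derivative c t y) (at t within {0..T})"
    "\<And>t. t \<in> {0..T} \<Longrightarrow> smooth_circle (m t)"
    "\<And>t y. t \<in> {0<..<T} \<Longrightarrow> deriv (\<lambda>\<tau>. m \<tau> y) t = c t y"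
proof -
  from sm obtain D :: "nat \<Rightarrow> nat \<Rightarrow> real \<Rightarrow> real \<Rightarrow> real" where
      mper: "\<And>t. t \<in> {0..T} \<Longrightarrow> periodic1 (m t)"
    and D0: "\<And>t y. t \<in> {0..T} \<Longrightarrow> D 0 0 t y = m t y"
    and Dc: "\<And>i j. continuous_on ({0..T} \<times> UNIV) (\<lambda>(t, y). D i j t y)"
    and Dt: "\<And>i j t y. t \<in> {0..T} \<Longrightarrow> ((\<lambda>\<tau>. D i j \<tau> y) has_real_derivative D (Suc i) j t y) (at t within {0..T})"
    and Dy: "\<And>i j t y. t \<in> {0..T} \<Longrightarrow> (D i j t has_real_derivative D i (Suc j) t y) (at y)"
    unfolding smooth_spacetime_def by blast
  define cl where "cl t = max 0 (min T t)" for t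
  have cl: "cl t \<in> {0..T}" for t using T by (auto simp: cl_def)
  have cl_id: "cl t = t" if "t \<in> {0..T}" for t using that by (auto simp: cl_def)
  have per0: "D 0 0 t (y + 1) = D 0 0 t y" if "t \<in> {0..T}" for t y
    using mper[OF that] that by (simp add: D0 periodic1_def)
  have per01: "D 0 (Suc 0) t (y + 1) = D 0 (Suc 0) t y" if t: "t \<in> {0..T}" for t y
  proof -
    have "((\<lambda>x. D 0 0 t (x + 1)) has_real_derivative D 0 (Suc 0) t (y + 1)) (at y)"
      using Dy[OF t, of 0 0 "y + 1"] by (simp add: DERIV_shift)
    then have "(D 0 0 t has_real_derivative D 0 (Suc 0) t (y + 1)) (at y)"
      using per0[OF t] by simp
    then show ?thesis using Dy[OF t] DERIV_unique by blast
  qed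
  \<comment> \<open>Periodicity passes to the time derivative because derivatives within
    \<open>{0..T}\<close> are unique, also at the end points; this uses
    \<open>0 < T\<close>.\<close>
  have per10: "D (Suc 0) 0 t (y + 1) = D (Suc 0) 0 t y" if t: "t \<in> {0..T}" for t y
  proof -
    have "((\<lambda>\<tau>. D 0 0 \<tau> y) has_real_derivative D (Suc 0) 0 t (y + 1)) (at t within {0..T})"
      using Dt[OF t, of 0 0 "y + 1"] per0 t by (subst has_field_derivative_cong_ev[OF refl _ refl refl, where g = "\<lambda>\<tau>. D 0 0 \<tau> (y + 1)"]) auto
    then show ?thesis
      using Dt[OF t, of 0 0 y] T t
        vector_derivative_unique_within_closed_interval[of 0 T t "\<lambda>\<tau>. D 0 0 \<tau> y" "D (Suc 0) 0 t (y + 1)" "D (Suc 0) 0 t y"]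
      by (simp add: has_real_derivative_iff_has_vector_derivative)
  qed
  obtain B1 where B1: "0 \<le> B1" "\<And>t y. t \<in> {0..T} \<Longrightarrow> \<bar>D 0 0 t y\<bar> \<le> B1"
    using periodic_strip_bounded[OF Dc per0] by blast
  obtain B2 where B2: "0 \<le> B2" "\<And>t y. t \<in> {0..T} \<Longrightarrow> \<bar>D (Suc 0) 0 t y\<bar> \<le> B2"
    using periodic_strip_bounded[OF Dc per10] by blast
  obtain L where L: "0 \<le> L" "\<And>t y. t \<in> {0..T} \<Longrightarrow> \<bar>D 0 (Suc 0) t y\<bar> \<le> L"
    using periodic_strip_bounded[OF Dc per01] by blast
  have cont: "continuous_on UNIV (\<lambda>(t, y). D i j (cl t) y)" for i j
  proof -
    have "continuous_on UNIV (\<lambda>p :: real \<times> real. (cl (fst p), snd p))"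
      unfolding cl_def by (intro continuous_intros)
    then have "continuous_on UNIV (\<lambda>p :: real \<times> real. (\<lambda>(t, y). D i j t y) (cl (fst p), snd p))"
      by (rule continuous_on_compose2[OF Dc]) (use cl in auto)
    then show ?thesis by (simp add: case_prod_beta')
  qed
  show ?thesis
  proof (rule that[of "\<lambda>t. D 0 0 (cl t)" "\<lambda>t. D (Suc 0) 0 (cl t)" L "max B1 B2"])
    show "D 0 0 (cl t) = m t" if "t \<in> {0..T}" for t
      using that by (auto simp: cl_id D0)
    show "lip_circ L (D 0 0 (cl t))" for t
      unfolding lip_circ_def
    proof (intro conjI allI per0 cl)
      fix x y
      have "norm (D 0 0 (cl t) x - D 0 0 (cl t) y) \<le> L * norm (x - y)"
        by (rule field_differentiable_bound[where S = UNIV and f' = "D 0 (Suc 0) (cl t)"])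
           (use Dy[OF cl] L(2)[OF cl] in auto)
      then show "\<bar>D 0 0 (cl t) x - D 0 0 (cl t) y\<bar> \<le> L * \<bar>x - y\<bar>" by simp
    qed
    show "\<bar>D 0 0 (cl t) y\<bar> \<le> max B1 B2" "\<bar>D (Suc 0) 0 (cl t) y\<bar> \<le> max B1 B2" for t y
      using B1(2)[OF cl, of t y] B2(2)[OF cl, of t y] by auto
    show "D (Suc 0) 0 (cl t) (y + 1) = D (Suc 0) 0 (cl t) y" for t y by (rule per10[OF cl])
    show "((\<lambda>\<tau>. D 0 0 (cl \<tau>) y) has_real_derivative D (Suc 0) 0 (cl t) y) (at t within {0..T})" if t: "t \<in> {0..T}" for t y
    proof (rule has_field_derivative_transform_within[OF _ zero_less_one t])
      show "((\<lambda>\<tau>. D 0 0 \<tau> y) has_real_derivative D (Suc 0) 0 (cl t) y) (at t within {0..T})"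
        using Dt[OF t, of 0 0 y] by (simp add: cl_id[OF t])
    qed (simp add: cl_id)
    show "smooth_circle (m t)" if t: "t \<in> {0..T}" for t
      unfolding smooth_circle_def
    proof (intro conjI allI mper[OF t])
      fix n x
      have "(deriv ^^ n) (m t) = D 0 n t"
      proof (induction n)
        case 0
        then show ?case using D0[OF t] by auto
      next
        case (Suc n)
        then show ?case using DERIV_imp_deriv[OF Dy[OF t]] by auto
      qed
      then show "(deriv ^^ n) (m t) field_differentiable at x"
        using Dy[OF t] field_differentiable_def by metis
    qed
    show "deriv (\<lambda>\<tau>. m \<tau> y) t = D (Suc 0) 0 (cl t) y" if t: "t \<in> {0<..<T}" for t y
    proof (rule DERIV_imp_deriv)
      have t': "t \<in> {0..T}" using t by auto
      have "((\<lambda>\<tau>. D 0 0 \<tau> y) has_real_derivative D (Suc 0) 0 t y) (at t)"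
        using Dt[OF t', of 0 0 y] t by (simp add: at_within_Icc_at)
      then show "((\<lambda>\<tau>. m \<tau> y) has_real_derivative D (Suc 0) 0 (cl t) y) (at t)"
        unfolding cl_id[OF t']
      proof (rule has_field_derivative_transform_within_open[where S = "{0<..<T}"])
        show "D 0 0 \<tau> y = m \<tau> y" if "\<tau> \<in> {0<..<T}" for \<tau> using that by (intro D0) auto
      qed (use t in auto)
    qed
  qed (fact cont)+
qed

lemma lip_circ_cube:
  assumes m: "lip_circ L m" and B: "\<And>x. \<bar>m x\<bar> \<le> B"
  shows "lip_circ (3 * B\<^sup>2 * L) (\<lambda>x. m x ^ 3)"
  unfolding lip_circ_def
proof (intro conjI allI)
  fix x y
  have B0: "0 \<le> B" using B[of 0] by linarith
  show "m (x + 1) ^ 3 = m x ^ 3" by (simp add: lip_circ_periodic[OF m])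
  have bound: "p * q \<le> B\<^sup>2" if "\<bar>p\<bar> \<le> B" "\<bar>q\<bar> \<le> B" for p q
  proof -
    have "p * q \<le> \<bar>p\<bar> * \<bar>q\<bar>" by (simp flip: abs_mult)
    also have "\<dots> \<le> B * B" using that B0 by (intro mult_mono) auto
    finally show ?thesis by (simp add: power2_eq_square)
  qed
  have "\<bar>m x ^ 3 - m y ^ 3\<bar> = ((m x)\<^sup>2 + m x * m y + (m y)\<^sup>2) * \<bar>m x - m y\<bar>"
    by (simp add: abs_cube_diff)
  also have "\<dots> \<le> (3 * B\<^sup>2) * (L * \<bar>x - y\<bar>)"
  proof (intro mult_mono lip_circD[OF m])
    show "(m x)\<^sup>2 + m x * m y + (m y)\<^sup>2 \<le> 3 * B\<^sup>2"
      using bound[OF B B, of x x] bound[OF B B, of x y] bound[OF B B, of y y] by (simp add: power2_eq_square)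
  qed auto
  finally show "\<bar>m x ^ 3 - m y ^ 3\<bar> \<le> 3 * B\<^sup>2 * L * \<bar>x - y\<bar>" by simp
qed

text \<open>The primitive of \<open>|x|\<close> is differentiable even at zero. With it,
  \<open>|diff_op z m|\<close> times the time derivative of \<open>diff_op z m\<close> is an exact
  time derivative.\<close>

lemma DERIV_signed_square: "((\<lambda>x. x * \<bar>x\<bar> / 2) has_real_derivative \<bar>x\<bar>) (at (x :: real))"
proof -
  consider "x > 0" | "x < 0" | "x = 0" by linarith
  then show ?thesis
  proof cases
    case 1
    have "((\<lambda>x. x * x / 2) has_real_derivative \<bar>x\<bar>) (at x)"
      using 1 by (auto intro!: derivative_eq_intros)
    then show ?thesis
      by (rule has_field_derivative_transform_within_open[where S = "{0<..}"]) (use 1 in auto)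
  next
    case 2
    have "((\<lambda>x. - (x * x) / 2) has_real_derivative \<bar>x\<bar>) (at x)"
      using 2 by (auto intro!: derivative_eq_intros)
    then show ?thesis
      by (rule has_field_derivative_transform_within_open[where S = "{..<0}"]) (use 2 in auto)
  next
    case 3
    have "(\<lambda>h :: real. (h * \<bar>h\<bar> / 2) / h) \<midarrow>0\<rightarrow> 0"
    proof (rule Lim_null_comparison)
      show "\<forall>\<^sub>F h :: real in at 0. norm (h * \<bar>h\<bar> / 2 / h) \<le> \<bar>h\<bar>"
        by (intro always_eventually allI) (auto simp: abs_mult)
      show "(\<lambda>h :: real. \<bar>h\<bar>) \<midarrow>0\<rightarrow> 0" by (rule tendsto_rabs_zero) (rule tendsto_ident_at)
    qed
    then show ?thesis using 3 by (simp add: DERIV_def)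
  qed
qed

text \<open>Fubini brings the time integral innermost, where it is exact. The boundary terms are
  half squares of increments, each at most a sum of two squares whose means over the circle do not
  depend on \<open>z\<close>; the integration over \<open>z\<close> supplies the factor
  \<open>h\<close>.\<close>

lemma psi_energy_bound:
  assumes T: "0 < T" and h: "0 < h"
    and \<mu>c: "continuous_on UNIV (\<lambda>(t, y). \<mu> t y)" and cc: "continuous_on UNIV (\<lambda>(t, y). c t y)"
    and lip: "\<And>t. lip_circ L (\<mu> t)" and \<mu>B: "\<And>t y. \<bar>\<mu> t y\<bar> \<le> B" and cB: "\<And>t y. \<bar>c t y\<bar> \<le> B"
    and cper: "\<And>t y. c t (y + 1) = c t y"
    and der: "\<And>t y. t \<in> {0..T} \<Longrightarrow> ((\<lambda>\<tau>. \<mu> \<tau> y) has_real_derivative c t y) (at t within {0..T})"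
  shows "\<bar>\<integral>t. (\<integral>x. c t x * psi (\<mu> t) h x \<partial>circ) \<partial>seg 0 T\<bar>
    \<le> 2 * h * ((\<integral>x. (\<mu> 0 x)\<^sup>2 \<partial>circ) + (\<integral>x. (\<mu> T x)\<^sup>2 \<partial>circ))"
proof -
  have [measurable]: "(\<lambda>(t, y). \<mu> t y) \<in> borel_measurable (borel \<Otimes>\<^sub>M borel)"
    "(\<lambda>(t, y). c t y) \<in> borel_measurable (borel \<Otimes>\<^sub>M borel)"
    by (rule continuous_on_pair_measurable, fact)+
  have B: "0 \<le> B" using \<mu>B[of 0 0] by linarith
  define f where "f t x z = \<bar>diff_op z (\<mu> t) x\<bar> * diff_op z (c t) x" for t x z
  define \<Phi> where "\<Phi> t x z = diff_op z (\<mu> t) x * \<bar>diff_op z (\<mu> t) x\<bar> / 2" for t x z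
  have dB: "\<bar>diff_op z (\<mu> t) x\<bar> \<le> 2 * B" "\<bar>diff_op z (c t) x\<bar> \<le> 2 * B" for z t x
    using \<mu>B[of t x] \<mu>B[of t "x + z"] cB[of t x] cB[of t "x + z"] by (simp_all add: diff_op_def)
  have fB: "\<bar>f t x z\<bar> \<le> (2 * B) * (2 * B)" for t x z
    unfolding f_def abs_mult using dB[of z t x] B by (intro mult_mono) auto
  have gB: "\<bar>\<integral>z. f t x z \<partial>seg 0 h\<bar> \<le> (h - 0) * ((2 * B) * (2 * B))" for t x
    using h by (intro integral_seg_le fB) simp
  have fm: "(\<lambda>(p, z). f (fst p) (snd p) z) \<in> borel_measurable ((borel \<Otimes>\<^sub>M borel) \<Otimes>\<^sub>M borel)"
    unfolding f_def diff_op_def by measurable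
  have gm: "(\<lambda>(t, x). \<integral>z. f t x z \<partial>seg 0 h) \<in> borel_measurable (borel \<Otimes>\<^sub>M borel)"
    using borel_measurable_integral_seg[OF fm] by (simp add: case_prod_beta')
  have fm2: "(\<lambda>(t, z). f t x z) \<in> borel_measurable (borel \<Otimes>\<^sub>M borel)" for x
    unfolding f_def diff_op_def by measurable
  have c1: "c t \<in> borel_measurable borel" for t by measurable
  have fc: "continuous_on {0..T} (\<lambda>t. f t x z)" for x z
  proof -
    have "continuous_on {0..T} (\<lambda>t. \<mu> t y)" "continuous_on {0..T} (\<lambda>t. c t y)" for y
    proof -
      have "continuous_on {0..T} (\<lambda>t. (\<lambda>(t, y). \<mu> t y) (t, y))"
        by (rule continuous_on_compose2[OF \<mu>c]) (auto intro!: continuous_intros)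
      then show "continuous_on {0..T} (\<lambda>t. \<mu> t y)" by simp
      have "continuous_on {0..T} (\<lambda>t. (\<lambda>(t, y). c t y) (t, y))"
        by (rule continuous_on_compose2[OF cc]) (auto intro!: continuous_intros)
      then show "continuous_on {0..T} (\<lambda>t. c t y)" by simp
    qed
    then show ?thesis unfolding f_def diff_op_def by (intro continuous_intros)
  qed
  have FTC: "(\<integral>t. f t x z \<partial>seg 0 T) = \<Phi> T x z - \<Phi> 0 x z" for x z
  proof (rule integral_seg_FTC_within[where F = "\<lambda>t. \<Phi> t x z" and f = "\<lambda>t. f t x z"])
    fix t assume t: "t \<in> {0..T}"
    have "((\<lambda>\<tau>. diff_op z (\<mu> \<tau>) x) has_real_derivative diff_op z (c t) x) (at t within {0..T})"
      unfolding diff_op_def by (intro DERIV_diff der t)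
    from DERIV_chain2[OF DERIV_signed_square this]
    show "((\<lambda>t. \<Phi> t x z) has_real_derivative f t x z) (at t within {0..T})"
      by (simp add: \<Phi>_def f_def)
  qed (use T fc in auto)
  have "(\<integral>t. (\<integral>x. c t x * psi (\<mu> t) h x \<partial>circ) \<partial>seg 0 T) = (\<integral>t. (\<integral>x. (\<integral>z. f t x z \<partial>seg 0 h) \<partial>circ) \<partial>seg 0 T)"
    unfolding f_def by (simp add: psi_pairing[OF lip h c1 cper cB])
  also have "\<dots> = (\<integral>x. (\<integral>t. (\<integral>z. f t x z \<partial>seg 0 h) \<partial>seg 0 T) \<partial>circ)"
    unfolding circ_eq_seg by (rule Fubini_seg[OF gm gB])
  also have "\<dots> = (\<integral>x. (\<integral>z. (\<integral>t. f t x z \<partial>seg 0 T) \<partial>seg 0 h) \<partial>circ)"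
    by (intro arg_cong[where f = "\<lambda>F. integral\<^sup>L circ F"] ext Fubini_seg[OF fm2 fB])
  also have "\<dots> = (\<integral>x. (\<integral>z. \<Phi> T x z - \<Phi> 0 x z \<partial>seg 0 h) \<partial>circ)" by (simp only: FTC)
  finally have eq: "(\<integral>t. (\<integral>x. c t x * psi (\<mu> t) h x \<partial>circ) \<partial>seg 0 T) = (\<integral>x. (\<integral>z. \<Phi> T x z - \<Phi> 0 x z \<partial>seg 0 h) \<partial>circ)" .
  define S where "S x z = (\<mu> T x)\<^sup>2 + (\<mu> T (x + z))\<^sup>2 + (\<mu> 0 x)\<^sup>2 + (\<mu> 0 (x + z))\<^sup>2" for x z
  have sq: "(\<mu> t x)\<^sup>2 \<le> B\<^sup>2" for t x using power_mono[OF \<mu>B[of t x], of 2] by simp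
  have S0: "0 \<le> S x z" for x z by (simp add: S_def)
  have SB: "\<bar>S x z\<bar> \<le> 4 * B\<^sup>2" for x z
    using sq[of T x] sq[of T "x + z"] sq[of 0 x] sq[of 0 "x + z"] S0[of x z] by (simp add: S_def)
  have Sm: "(\<lambda>(x, z). S x z) \<in> borel_measurable (borel \<Otimes>\<^sub>M borel)" unfolding S_def by measurable
  have [measurable]: "(\<lambda>z. S x z) \<in> borel_measurable borel" for x unfolding S_def by measurable
  have \<Phi>S: "\<bar>\<Phi> T x z - \<Phi> 0 x z\<bar> \<le> S x z" for x z
  proof -
    have "\<bar>\<Phi> t x z\<bar> \<le> (\<mu> t x)\<^sup>2 + (\<mu> t (x + z))\<^sup>2" for t
    proof -
      have "\<bar>\<Phi> t x z\<bar> = (\<mu> t (x + z) - \<mu> t x)\<^sup>2 / 2"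
        by (simp add: \<Phi>_def diff_op_def abs_mult power2_eq_square)
      also have "\<dots> \<le> (\<mu> t x)\<^sup>2 + (\<mu> t (x + z))\<^sup>2"
        using zero_le_power2[of "\<mu> t (x + z) + \<mu> t x"] by (simp add: power2_eq_square algebra_simps)
      finally show ?thesis .
    qed
    from this[of T] this[of 0] show ?thesis by (simp add: S_def)
  qed
  have inner: "\<bar>\<integral>z. \<Phi> T x z - \<Phi> 0 x z \<partial>seg 0 h\<bar> \<le> (\<integral>z. S x z \<partial>seg 0 h)" for x
  proof -
    have "\<bar>\<integral>z. \<Phi> T x z - \<Phi> 0 x z \<partial>seg 0 h\<bar> \<le> (\<integral>z. \<bar>\<Phi> T x z - \<Phi> 0 x z\<bar> \<partial>seg 0 h)" by (rule integral_abs_bound)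
    also have "\<dots> \<le> (\<integral>z. S x z \<partial>seg 0 h)"
    proof (rule integral_mono)
      show i: "integrable (seg 0 h) (\<lambda>z. S x z)" by (rule integrable_seg_bounded[where B = "4 * B\<^sup>2"]) (simp, rule SB)
      show "integrable (seg 0 h) (\<lambda>z. \<bar>\<Phi> T x z - \<Phi> 0 x z\<bar>)"
      proof (rule integrable_seg_bounded)
        show "(\<lambda>z. \<bar>\<Phi> T x z - \<Phi> 0 x z\<bar>) \<in> borel_measurable borel" unfolding \<Phi>_def diff_op_def by measurable
        show "\<bar>\<bar>\<Phi> T x z - \<Phi> 0 x z\<bar>\<bar> \<le> 4 * B\<^sup>2" for z using \<Phi>S[of x z] SB[of x z] by linarith
      qed
    qed (rule \<Phi>S)
    finally show ?thesis .
  qed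
  have iS: "integrable circ (\<lambda>x. \<integral>z. S x z \<partial>seg 0 h)"
    unfolding circ_eq_seg by (rule integrable_integral_seg[OF Sm SB])
  have "\<bar>\<integral>x. (\<integral>z. \<Phi> T x z - \<Phi> 0 x z \<partial>seg 0 h) \<partial>circ\<bar> \<le> (\<integral>x. \<bar>\<integral>z. \<Phi> T x z - \<Phi> 0 x z \<partial>seg 0 h\<bar> \<partial>circ)"
    by (rule integral_abs_bound)
  also have "\<dots> \<le> (\<integral>x. (\<integral>z. S x z \<partial>seg 0 h) \<partial>circ)"
  proof (rule integral_mono_AE')
    show "AE x in circ. \<bar>\<integral>z. \<Phi> T x z - \<Phi> 0 x z \<partial>seg 0 h\<bar> \<le> (\<integral>z. S x z \<partial>seg 0 h)" using inner by simp
    show "AE x in circ. 0 \<le> (\<integral>z. S x z \<partial>seg 0 h)" by (simp add: S0)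
  qed (rule iS)
  also have "\<dots> = (\<integral>z. (\<integral>x. S x z \<partial>circ) \<partial>seg 0 h)"
    unfolding circ_eq_seg by (rule Fubini_seg[OF Sm SB])
  also have "\<dots> = (\<integral>z. 2 * ((\<integral>x. (\<mu> 0 x)\<^sup>2 \<partial>circ) + (\<integral>x. (\<mu> T x)\<^sup>2 \<partial>circ)) \<partial>seg 0 h)"
  proof (rule Bochner_Integration.integral_cong[OF refl])
    fix z
    have s: "(\<integral>x. (\<mu> t (x + z))\<^sup>2 \<partial>circ) = (\<integral>x. (\<mu> t x)\<^sup>2 \<partial>circ)" for t
      by (rule integral_circ_shift[where f = "\<lambda>x. (\<mu> t x)\<^sup>2"]) (auto simp: lip_circ_periodic[OF lip])
    have i: "integrable circ (\<lambda>x. (\<mu> t (x + p))\<^sup>2)" for t p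
      by (rule integrable_circ_bounded[where B = "B\<^sup>2"]) (use sq in auto)
    show "(\<integral>x. S x z \<partial>circ) = 2 * ((\<integral>x. (\<mu> 0 x)\<^sup>2 \<partial>circ) + (\<integral>x. (\<mu> T x)\<^sup>2 \<partial>circ))"
      unfolding S_def using i[of T 0] i[of T z] i[of 0 0] i[of 0 z] by (simp add: s)
  qed
  finally show ?thesis unfolding eq using h by (simp add: mult_ac)
qed

section \<open>Norms as integrals and their measurability in time\<close>

lemma Lp_norm_power:
  assumes "0 < n"
  shows "(Lp_norm (real n) f) ^ n = (\<integral>\<^sup>+x. ennreal (\<bar>f x\<bar> ^ n) \<partial>circ)"
proof -
  have pow: "(ennpow X (1 / real n)) ^ n = X" for X
  proof (cases X)
    case (real r)
    have "(r powr (1 / real n)) ^ n = r"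
      using real assms by (cases "r = 0") (auto simp: powr_realpow[symmetric] powr_powr)
    then show ?thesis using real by (simp add: ennpow_def ennreal_power)
  next
    case top
    then show ?thesis using assms by (simp add: ennpow_def power_eq_top_ennreal)
  qed
  have "\<bar>x\<bar> powr real n = \<bar>x\<bar> ^ n" for x :: real
    using assms by (cases "x = 0") (auto simp: powr_realpow)
  then show ?thesis unfolding Lp_norm_def pow nn_integral_circ by simp
qed

lemma Lp_norm_power_bounded:
  assumes n: "0 < n" and f: "f \<in> borel_measurable borel" "\<And>x. \<bar>f x\<bar> \<le> B"
  shows "(Lp_norm (real n) f) ^ n = ennreal (\<integral>x. \<bar>f x\<bar> ^ n \<partial>circ)"
  unfolding Lp_norm_power[OF n]
proof (rule nn_integral_eq_integral)
  show "integrable circ (\<lambda>x. \<bar>f x\<bar> ^ n)"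
  proof (rule integrable_circ_bounded)
    show "norm (\<bar>f x\<bar> ^ n) \<le> B ^ n" for x using power_mono[OF f(2)[of x], of n] by (simp add: power_abs)
  qed (use f(1) in measurable)
qed simp

lemma ennpow_1: "ennpow x 1 = x"
  by (cases x) (auto simp: ennpow_def)

lemma nn_integral_seg: "(\<integral>\<^sup>+t\<in>{0<..<T}. f t \<partial>lborel) = (\<integral>\<^sup>+t. f t \<partial>seg 0 T)"
proof -
  have "(\<integral>\<^sup>+t. f t \<partial>seg 0 T) = (\<integral>\<^sup>+t\<in>{0..T}. f t \<partial>lborel)"
    unfolding seg_def by (simp add: nn_integral_restrict_space)
  also have "\<dots> = (\<integral>\<^sup>+t\<in>{0<..<T}. f t \<partial>lborel)"
  proof (intro nn_integral_cong_AE)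
    have "AE t in lborel. t \<noteq> 0 \<and> t \<noteq> T" by (intro AE_conjI AE_lborel_singleton)
    then show "AE t in lborel. f t * indicator {0..T} t = f t * indicator {0<..<T} t"
      by eventually_elim (auto simp: indicator_def)
  qed
  finally show ?thesis by simp
qed

lemma AE_seg:
  assumes "AE t in lborel. t \<in> {0<..<T} \<longrightarrow> P t"
  shows "AE t in seg 0 T. t \<in> {0<..<T} \<and> P t"
proof -
  have "AE t in lborel. t \<noteq> 0 \<and> t \<noteq> T" by (intro AE_conjI AE_lborel_singleton)
  with assms have "AE t in lborel. t \<in> {0..T} \<longrightarrow> t \<in> {0<..<T} \<and> P t"
    by eventually_elim auto
  then show ?thesis unfolding seg_def by (subst AE_restrict_space_iff) auto
qed

lemma Tonelli_seg:
  fixes f :: "real \<Rightarrow> real \<Rightarrow> ennreal"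
  assumes [measurable]: "(\<lambda>(t, h). f t h) \<in> borel_measurable (borel \<Otimes>\<^sub>M borel)"
  shows "(\<integral>\<^sup>+t. (\<integral>\<^sup>+h. f t h \<partial>lborel) \<partial>seg a b) = (\<integral>\<^sup>+h. (\<integral>\<^sup>+t. f t h \<partial>seg a b) \<partial>lborel)"
proof -
  have "(\<integral>\<^sup>+t. (\<integral>\<^sup>+h. f t h \<partial>lborel) \<partial>seg a b) = (\<integral>\<^sup>+t. (\<integral>\<^sup>+h. f t h * indicator {a..b} t \<partial>lborel) \<partial>lborel)"
    unfolding seg_def by (simp add: nn_integral_restrict_space nn_integral_multc)
  also have "\<dots> = (\<integral>\<^sup>+h. (\<integral>\<^sup>+t. f t h * indicator {a..b} t \<partial>lborel) \<partial>lborel)"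
    by (rule lborel_pair.Fubini') measurable
  finally show ?thesis unfolding seg_def by (simp add: nn_integral_restrict_space)
qed

text \<open>Passage from a pointwise estimate with a signed term to an integrated one in
  \<open>ennreal\<close>: the integral of \<open>a0 * X\<close> is that of \<open>P\<close>, at most
  \<open>b\<close>, plus that of \<open>a0 * X - P\<close>, which is at most the integral of its
  positive part, that is of \<open>ennreal (a0 * X - P)\<close>. The bound \<open>E\<close> may be
  infinite.\<close>

lemma nn_integral_seg_estimate:
  fixes X P :: "real \<Rightarrow> real"
  assumes a0: "0 \<le> a0"
    and X [measurable]: "X \<in> borel_measurable borel" "\<And>t. \<bar>X t\<bar> \<le> K" "\<And>t. 0 \<le> X t"
    and P [measurable]: "P \<in> borel_measurable borel" "\<And>t. \<bar>P t\<bar> \<le> K'"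
    and IP: "\<bar>\<integral>t. P t \<partial>seg 0 T\<bar> \<le> b"
    and le: "AE t in seg 0 T. ennreal (a0 * X t - P t) \<le> E t"
  shows "ennreal a0 * (\<integral>\<^sup>+t. ennreal (X t) \<partial>seg 0 T) \<le> ennreal b + (\<integral>\<^sup>+t. E t \<partial>seg 0 T)"
proof -
  have iX: "integrable (seg 0 T) X" by (rule integrable_seg_bounded[OF X(1,2)])
  have iP: "integrable (seg 0 T) P" by (rule integrable_seg_bounded[OF P])
  have i: "integrable (seg 0 T) (\<lambda>t. a0 * X t - P t)" using iX iP by simp
  have "ennreal a0 * (\<integral>\<^sup>+t. ennreal (X t) \<partial>seg 0 T) = ennreal (a0 * (\<integral>t. X t \<partial>seg 0 T))"
    using iX X(3) a0 by (simp add: nn_integral_eq_integral ennreal_mult)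
  also have "a0 * (\<integral>t. X t \<partial>seg 0 T) = (\<integral>t. P t \<partial>seg 0 T) + (\<integral>t. a0 * X t - P t \<partial>seg 0 T)"
    using iX iP by simp
  also have "ennreal \<dots> \<le> ennreal (b + (\<integral>t. max 0 (a0 * X t - P t) \<partial>seg 0 T))"
    using i IP by (intro ennreal_leI add_mono integral_mono) auto
  also have "\<dots> = ennreal b + ennreal (\<integral>t. max 0 (a0 * X t - P t) \<partial>seg 0 T)"
    using IP by (intro ennreal_plus) auto
  also have "ennreal (\<integral>t. max 0 (a0 * X t - P t) \<partial>seg 0 T) = (\<integral>\<^sup>+t. ennreal (max 0 (a0 * X t - P t)) \<partial>seg 0 T)"
    using i by (intro nn_integral_eq_integral[symmetric]) auto
  also have "\<dots> = (\<integral>\<^sup>+t. ennreal (a0 * X t - P t) \<partial>seg 0 T)"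
    by (intro nn_integral_cong) (auto simp: max_def ennreal_neg)
  also have "\<dots> \<le> (\<integral>\<^sup>+t. E t \<partial>seg 0 T)" by (intro nn_integral_mono_AE le)
  finally show ?thesis by (simp add: add_left_mono)
qed

text \<open>The sum over frequencies is rewritten along an enumeration of the integers, a countable
  series that preserves measurability in \<open>t\<close>.\<close>

lemma measurable_H_norm_square:
  assumes [measurable]: "(\<lambda>(t, y). g t y) \<in> borel_measurable (borel \<Otimes>\<^sub>M borel)"
  shows "(\<lambda>t. (H_norm r (fc (g t)))\<^sup>2) \<in> borel_measurable borel"
proof -
  have [measurable]: "(\<lambda>t. fc (g t) k) \<in> borel_measurable borel" for k
    unfolding fc_eq_cfc cfc_def circ_eq_seg by (rule borel_measurable_integral_seg) measurable
  have "(\<lambda>t. \<integral>\<^sup>+k. ennreal ((1 + (2 * pi * of_int k)\<^sup>2) powr r * (cmod (fc (g t) k))\<^sup>2) \<partial>count_space UNIV) \<in> borel_measurable borel"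
    unfolding nn_integral_count_space_int_eq_suminf by measurable
  then show ?thesis unfolding H_norm_square .
qed

lemma Hoelder_norm_leD:
  assumes "Hoelder_norm \<beta> f \<le> ennreal A" "0 \<le> A"
  shows "\<bar>f x\<bar> \<le> A" "\<bar>f x - f y\<bar> \<le> A * \<bar>x - y\<bar> powr \<beta>"
proof -
  have "ennreal \<bar>f x\<bar> \<le> (SUP x. ennreal \<bar>f x\<bar>)" by (rule SUP_upper) simp
  also have "\<dots> \<le> Hoelder_norm \<beta> f" unfolding Hoelder_norm_def by simp
  finally show "\<bar>f x\<bar> \<le> A" using assms by (meson ennreal_le_iff order_trans)
  show "\<bar>f x - f y\<bar> \<le> A * \<bar>x - y\<bar> powr \<beta>"
  proof (cases "x = y")
    case False
    have "ennreal (\<bar>f x - f y\<bar> / \<bar>x - y\<bar> powr \<beta>)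
        \<le> (SUP (x, y)\<in>{(x, y). x \<noteq> y}. ennreal (\<bar>f x - f y\<bar> / \<bar>x - y\<bar> powr \<beta>))"
      using False by (intro SUP_upper2[of "(x, y)"]) auto
    also have "\<dots> \<le> Hoelder_norm \<beta> f" unfolding Hoelder_norm_def by simp
    finally have "\<bar>f x - f y\<bar> / \<bar>x - y\<bar> powr \<beta> \<le> A" using assms by (meson ennreal_le_iff order_trans)
    then show ?thesis using False by (simp add: pos_divide_le_eq)
  qed (use assms in simp)
qed

lemma L2r_of_Lp_norm:
  assumes [measurable]: "f \<in> borel_measurable borel" and "Lp_norm 2 f < top"
  shows "L2r f"
proof -
  have "(Lp_norm (real 2) f) ^ 2 < top" using assms(2) by (simp add: power2_eq_square ennreal_mult_less_top)
  then have "(\<integral>\<^sup>+x. ennreal (norm (\<bar>f x\<bar> ^ 2)) \<partial>circ) < \<infinity>"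
    by (subst (asm) Lp_norm_power) auto
  then have "integrable circ (\<lambda>x. \<bar>f x\<bar> ^ 2)" by (intro integrableI_bounded) measurable
  then show ?thesis by (simp add: L2c_def)
qed

lemma spacetime_measurable_extend:
  assumes "spacetime_measurable T g"
  shows "(\<lambda>(t, y). if t \<in> {0<..<T} then g t y else 0) \<in> borel_measurable (borel \<Otimes>\<^sub>M borel)"
proof -
  have "(\<lambda>p. if p \<in> {0<..<T} \<times> UNIV then (case p of (t, y) \<Rightarrow> g t y) else 0) \<in> borel_measurable borel"
    using assms unfolding spacetime_measurable_def
    by (subst (asm) measurable_restrict_space_iff) (auto simp: open_Times)
  also have "(\<lambda>p. if p \<in> {0<..<T} \<times> UNIV then (case p of (t, y) \<Rightarrow> g t y) else 0)
      = (\<lambda>(t, y). if t \<in> {0<..<T} then g t y else 0)" by auto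
  finally show ?thesis by (simp add: borel_prod)
qed

text \<open>Brings the two regimes to one form: at \<open>\<gamma> = 2\<close> the nonnegative
  summand with \<open>D_op\<close> is dropped.\<close>

lemma operator_bounds_D:
  assumes "operator_bounds \<gamma> M T \<psi>" "t \<in> {0..T}" "smooth_circle f" "\<gamma> \<le> 2"
  shows "H_norm (- \<gamma> / 2) (A_op \<gamma> (\<psi> t) f) \<le> ennreal M * H_norm (\<gamma> / 2) (fc f)"
proof (cases "\<gamma> = 2")
  case True
  have "H_norm (- 1) (A_op 2 (\<psi> t) f) \<le> Lp_norm 2 (D_op 2 (\<psi> t) f) + H_norm (- 1) (A_op 2 (\<psi> t) f)" by simp
  also have "\<dots> \<le> ennreal M * H_norm 1 (fc f)" using assms True unfolding operator_bounds_def by auto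
  finally show ?thesis using True by simp
qed (use assms in \<open>auto simp: operator_bounds_def\<close>)

section \<open>Integration over time and over the increment\<close>

theorem proposition3p3:
  fixes \<gamma> s \<beta> a_star M :: real
  assumes "1 < \<gamma>" "\<gamma> \<le> 2" "0 < s" "s < 1 / 3" "0 < \<beta>" "\<beta> < 1" "0 < a_star" "0 \<le> M"
  shows "\<exists>C > 0. \<forall>(T :: real) (\<psi> :: real \<Rightarrow> real \<Rightarrow> real) (a :: real \<Rightarrow> real \<Rightarrow> real)
      (G :: real \<Rightarrow> real \<Rightarrow> real) (m :: real \<Rightarrow> real \<Rightarrow> real).
    0 < T \<longrightarrow>
    (\<forall>t\<in>{0..T}. bilipschitz_circle_map (\<psi> t)) \<longrightarrow>
    operator_bounds \<gamma> M T \<psi> \<longrightarrow>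
    in_LinfC T \<beta> a \<longrightarrow>
    (AE t in lborel. t \<in> {0<..<T} \<longrightarrow> (\<forall>y. a_star \<le> a t y)) \<longrightarrow>
    in_L2H T (1 - \<gamma> / 2) G \<longrightarrow>
    smooth_spacetime T m \<longrightarrow>
    solves_transformed_eq \<gamma> T \<psi> a G m \<longrightarrow>
    K_energy T s m \<le> ennreal C *
      ((Lp_norm 2 (m 0))\<^sup>2 + (Lp_norm 2 (m T))\<^sup>2
       + (\<integral>\<^sup>+t\<in>{0<..<T}. (H_norm (\<gamma> / 2) (fc (m t)))\<^sup>2 \<partial>lborel)
       + LinfC_norm T \<beta> a * Z_energy T \<beta> m
       + (L2H_norm T (1 - \<gamma> / 2) G)\<^sup>2)"
proof -
  \<comment> \<open>The integral of \<open>h powr (- (3 * s))\<close> over \<open>{0<..<1}\<close>,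
    finite because \<open>3 * s < 1\<close>.\<close>
  define \<kappa> where "\<kappa> = 1 / (1 - 3 * s)"
  \<comment> \<open>A common bound for four coefficients: \<open>2 * \<kappa>\<close> for the end
    times, \<open>\<kappa> * (M^2 + 64)\<close> for the Sobolev term, \<open>\<kappa>\<close> for
    \<open>G\<close>, and \<open>4 * \<kappa> + 1\<close> for the Besov term, where the 1 pays for
    the Hoelder error.\<close>
  define C0 where "C0 = 4 * \<kappa> + \<kappa> * (M\<^sup>2 + 64) + 1"
  have \<kappa>: "0 < \<kappa>" using assms by (simp add: \<kappa>_def)
  have C0: "2 * \<kappa> \<le> C0" "\<kappa> * (M\<^sup>2 + 64) \<le> C0" "\<kappa> \<le> C0" "4 * \<kappa> + 1 \<le> C0"
    using \<kappa> mult_nonneg_nonneg[of \<kappa> "M\<^sup>2 + 64"] by (auto simp: C0_def)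
  have C0pos: "0 < C0" using C0(3) \<kappa> by linarith
  show ?thesis
  \<comment> \<open>\<open>3 / a_star\<close> inverts the coercivity constant
    \<open>a_star / 3\<close> of the cubic term.\<close>
  proof (intro exI[of _ "3 / a_star * C0"] conjI allI impI)
    show "0 < 3 / a_star * C0" using assms C0pos by simp
    fix T :: real and \<psi> a G m :: "real \<Rightarrow> real \<Rightarrow> real"
    assume T: "0 < T" and opb: "operator_bounds \<gamma> M T \<psi>" and aC: "in_LinfC T \<beta> a"
      and alow: "AE t in lborel. t \<in> {0<..<T} \<longrightarrow> (\<forall>y. a_star \<le> a t y)"
      and GH: "in_L2H T (1 - \<gamma> / 2) G" and sm: "smooth_spacetime T m"
      and sol: "solves_transformed_eq \<gamma> T \<psi> a G m"
    obtain \<mu> c :: "real \<Rightarrow> real \<Rightarrow> real" and L B :: real where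
        \<mu>m: "\<And>t. t \<in> {0..T} \<Longrightarrow> \<mu> t = m t"
      and \<mu>c: "continuous_on UNIV (\<lambda>(t, y). \<mu> t y)" and cc: "continuous_on UNIV (\<lambda>(t, y). c t y)"
      and lip: "\<And>t. lip_circ L (\<mu> t)" and \<mu>B: "\<And>t y. \<bar>\<mu> t y\<bar> \<le> B" and cB: "\<And>t y. \<bar>c t y\<bar> \<le> B"
      and cper: "\<And>t y. c t (y + 1) = c t y"
      and der: "\<And>t y. t \<in> {0..T} \<Longrightarrow> ((\<lambda>\<tau>. \<mu> \<tau> y) has_real_derivative c t y) (at t within {0..T})"
      and smc: "\<And>t. t \<in> {0..T} \<Longrightarrow> smooth_circle (m t)"
      and mt: "\<And>t y. t \<in> {0<..<T} \<Longrightarrow> deriv (\<lambda>\<tau>. m \<tau> y) t = c t y"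
      using smooth_spacetime_extension[OF T sm] by blast
    have [measurable]: "(\<lambda>(t, y). \<mu> t y) \<in> borel_measurable (borel \<Otimes>\<^sub>M borel)"
      "(\<lambda>(t, y). c t y) \<in> borel_measurable (borel \<Otimes>\<^sub>M borel)"
      by (rule continuous_on_pair_measurable, fact)+
    have B: "0 \<le> B" using \<mu>B[of 0 0] by linarith
    \<comment> \<open>Extension by zero turns measurability on the open strip into Borel
      measurability on the plane.\<close>
    define G' where "G' t y = (if t \<in> {0<..<T} then G t y else 0)" for t y
    define a' where "a' t y = (if t \<in> {0<..<T} then a t y else 0)" for t y
    have [measurable]: "(\<lambda>(t, y). G' t y) \<in> borel_measurable (borel \<Otimes>\<^sub>M borel)"
      unfolding G'_def using GH by (intro spacetime_measurable_extend) (simp add: in_L2H_def)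
    have [measurable]: "(\<lambda>(t, y). a' t y) \<in> borel_measurable (borel \<Otimes>\<^sub>M borel)"
      unfolding a'_def using aC by (intro spacetime_measurable_extend) (simp add: in_LinfC_def)
    have slices [measurable]: "G t \<in> borel_measurable borel" "a t \<in> borel_measurable borel" if "t \<in> {0<..<T}" for t
    proof -
      have "G' t \<in> borel_measurable borel" "a' t \<in> borel_measurable borel" by measurable
      moreover have "G' t = G t" "a' t = a t" using that by (auto simp: G'_def a'_def)
      ultimately show "G t \<in> borel_measurable borel" "a t \<in> borel_measurable borel" by simp_all
    qed
    define A where "A = enn2real (LinfC_norm T \<beta> a)"
    have A0: "0 \<le> A" by (simp add: A_def)
    have AL: "ennreal A = LinfC_norm T \<beta> a" using aC by (simp add: A_def in_LinfC_def)
    \<comment> \<open>The essential supremum refers to the completed measure; almost-everywhere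
      statements return to \<open>lborel\<close> unchanged.\<close>
    have aH: "AE t in lborel. t \<in> {0<..<T} \<longrightarrow> Hoelder_norm \<beta> (a t) \<le> ennreal A"
    proof -
      have "AE t in lebesgue_on {0<..<T}. Hoelder_norm \<beta> (a t) \<le> ennreal A"
        unfolding AL LinfC_norm_def by (rule esssup_AE)
      then have "AE t in completion lborel. t \<in> {0<..<T} \<longrightarrow> Hoelder_norm \<beta> (a t) \<le> ennreal A"
        by (subst (asm) AE_restrict_space_iff) auto
      then show ?thesis by (simp only: AE_completion_iff)
    qed
    \<comment> \<open>\<open>X\<close> is the cubic quantity to be bounded and \<open>P\<close> the
      signed pairing with the time derivative; \<open>Y\<close> and \<open>W\<close> are the
      \<open>L^1\<close> increment and the Besov seminorm of the cube at a fixed time.\<close>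
    define X where "X h t = (\<integral>x. \<bar>diff_op h (\<mu> t) x\<bar> ^ 3 \<partial>circ)" for h t
    define Y where "Y h t = (\<integral>x. \<bar>diff_op h (\<lambda>x. \<mu> t x ^ 3) x\<bar> \<partial>circ)" for h t
    define P where "P h t = (\<integral>x. c t x * psi (\<mu> t) h x \<partial>circ)" for h t
    define W where "W t = (\<integral>\<^sup>+\<rho>\<in>{0<..<1}. ennreal (\<rho> powr (\<beta> - 2) * Y \<rho> t) \<partial>lborel)" for t
    define Hm where "Hm t = (H_norm (\<gamma> / 2) (fc (\<mu> t)))\<^sup>2" for t
    define HG where "HG t = (H_norm (1 - \<gamma> / 2) (fc (G' t)))\<^sup>2" for t
    define e where "e t = (\<integral>x. (\<mu> t x)\<^sup>2 \<partial>circ)" for t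
    have X0: "0 \<le> X h t" and Y0: "0 \<le> Y h t" and e0: "0 \<le> e t" for h t by (simp_all add: X_def Y_def e_def)
    have Xm [measurable]: "(\<lambda>(h, t). X h t) \<in> borel_measurable (borel \<Otimes>\<^sub>M borel)"
    proof -
      have "(\<lambda>(p, x). \<bar>diff_op (fst p) (\<mu> (snd p)) x\<bar> ^ 3) \<in> borel_measurable ((borel \<Otimes>\<^sub>M borel) \<Otimes>\<^sub>M borel)"
        unfolding diff_op_def by measurable
      from borel_measurable_integral_seg[OF this, of 0 1] show ?thesis
        unfolding X_def circ_eq_seg by (simp add: case_prod_beta')
    qed
    have Ym [measurable]: "(\<lambda>(h, t). Y h t) \<in> borel_measurable (borel \<Otimes>\<^sub>M borel)"
    proof -
      have "(\<lambda>(p, x). \<bar>diff_op (fst p) (\<lambda>x. \<mu> (snd p) x ^ 3) x\<bar>) \<in> borel_measurable ((borel \<Otimes>\<^sub>M borel) \<Otimes>\<^sub>M borel)"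
        unfolding diff_op_def by measurable
      from borel_measurable_integral_seg[OF this, of 0 1] show ?thesis
        unfolding Y_def circ_eq_seg by (simp add: case_prod_beta')
    qed
    have Wm [measurable]: "W \<in> borel_measurable borel" unfolding W_def by measurable
    have Hmm [measurable]: "Hm \<in> borel_measurable borel" unfolding Hm_def by (rule measurable_H_norm_square) simp
    have HGm [measurable]: "HG \<in> borel_measurable borel" unfolding HG_def by (rule measurable_H_norm_square) simp
    have Pm: "P h \<in> borel_measurable borel" for h
    proof -
      have "(\<lambda>(p, z). \<bar>\<mu> (fst p) (snd p) - \<mu> (fst p) (snd p - z)\<bar> - \<bar>\<mu> (fst p) (snd p + z) - \<mu> (fst p) (snd p)\<bar>)
          \<in> borel_measurable ((borel \<Otimes>\<^sub>M borel) \<Otimes>\<^sub>M borel)" by measurable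
      from borel_measurable_integral_seg[OF this, of 0 h]
      have [measurable]: "(\<lambda>(t, x). psi (\<mu> t) h x) \<in> borel_measurable (borel \<Otimes>\<^sub>M borel)"
        unfolding psi_def by (simp add: case_prod_beta')
      show ?thesis unfolding P_def circ_eq_seg by (rule borel_measurable_integral_seg) measurable
    qed
    have dB: "\<bar>diff_op h (\<mu> t) x\<bar> \<le> 2 * B" for h t x
      using \<mu>B[of t x] \<mu>B[of t "x + h"] unfolding diff_op_def by linarith
    have N: "lip_circ (3 * B\<^sup>2 * L) (\<lambda>x. \<mu> t x ^ 3)" for t by (rule lip_circ_cube[OF lip \<mu>B])
    have Xb: "\<bar>X h t\<bar> \<le> (2 * B) ^ 3" for h t
    proof -
      have "\<bar>X h t\<bar> \<le> (1 - 0) * (2 * B) ^ 3"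
        unfolding X_def circ_eq_seg
      proof (rule integral_seg_le)
        show "\<bar>\<bar>diff_op h (\<mu> t) x\<bar> ^ 3\<bar> \<le> (2 * B) ^ 3" for x
          using power_mono[OF dB[of h t x], of 3] by (simp add: power_abs)
      qed simp
      then show ?thesis by simp
    qed
    have Pb: "\<bar>P h t\<bar> \<le> B * (2 * h * (2 * B))" if "0 < h" for h t
    proof -
      have "\<bar>psi (\<mu> t) h x\<bar> \<le> (h - 0) * (2 * (2 * B))" for x
        unfolding psi_def
      proof (rule integral_seg_le)
        fix z
        show "\<bar>\<bar>\<mu> t x - \<mu> t (x - z)\<bar> - \<bar>\<mu> t (x + z) - \<mu> t x\<bar>\<bar> \<le> 2 * (2 * B)"
          using \<mu>B[of t x] \<mu>B[of t "x - z"] \<mu>B[of t "x + z"] by linarith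
      qed (use that in simp)
      then have "\<bar>c t x * psi (\<mu> t) h x\<bar> \<le> B * (2 * h * (2 * B))" for x
        unfolding abs_mult using cB[of t x] B by (intro mult_mono) (auto simp: mult_ac)
      then have "\<bar>P h t\<bar> \<le> (1 - 0) * (B * (2 * h * (2 * B)))"
        unfolding P_def circ_eq_seg by (intro integral_seg_le) auto
      then show ?thesis by simp
    qed
    define E where "E h t = ennreal (A * h powr \<beta>) * ennreal (Y h t)
      + (ennreal (4 * h) * (ennreal A * W t) + ennreal h * (ennreal (M\<^sup>2 + 64) * Hm t + HG t))" for h t
    have pointwise: "AE t in seg 0 T. ennreal (a_star / 3 * X h t - P h t) \<le> E h t" if h: "0 < h" for h
    proof -
      have "AE t in lborel. t \<in> {0<..<T} \<longrightarrow> Lp_norm 2 (G t) < top"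
        using GH by (simp add: in_L2H_def)
      moreover have "AE t in lborel. t \<in> {0<..<T} \<longrightarrow>
        (\<forall>k. fc (\<lambda>y. deriv (\<lambda>\<tau>. m \<tau> y) t) k + A_op \<gamma> (\<psi> t) (m t) k = Dx (fc (\<lambda>y. a t y * (m t y)\<^sup>2 + G t y)) k)"
        using sol by (simp add: solves_transformed_eq_def)
      ultimately have "AE t in lborel. t \<in> {0<..<T} \<longrightarrow> ennreal (a_star / 3 * X h t - P h t) \<le> E h t"
        using alow aH
      proof eventually_elim
        case (elim t)
        show ?case
        proof
          assume t: "t \<in> {0<..<T}"
          then have t': "t \<in> {0..T}" by auto
          have GG: "G' t = G t" using t by (auto simp: G'_def)
          have aper: "a t (x + 1) = a t x" for x
            using aC t by (simp add: in_LinfC_def spacetime_measurable_def periodic1_def)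
          have aHt: "Hoelder_norm \<beta> (a t) \<le> ennreal A" using elim t by simp
          have "c t \<in> borel_measurable borel" by measurable
          then have cL: "L2r (c t)" by (intro L2c_bounded[where B = B]) (auto simp: cB)
          have eqn: "fc (c t) k + A_op \<gamma> (\<psi> t) (m t) k = Dx (fc (\<lambda>y. a t y * (\<mu> t y)\<^sup>2 + G t y)) k" for k
            using elim t by (simp add: mt[OF t] \<mu>m[OF t'])
          have op: "H_norm (- \<gamma> / 2) (A_op \<gamma> (\<psi> t) (m t)) \<le> ennreal M * H_norm (\<gamma> / 2) (fc (\<mu> t))"
            unfolding \<mu>m[OF t'] using assms by (intro operator_bounds_D[OF opb t' smc[OF t']]) auto
          show "ennreal (a_star / 3 * X h t - P h t) \<le> E h t"
            unfolding X_def P_def E_def Y_def W_def Hm_def HG_def GG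
            by (rule fixed_time_estimate[OF _ _ _ _ h lip N \<mu>B slices(2)[OF t] Hoelder_norm_leD(1)[OF aHt A0] aper
                  Hoelder_norm_leD(2)[OF aHt A0] _ L2r_of_Lp_norm[OF slices(1)[OF t]] cL eqn op])
               (use assms elim t in auto)
        qed
      qed
      from AE_seg[OF this] show ?thesis by eventually_elim simp
    qed
    define IW where "IW = (\<integral>\<^sup>+t. W t \<partial>seg 0 T)"
    define IH where "IH = (\<integral>\<^sup>+t. Hm t \<partial>seg 0 T)"
    define IG where "IG = (\<integral>\<^sup>+t. HG t \<partial>seg 0 T)"
    \<comment> \<open>Everything that enters with exactly one factor \<open>h\<close>; the Hoelder
      error, of order \<open>h powr \<beta>\<close>, is kept apart.\<close>
    define R where "R = ennreal (2 * (e 0 + e T)) + (4 * (ennreal A * IW) + (ennreal (M\<^sup>2 + 64) * IH + IG))"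
    \<comment> \<open>Time is integrated at fixed \<open>h\<close>, before \<open>h\<close> itself:
      the signed term \<open>P\<close> is controlled only after integration over
      \<open>{0..T}\<close>.\<close>
    have fixed_h: "ennreal (a_star / 3) * (\<integral>\<^sup>+t. ennreal (X h t) \<partial>seg 0 T)
        \<le> ennreal h * R + ennreal (A * h powr \<beta>) * (\<integral>\<^sup>+t. ennreal (Y h t) \<partial>seg 0 T)" if h: "0 < h" for h
    proof -
      have "ennreal (a_star / 3) * (\<integral>\<^sup>+t. ennreal (X h t) \<partial>seg 0 T)
        \<le> ennreal (2 * h * (e 0 + e T)) + (\<integral>\<^sup>+t. E h t \<partial>seg 0 T)"
      proof (rule nn_integral_seg_estimate[OF _ _ Xb X0 Pm Pb[OF h] _ pointwise[OF h]])
        show "\<bar>\<integral>t. P h t \<partial>seg 0 T\<bar> \<le> 2 * h * (e 0 + e T)"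
          unfolding P_def e_def by (rule psi_energy_bound[OF T h \<mu>c cc lip \<mu>B cB cper der])
        show "X h \<in> borel_measurable borel" by measurable
      qed (use assms in simp)
      also have "(\<integral>\<^sup>+t. E h t \<partial>seg 0 T) = ennreal (A * h powr \<beta>) * (\<integral>\<^sup>+t. ennreal (Y h t) \<partial>seg 0 T)
          + (ennreal (4 * h) * (ennreal A * IW) + ennreal h * (ennreal (M\<^sup>2 + 64) * IH + IG))"
      proof -
        have lin: "(\<integral>\<^sup>+t. k1 * f1 t + (k2 * (k3 * f2 t) + k4 * (k5 * f3 t + f4 t)) \<partial>N)
          = k1 * integral\<^sup>N N f1 + (k2 * (k3 * integral\<^sup>N N f2) + k4 * (k5 * integral\<^sup>N N f3 + integral\<^sup>N N f4))"
          if [measurable]: "f1 \<in> borel_measurable N" "f2 \<in> borel_measurable N" "f3 \<in> borel_measurable N" "f4 \<in> borel_measurable N"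
          for f1 f2 f3 f4 :: "real \<Rightarrow> ennreal" and N k1 k2 k3 k4 k5
          by (simp add: nn_integral_add nn_integral_cmult)
        show ?thesis
          unfolding E_def IW_def IH_def IG_def by (rule lin; rule measurable_seg; measurable)
      qed
      also have "ennreal (2 * h * (e 0 + e T)) + (ennreal (A * h powr \<beta>) * (\<integral>\<^sup>+t. ennreal (Y h t) \<partial>seg 0 T)
          + (ennreal (4 * h) * (ennreal A * IW) + ennreal h * (ennreal (M\<^sup>2 + 64) * IH + IG)))
        = ennreal h * R + ennreal (A * h powr \<beta>) * (\<integral>\<^sup>+t. ennreal (Y h t) \<partial>seg 0 T)"
      proof -
        have "ennreal (4 * h) = ennreal h * 4"
          using ennreal_mult'[of h 4] h by (simp add: mult.commute)
        moreover have "ennreal (2 * h * (e 0 + e T)) = ennreal h * ennreal (2 * (e 0 + e T))"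
          using h e0[of 0] e0[of T] by (subst ennreal_mult[symmetric]) (simp_all only: mult_ac, auto)
        ultimately show ?thesis unfolding R_def by (simp only: distrib_left mult.assoc add_ac)
      qed
      finally show ?thesis .
    qed
    have "K_energy T s m = (\<integral>\<^sup>+t. (\<integral>\<^sup>+h. ennreal (h powr (- 1 - 3 * s)) * ennreal (X h t) * indicator {0<..<1} h \<partial>lborel) \<partial>seg 0 T)"
      unfolding K_energy_def nn_integral_seg[where T = T]
    proof (rule nn_integral_cong)
      fix t assume "t \<in> space (seg 0 T)"
      then have t: "t \<in> {0..T}" by simp
      have "(Lp_norm 3 (diff_op h (m t))) ^ 3 = ennreal (X h t)" for h
      proof -
        have "diff_op h (\<mu> t) \<in> borel_measurable borel" unfolding diff_op_def by measurable
        from Lp_norm_power_bounded[OF _ this dB, of 3] show ?thesis by (simp add: X_def \<mu>m[OF t])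
      qed
      then show "(\<integral>\<^sup>+h\<in>{0<..<1}. ennreal (h powr (- 1 - 3 * s)) * (Lp_norm 3 (diff_op h (m t))) ^ 3 \<partial>lborel)
        = (\<integral>\<^sup>+h. ennreal (h powr (- 1 - 3 * s)) * ennreal (X h t) * indicator {0<..<1} h \<partial>lborel)" by simp
    qed
    also have "\<dots> = (\<integral>\<^sup>+h. (\<integral>\<^sup>+t. ennreal (h powr (- 1 - 3 * s)) * ennreal (X h t) * indicator {0<..<1} h \<partial>seg 0 T) \<partial>lborel)"
      by (rule Tonelli_seg) measurable
    finally have K1: "K_energy T s m = (\<integral>\<^sup>+h. (\<integral>\<^sup>+t. ennreal (h powr (- 1 - 3 * s)) * ennreal (X h t) * indicator {0<..<1} h \<partial>seg 0 T) \<partial>lborel)" .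
    have IYm [measurable]: "(\<lambda>h. \<integral>\<^sup>+t. ennreal (Y h t) \<partial>seg 0 T) \<in> borel_measurable borel"
    proof -
      have "(\<lambda>h. \<integral>\<^sup>+t. ennreal (Y h t) * indicator {0..T} t \<partial>lborel) \<in> borel_measurable borel" by measurable
      then show ?thesis unfolding seg_def by (simp add: nn_integral_restrict_space)
    qed
    have IXm [measurable]: "(\<lambda>h. \<integral>\<^sup>+t. ennreal (X h t) \<partial>seg 0 T) \<in> borel_measurable borel"
    proof -
      have "(\<lambda>h. \<integral>\<^sup>+t. ennreal (X h t) * indicator {0..T} t \<partial>lborel) \<in> borel_measurable borel" by measurable
      then show ?thesis unfolding seg_def by (simp add: nn_integral_restrict_space)
    qed
    have K2: "K_energy T s m = (\<integral>\<^sup>+h. ennreal (h powr (- 1 - 3 * s)) * indicator {0<..<1} h * (\<integral>\<^sup>+t. ennreal (X h t) \<partial>seg 0 T) \<partial>lborel)"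
      unfolding K1
    proof (rule nn_integral_cong)
      fix h :: real
      have [measurable]: "(\<lambda>t. ennreal (X h t)) \<in> borel_measurable (seg 0 T)"
        by (rule measurable_seg) measurable
      show "(\<integral>\<^sup>+t. ennreal (h powr (- 1 - 3 * s)) * ennreal (X h t) * indicator {0<..<1} h \<partial>seg 0 T)
        = ennreal (h powr (- 1 - 3 * s)) * indicator {0<..<1} h * (\<integral>\<^sup>+t. ennreal (X h t) \<partial>seg 0 T)"
        by (simp add: nn_integral_cmult nn_integral_multc mult_ac)
    qed
    have IW_eq: "IW = (\<integral>\<^sup>+h. ennreal (h powr (\<beta> - 2)) * indicator {0<..<1} h * (\<integral>\<^sup>+t. ennreal (Y h t) \<partial>seg 0 T) \<partial>lborel)"
    proof -
      have "IW = (\<integral>\<^sup>+h. (\<integral>\<^sup>+t. ennreal (h powr (\<beta> - 2) * Y h t) * indicator {0<..<1} h \<partial>seg 0 T) \<partial>lborel)"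
        unfolding IW_def W_def by (rule Tonelli_seg) measurable
      also have "\<dots> = (\<integral>\<^sup>+h. ennreal (h powr (\<beta> - 2)) * indicator {0<..<1} h * (\<integral>\<^sup>+t. ennreal (Y h t) \<partial>seg 0 T) \<partial>lborel)"
      proof (rule nn_integral_cong)
        fix h :: real
        have [measurable]: "(\<lambda>t. ennreal (Y h t)) \<in> borel_measurable (seg 0 T)"
          by (rule measurable_seg) measurable
        have "(\<integral>\<^sup>+t. ennreal (h powr (\<beta> - 2) * Y h t) * indicator {0<..<1} h \<partial>seg 0 T)
            = (\<integral>\<^sup>+t. (ennreal (h powr (\<beta> - 2)) * indicator {0<..<1} h) * ennreal (Y h t) \<partial>seg 0 T)"
          by (intro nn_integral_cong) (simp add: ennreal_mult Y0 mult_ac)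
        also have "\<dots> = ennreal (h powr (\<beta> - 2)) * indicator {0<..<1} h * (\<integral>\<^sup>+t. ennreal (Y h t) \<partial>seg 0 T)"
          by (rule nn_integral_cmult) measurable
        finally show "(\<integral>\<^sup>+t. ennreal (h powr (\<beta> - 2) * Y h t) * indicator {0<..<1} h \<partial>seg 0 T)
            = ennreal (h powr (\<beta> - 2)) * indicator {0<..<1} h * (\<integral>\<^sup>+t. ennreal (Y h t) \<partial>seg 0 T)" .
      qed
      finally show ?thesis .
    qed
    have "ennreal (a_star / 3) * K_energy T s m
      = (\<integral>\<^sup>+h. ennreal (h powr (- 1 - 3 * s)) * indicator {0<..<1} h * (ennreal (a_star / 3) * (\<integral>\<^sup>+t. ennreal (X h t) \<partial>seg 0 T)) \<partial>lborel)"
      unfolding K2 by (subst nn_integral_cmult[symmetric]) (auto simp: mult_ac)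
    also have "\<dots> \<le> (\<integral>\<^sup>+h. (ennreal (h powr (- (3 * s))) * indicator {0<..<1} h) * R
        + ennreal A * (ennreal (h powr (\<beta> - 2)) * indicator {0<..<1} h * (\<integral>\<^sup>+t. ennreal (Y h t) \<partial>seg 0 T)) \<partial>lborel)"
    proof (rule nn_integral_mono)
      fix h :: real
      let ?Y = "\<integral>\<^sup>+t. ennreal (Y h t) \<partial>seg 0 T"
      show "ennreal (h powr (- 1 - 3 * s)) * indicator {0<..<1} h * (ennreal (a_star / 3) * (\<integral>\<^sup>+t. ennreal (X h t) \<partial>seg 0 T))
        \<le> (ennreal (h powr (- (3 * s))) * indicator {0<..<1} h) * R + ennreal A * (ennreal (h powr (\<beta> - 2)) * indicator {0<..<1} h * ?Y)"
      proof (cases "h \<in> {0<..<1}")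
        case True
        then have h: "0 < h" "h < 1" by auto
        have "ennreal (h powr (- 1 - 3 * s)) * (ennreal (a_star / 3) * (\<integral>\<^sup>+t. ennreal (X h t) \<partial>seg 0 T))
          \<le> ennreal (h powr (- 1 - 3 * s)) * (ennreal h * R + ennreal (A * h powr \<beta>) * ?Y)"
          by (rule mult_left_mono[OF fixed_h[OF h(1)]]) simp
        also have "\<dots> = ennreal (h powr (- 1 - 3 * s)) * ennreal h * R + ennreal (h powr (- 1 - 3 * s)) * ennreal (A * h powr \<beta>) * ?Y"
          by (simp only: distrib_left mult.assoc)
        also have "ennreal (h powr (- 1 - 3 * s)) * ennreal h = ennreal (h powr (- (3 * s)))"
        proof -
          have "h powr (- 1 - 3 * s) * h = h powr (- (3 * s))"
            using powr_add[of h "- 1 - 3 * s" 1] h by simp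
          then show ?thesis using h by (simp flip: ennreal_mult)
        qed
        also have "ennreal (h powr (- 1 - 3 * s)) * ennreal (A * h powr \<beta>) \<le> ennreal A * ennreal (h powr (\<beta> - 2))"
        proof -
          have "h powr (- 1 - 3 * s) * h powr \<beta> = h powr (\<beta> - 1 - 3 * s)" by (simp add: powr_add[symmetric] algebra_simps)
          \<comment> \<open>Since \<open>h < 1\<close> and \<open>3 * s < 1\<close>, the singular
            weight of the Hoelder error is below the Besov weight, so this error costs at most
            \<open>A * IW\<close>.\<close>
          also have "\<dots> \<le> h powr (\<beta> - 2)" using h assms by (intro powr_mono') auto
          finally have "A * (h powr (- 1 - 3 * s) * h powr \<beta>) \<le> A * h powr (\<beta> - 2)" using A0 by (rule mult_left_mono)
          then show ?thesis using A0 by (simp flip: ennreal_mult add: ennreal_leI mult_ac)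
        qed
        finally show ?thesis using True by (simp add: mult.assoc add_left_mono mult_right_mono)
      qed simp
    qed
    also have "\<dots> = ennreal \<kappa> * R + ennreal A * IW"
    proof -
      have "(\<integral>\<^sup>+h. (ennreal (h powr (- (3 * s))) * indicator {0<..<1} h) * R \<partial>lborel) = ennreal \<kappa> * R"
        using nn_integral_powr_0_1[of "- (3 * s)"] assms by (subst nn_integral_multc) (auto simp: \<kappa>_def)
      moreover have "(\<integral>\<^sup>+h. ennreal A * (ennreal (h powr (\<beta> - 2)) * indicator {0<..<1} h * (\<integral>\<^sup>+t. ennreal (Y h t) \<partial>seg 0 T)) \<partial>lborel) = ennreal A * IW"
        unfolding IW_eq by (rule nn_integral_cmult) measurable
      ultimately show ?thesis by (subst nn_integral_add) auto
    qed
    finally have main: "ennreal (a_star / 3) * K_energy T s m \<le> ennreal \<kappa> * R + ennreal A * IW" .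
    define Z where "Z = Z_energy T \<beta> m"
    \<comment> \<open>For order \<open>1 - \<beta>\<close> and \<open>p = q = 1\<close> the weight
      of \<open>Besov_norm\<close> is \<open>- 1 - (1 - \<beta>) = \<beta> - 2\<close>, so
      \<open>W t\<close> is its seminorm part.\<close>
    have IWZ: "IW \<le> Z"
      unfolding IW_def Z_def Z_energy_def nn_integral_seg
    proof (rule nn_integral_mono)
      fix t assume "t \<in> space (seg 0 T)"
      then have t: "t \<in> {0..T}" by simp
      have "Lp_norm 1 (diff_op h (\<lambda>y. m t y ^ 3)) = ennreal (Y h t)" for h
      proof -
        have d: "diff_op h (\<lambda>x. \<mu> t x ^ 3) \<in> borel_measurable borel" unfolding diff_op_def by measurable
        have "\<bar>diff_op h (\<lambda>x. \<mu> t x ^ 3) x\<bar> \<le> 2 * B ^ 3" for x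
        proof -
          have "\<bar>\<mu> t y ^ 3\<bar> \<le> B ^ 3" for y using power_mono[OF \<mu>B[of t y], of 3] by (simp add: power_abs)
          from this[of x] this[of "x + h"] show ?thesis unfolding diff_op_def by linarith
        qed
        from Lp_norm_power_bounded[OF _ d this, of 1] show ?thesis by (simp add: Y_def \<mu>m[OF t])
      qed
      then have "W t = (\<integral>\<^sup>+h\<in>{0<..<1}. ennreal (h powr (- 1 - (1 - \<beta>) * 1)) * ennpow (Lp_norm 1 (diff_op h (\<lambda>y. m t y ^ 3))) 1 \<partial>lborel)"
        unfolding W_def by (simp add: ennpow_1 ennreal_mult Y0 algebra_simps)
      then show "W t \<le> Besov_norm (1 - \<beta>) 1 1 (\<lambda>y. m t y ^ 3)"
        unfolding Besov_norm_def by (simp add: ennpow_1)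
    qed
    define S where "S = (Lp_norm 2 (m 0))\<^sup>2 + (Lp_norm 2 (m T))\<^sup>2
       + (\<integral>\<^sup>+t\<in>{0<..<T}. (H_norm (\<gamma> / 2) (fc (m t)))\<^sup>2 \<partial>lborel)
       + LinfC_norm T \<beta> a * Z_energy T \<beta> m + (L2H_norm T (1 - \<gamma> / 2) G)\<^sup>2"
    have S: "S = ennreal (e 0 + e T) + IH + ennreal A * Z + IG"
    proof -
      have "(Lp_norm 2 (m t))\<^sup>2 = ennreal (e t)" if t: "t \<in> {0..T}" for t
      proof -
        have "\<mu> t \<in> borel_measurable borel" by measurable
        from Lp_norm_power_bounded[OF _ this \<mu>B, of 2] show ?thesis by (simp add: e_def \<mu>m[OF t])
      qed
      from this[of 0] this[of T] have "(Lp_norm 2 (m 0))\<^sup>2 + (Lp_norm 2 (m T))\<^sup>2 = ennreal (e 0 + e T)"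
        using T e0 by simp
      moreover have "(\<integral>\<^sup>+t\<in>{0<..<T}. (H_norm (\<gamma> / 2) (fc (m t)))\<^sup>2 \<partial>lborel) = IH"
        unfolding nn_integral_seg IH_def Hm_def by (intro nn_integral_cong) (simp add: \<mu>m)
      moreover have "(L2H_norm T (1 - \<gamma> / 2) G)\<^sup>2 = IG"
      proof -
        have "(L2H_norm T (1 - \<gamma> / 2) G)\<^sup>2 = (\<integral>\<^sup>+t\<in>{0<..<T}. HG t \<partial>lborel)"
          unfolding L2H_norm_def ennpow_half_square HG_def
          by (intro nn_integral_cong) (auto simp: indicator_def G'_def[abs_def])
        then show ?thesis by (simp add: nn_integral_seg IG_def)
      qed
      ultimately show ?thesis by (simp add: S_def AL Z_def)
    qed
    have "ennreal \<kappa> * R + ennreal A * IW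
      = ennreal (2 * \<kappa>) * ennreal (e 0 + e T) + ennreal (\<kappa> * (M\<^sup>2 + 64)) * IH + ennreal (4 * \<kappa> + 1) * (ennreal A * IW) + ennreal \<kappa> * IG"
    proof -
      have "ennreal \<kappa> * ennreal (2 * (e 0 + e T)) = ennreal (2 * \<kappa>) * ennreal (e 0 + e T)"
        using \<kappa> e0 by (subst (1 2) ennreal_mult[symmetric]) (auto simp: mult_ac)
      moreover have "ennreal (4 * \<kappa> + 1) = ennreal \<kappa> * 4 + 1"
        using \<kappa> ennreal_mult'[of \<kappa> 4] by (simp add: mult.commute)
      moreover have "ennreal (\<kappa> * (M\<^sup>2 + 64)) = ennreal \<kappa> * ennreal (M\<^sup>2 + 64)"
        using \<kappa> by (intro ennreal_mult) auto
      ultimately show ?thesis unfolding R_def by (simp only: distrib_left distrib_right mult.assoc add_ac mult_1_left)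
    qed
    also have "\<dots> \<le> ennreal C0 * ennreal (e 0 + e T) + ennreal C0 * IH + ennreal C0 * (ennreal A * Z) + ennreal C0 * IG"
      using C0 IWZ by (intro add_mono mult_mono ennreal_leI order_refl) auto
    also have "\<dots> = ennreal C0 * S" unfolding S by (simp only: distrib_left)
    finally have "ennreal (a_star / 3) * K_energy T s m \<le> ennreal C0 * S" using main by simp
    then have "ennreal (3 / a_star) * (ennreal (a_star / 3) * K_energy T s m) \<le> ennreal (3 / a_star) * (ennreal C0 * S)"
      by (rule mult_left_mono) simp
    also have "ennreal (3 / a_star) * (ennreal (a_star / 3) * K_energy T s m) = K_energy T s m"
    proof -
      have "ennreal (3 / a_star) * ennreal (a_star / 3) = 1"
        using assms by (subst ennreal_mult[symmetric]) auto
      then show ?thesis by (simp only: mult.assoc[symmetric] mult_1_left)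
    qed
    also have "ennreal (3 / a_star) * (ennreal C0 * S) = ennreal (3 / a_star * C0) * S"
      using assms C0pos by (simp only: mult.assoc[symmetric]) (subst ennreal_mult, auto)
    finally show "K_energy T s m \<le> ennreal (3 / a_star * C0) *
      ((Lp_norm 2 (m 0))\<^sup>2 + (Lp_norm 2 (m T))\<^sup>2
       + (\<integral>\<^sup>+t\<in>{0<..<T}. (H_norm (\<gamma> / 2) (fc (m t)))\<^sup>2 \<partial>lborel)
       + LinfC_norm T \<beta> a * Z_energy T \<beta> m + (L2H_norm T (1 - \<gamma> / 2) G)\<^sup>2)"
      unfolding S_def .
  qed
qed

end
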